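(* Let $\alpha\in\mathbb R\setminus\{0\}$ and let $f\in\mathcal C^\infty_0(\mathbb R_+,\mathbb C)$ have support contained in $[0,\frac{2\pi}{|\alpha|})$. For $k\in\mathbb N^*$ set $$S_k^+(f)=\tfrac12f(0)+\sum_{\ell=1}^\infty e^{i\frac\alpha2\ell^2/k}f\Bigl(\frac\ell k\Bigr).$$ If $f$ is even and $f(x)=\lambda x^{2n}+O(x^{2n+1})$ at the origin, then as $k\to\infty$ $$S_k^+(f)=k^{\frac12-n}\Bigl(\frac\pi{2|\alpha|}\Bigr)^{\frac12}e^{i\frac\pi4\operatorname{sgn}\alpha}\sum_{\ell=0}^\infty k^{-\ell}c_\ell+O(k^{-\infty})\quad\text{with}\quad c_0=\Bigl(\frac i{2\alpha}\Bigr)^n\frac{(2n)!}{n!}\lambda$$ and $c_\ell\in\mathbb C$ for every positive integer $\ell$. If $f$ is odd and $f(x)=\lambda x^{2n+1}+O(x^{2n+2})$ at the origin, then $$S_k^+(f)=k^{-n}\sum_{\ell=0}^\infty k^{-\ell}c_\ell+O(k^{-\infty})\quad\text{with}\quad c_0=\Bigl(\frac{2i}\alpha\Bigr)^{n+1}\frac{n!}2\lambda$$ and $c_\ell\in\mathbb C$ for every positive integer $\ell$.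
   Context: $\mathbb R_+=[0,\infty)$, and $\mathcal C_0^\infty(\mathbb R_+,\mathbb C)$ is the space of smooth (up to $0$) compactly supported functions on $\mathbb R_+$. A function in $\mathcal C^\infty(\mathbb R_+)$ is called even (resp. odd) if its Taylor expansion at the origin contains only even (resp. odd) monomials. Here $n\in\mathbb N$ and $\lambda\in\mathbb C$. Infinite series with $O(k^{-\infty})$ are asymptotic expansions. *)

theory Defs
  imports "HOL-Analysis.Analysis" "HOL-Library.Landau_Symbols"
begin

text \<open>
  A function on the half-line \<open>[0,\<infinity>)\<close> is represented by a total function on the reals. Everything
  below depends only on its values on \<open>{0..}\<close>: derivatives are taken within \<open>{0..}\<close>, hence they are
  one-sided at the origin.
\<close>

definition halfline_deriv :: "nat \<Rightarrow> (real \<Rightarrow> complex) \<Rightarrow> real \<Rightarrow> complex" where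
  "halfline_deriv j = ((\<lambda>g x. vector_derivative g (at x within {0..})) ^^ j)"

definition smooth_halfline :: "(real \<Rightarrow> complex) \<Rightarrow> bool" where
  "smooth_halfline f \<longleftrightarrow> (\<forall>j. halfline_deriv j f differentiable_on {0..})"

definition halfline_support :: "(real \<Rightarrow> complex) \<Rightarrow> real set" where
  "halfline_support f = closure {x \<in> {0..}. f x \<noteq> 0}"

definition smooth_compact_halfline :: "(real \<Rightarrow> complex) set" where
  "smooth_compact_halfline = {f. smooth_halfline f \<and> compact (halfline_support f)}"

definition taylor_coeff_origin :: "(real \<Rightarrow> complex) \<Rightarrow> nat \<Rightarrow> complex" where
  "taylor_coeff_origin f j = halfline_deriv j f 0 / fact j"

definition even_at_origin :: "(real \<Rightarrow> complex) \<Rightarrow> bool" where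
  "even_at_origin f \<longleftrightarrow> (\<forall>j. odd j \<longrightarrow> taylor_coeff_origin f j = 0)"

definition odd_at_origin :: "(real \<Rightarrow> complex) \<Rightarrow> bool" where
  "odd_at_origin f \<longleftrightarrow> (\<forall>j. even j \<longrightarrow> taylor_coeff_origin f j = 0)"

text \<open>The series starts at 1, so its index is shifted by \<open>Suc\<close>. The value at \<open>k = 0\<close> is irrelevant.\<close>

definition S_plus :: "real \<Rightarrow> (real \<Rightarrow> complex) \<Rightarrow> nat \<Rightarrow> complex" where
  "S_plus \<alpha> f k = f 0 / 2 +
     (\<Sum>l. exp (\<i> * of_real (\<alpha> / 2 * (real (Suc l))\<^sup>2 / real k)) * f (real (Suc l) / real k))"

text \<open>
  \<open>has_expansion a s A c\<close> means
  \<open>a k = k\<^sup>s A (\<Sum>l. k\<^sup>-\<^sup>l c l) + O(k\<^sup>-\<^sup>\<infinity>)\<close> as \<open>k\<close> tends to infinity, in the usual sense of a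
  (possibly divergent) asymptotic expansion: for every \<open>N\<close>, truncating the series before
  the index \<open>N\<close> leaves an error \<open>O(k\<^sup>s\<^sup>-\<^sup>N)\<close>.
\<close>

definition has_expansion ::
  "(nat \<Rightarrow> complex) \<Rightarrow> real \<Rightarrow> complex \<Rightarrow> (nat \<Rightarrow> complex) \<Rightarrow> bool" where
  "has_expansion a s A c \<longleftrightarrow>
     (\<forall>N. (\<lambda>k. a k - of_real (real k powr s) * A *
                  (\<Sum>l<N. of_real (real k powr (- real l)) * c l))
          \<in> O[sequentially](\<lambda>k. of_real (real k powr (s - real N))))"

end

theory Submission
  imports
    Defs
    "HOL-Probability.Probability"
    "HOL-Real_Asymp.Real_Asymp"
    "HOL-Computational_Algebra.Polynomial"
begin

text \<open>
  No Poisson summation is used. Extend \<open>f\<close> to a smooth even or odd function on the real line and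
  write \<open>a(t) = exp (i \<alpha> t\<^sup>2 / (2 k))\<close>. Then \<open>a(t + 1/2) - a(t - 1/2)\<close> is \<open>a(t) sin (\<alpha> t / (2 k))\<close> up to a
  constant factor, and on the support of \<open>f\<close> the sine vanishes only at the origin. So if \<open>f\<close> is odd, then
  \<open>f(x) = sin (\<alpha> x / 2) h(x)\<close> with \<open>h\<close> smooth and even, and a summation by parts followed by a Taylor
  expansion of \<open>h(x + 1/(2 k)) - h(x - 1/(2 k))\<close> expresses the sum of \<open>f\<close> by a boundary term and the sums
  of the odd functions \<open>h', h''', \<dots>\<close> over the shifted lattice, with weights \<open>k\<^sup>-\<^sup>1, k\<^sup>-\<^sup>3, \<dots>\<close>.
  Iterating gives the odd expansion.

  On a lattice unbounded in both directions there are no boundary terms, so the sum of an odd function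
  is \<open>O(k\<^sup>-\<^sup>\<infinity>)\<close>. The sum of an even function over the lattice with offset \<open>\<theta>\<close> has such a sum as its derivative
  in \<open>\<theta>\<close>; hence up to \<open>O(k\<^sup>-\<^sup>\<infinity>)\<close> it equals its mean over \<open>\<theta>\<close>, which is an integral over the real line.
  With \<open>F(x) = f(x) exp (x\<^sup>2 / 2)\<close> and \<open>z = 1 - i \<alpha> k\<close> this integral is that of \<open>exp (- z x\<^sup>2 / 2) F(x)\<close>. Writing
  \<open>F(x) = F(0) + x G(x)\<close> and integrating by parts replaces \<open>F\<close> by \<open>G' / z\<close>, up to a Gaussian integral.
\<close>

subsection \<open>Smooth functions on the line\<close>

text \<open>A lattice sum at scale 1/k has O(k) terms, so its trivial bound loses one power of k.
  Every sum created by a summation by parts carries a weight of at least 1/k: the first pass repays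
  that loss, each later one gains a power. As a pass moves the lattice by half a step, sums are
  treated for every offset \<theta>, and a lattice unbounded in both directions is a one-sided sum
  whose offset is very negative. Oddness makes the recursion closed, since odd-order derivatives of
  an even function vanish at the origin and can be divided by the sine again. An even function need
  not vanish there, hence the detour through the derivative in \<theta>.

  The factor exp(x^2/2) is a convergence device. With Re z = 1 the Gaussian has modulus exp(-x^2/2)
  whatever k is, so remainders are bounded uniformly in k although compact support is lost after one
  division by x.

  Expansions are kept as polynomials in 1/k up to a prescribed error, which is stable under sums and
  products. Leading coefficients are followed by a separate argument, and uniqueness of coefficients
  joins the two.\<close>

definition vd :: "(real \<Rightarrow> complex) \<Rightarrow> real \<Rightarrow> complex" where
  "vd f = (\<lambda>x. vector_derivative f (at x))"

definition smooth :: "(real \<Rightarrow> complex) \<Rightarrow> bool" where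
  "smooth f \<longleftrightarrow> (\<forall>n x. (vd ^^ n) f differentiable at x)"

text \<open>Smoothness of finite order, recursive in the order: closure under products and quotients
  is then an induction in which the functions are generalised.\<close>

primrec ndiff :: "nat \<Rightarrow> (real \<Rightarrow> complex) \<Rightarrow> bool" where
  "ndiff 0 f \<longleftrightarrow> True"
| "ndiff (Suc n) f \<longleftrightarrow> (\<forall>x. f differentiable at x) \<and> ndiff n (vd f)"

lemma ndiff_iff: "ndiff n f \<longleftrightarrow> (\<forall>j<n. \<forall>x. (vd ^^ j) f differentiable at x)"
proof (induction n arbitrary: f)
  case (Suc n)
  have "(\<forall>j<Suc n. \<forall>x. (vd ^^ j) f differentiable at x) \<longleftrightarrow>
     (\<forall>x. f differentiable at x) \<and> (\<forall>j<n. \<forall>x. (vd ^^ Suc j) f differentiable at x)"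
    by (subst All_less_Suc2) simp
  then show ?case
    using Suc[of "vd f"] by (simp add: funpow_Suc_right del: funpow.simps)
qed simp

lemma smooth_iff_ndiff: "smooth f \<longleftrightarrow> (\<forall>n. ndiff n f)"
  unfolding smooth_def ndiff_iff by blast

lemma vd_eq: "(\<And>x. (f has_vector_derivative g x) (at x)) \<Longrightarrow> vd f = g"
  unfolding vd_def by (auto intro: vector_derivative_at)

lemma ndiff_SucI:
  "(\<And>x. (f has_vector_derivative g x) (at x)) \<Longrightarrow> ndiff n g \<Longrightarrow> ndiff (Suc n) f"
  using vd_eq[of f g] by (auto intro: differentiableI_vector)

lemma ndiff_Suc_has_vd: "ndiff (Suc n) f \<Longrightarrow> (f has_vector_derivative vd f x) (at x)"
  by (simp add: vd_def vector_derivative_works)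

lemma ndiff_SucD: "ndiff (Suc n) f \<Longrightarrow> ndiff n f"
  by (simp add: ndiff_iff)

lemma smooth_has_vd: "smooth f \<Longrightarrow> (f has_vector_derivative vd f x) (at x)"
  using ndiff_Suc_has_vd smooth_iff_ndiff by blast

lemma smooth_vd_funpow: "smooth f \<Longrightarrow> smooth ((vd ^^ j) f)"
  unfolding smooth_def by (metis comp_apply funpow_add)

lemma smooth_vd: "smooth f \<Longrightarrow> smooth (vd f)"
  using smooth_vd_funpow[of f 1] by simp

lemma smooth_continuous_on: "smooth f \<Longrightarrow> continuous_on S f"
  by (meson continuous_at_imp_continuous_on has_vector_derivative_continuous smooth_has_vd)

lemma ndiff_const: "ndiff n (\<lambda>x. c)"
  by (induction n arbitrary: c) (auto intro!: ndiff_SucI[where g = "\<lambda>x. 0"] simp del: ndiff.simps(2))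

lemma smooth_const: "smooth (\<lambda>x. c)"
  by (simp add: smooth_iff_ndiff ndiff_const)

lemma ndiff_of_real: "ndiff n (\<lambda>x. of_real x)"
  by (cases n)
    (auto intro!: ndiff_SucI[where g = "\<lambda>x. 1"] ndiff_const derivative_eq_intros simp del: ndiff.simps(2)
       simp: has_vector_derivative_def bounded_linear_of_real scaleR_conv_of_real
       intro: bounded_linear.has_derivative)

lemma smooth_of_real: "smooth (\<lambda>x. of_real x)"
  by (simp add: smooth_iff_ndiff ndiff_of_real)

lemma ndiff_add: "ndiff n f \<Longrightarrow> ndiff n g \<Longrightarrow> ndiff n (\<lambda>x. f x + g x)"
proof (induction n arbitrary: f g)
  case (Suc n)
  show ?case
    by (rule ndiff_SucI[where g = "\<lambda>x. vd f x + vd g x"])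
      (use Suc in \<open>auto intro!: has_vector_derivative_add ndiff_Suc_has_vd[of n] simp del: ndiff.simps(2)\<close>,
       use Suc in auto)
qed simp

lemma ndiff_mult: "ndiff n f \<Longrightarrow> ndiff n g \<Longrightarrow> ndiff n (\<lambda>x. f x * g x)"
proof (induction n arbitrary: f g)
  case (Suc n)
  show ?case
  proof (rule ndiff_SucI[where g = "\<lambda>x. f x * vd g x + vd f x * g x"])
    show "((\<lambda>x. f x * g x) has_vector_derivative f x * vd g x + vd f x * g x) (at x)" for x
      using Suc.prems by (intro has_vector_derivative_mult ndiff_Suc_has_vd[of n])
    show "ndiff n (\<lambda>x. f x * vd g x + vd f x * g x)"
      using Suc.prems by (intro ndiff_add Suc.IH) (auto dest: ndiff_SucD simp del: ndiff.simps(2), auto)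
  qed
qed simp

lemma smooth_add: "smooth f \<Longrightarrow> smooth g \<Longrightarrow> smooth (\<lambda>x. f x + g x)"
  by (simp add: smooth_iff_ndiff ndiff_add)

lemma smooth_mult: "smooth f \<Longrightarrow> smooth g \<Longrightarrow> smooth (\<lambda>x. f x * g x)"
  by (simp add: smooth_iff_ndiff ndiff_mult)

lemma smooth_diff: "smooth f \<Longrightarrow> smooth g \<Longrightarrow> smooth (\<lambda>x. f x - g x)"
  using smooth_add[of f "\<lambda>x. (-1) * g x"] smooth_mult[OF smooth_const, of g "-1"] by simp

lemma smooth_power: "smooth f \<Longrightarrow> smooth (\<lambda>x. f x ^ n)"
  by (induction n) (auto intro: smooth_const smooth_mult)

text \<open>If f' is built from f by operations that preserve n-fold differentiability, each order
  of f yields the next one.\<close>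

lemma smooth_bootstrap:
  assumes "\<And>x. (f has_vector_derivative g x) (at x)" and "\<And>n. ndiff n f \<Longrightarrow> ndiff n g"
  shows "smooth f"
  unfolding smooth_iff_ndiff
proof
  show "ndiff n f" for n
    by (induction n) (use assms in \<open>auto intro: ndiff_SucI simp del: ndiff.simps(2)\<close>)
qed

lemma smooth_exp:
  assumes "smooth f" shows "smooth (\<lambda>x. exp (f x))"
proof (rule smooth_bootstrap[where g = "\<lambda>x. vd f x * exp (f x)"])
  show "((\<lambda>x. exp (f x)) has_vector_derivative vd f x * exp (f x)) (at x)" for x
    using field_vector_diff_chain_at[OF smooth_has_vd[OF assms], of exp "exp (f x)" x] 
    by (auto simp: o_def intro: DERIV_exp)
  show "ndiff n (\<lambda>x. exp (f x)) \<Longrightarrow> ndiff n (\<lambda>x. vd f x * exp (f x))" for n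
    using smooth_vd[OF assms] by (intro ndiff_mult) (auto simp: smooth_iff_ndiff)
qed

text \<open>For \<alpha> nonzero the line w - i\<alpha> avoids the branch cut, also at w = 0, and
  the derivative of z^(-1/2) is -1/2 times its own cube, so the bootstrap applies. Smoothness at w =
  0 later gives expansions in w = 1/k.\<close>

lemma smooth_inverse_csqrt:
  assumes "\<alpha> \<noteq> 0"
  shows "smooth (\<lambda>w. 1 / csqrt (of_real w - \<i> * of_real \<alpha>))"
proof (rule smooth_bootstrap[where g = "\<lambda>w. (-1/2) * (1 / csqrt (of_real w - \<i> * of_real \<alpha>)) ^ 3"])
  fix w :: real
  define z where "z = of_real w - \<i> * of_real \<alpha>"
  have nz: "z \<notin> \<real>\<^sub>\<le>\<^sub>0" "z \<noteq> 0" and sq: "csqrt z ^ 2 = z"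
    using assms by (auto simp: z_def complex_nonpos_Reals_iff complex_eq_iff)
  then have "csqrt z \<noteq> 0" by auto
  have "((\<lambda>z. 1 / csqrt z) has_field_derivative - (1/2) * (1 / csqrt z) ^ 3) (at z)"
    by (rule derivative_eq_intros refl nz \<open>csqrt z \<noteq> 0\<close>)+
      (use \<open>csqrt z \<noteq> 0\<close> in \<open>simp add: power3_eq_cube field_simps\<close>)
  moreover have "((\<lambda>w. of_real w - \<i> * of_real \<alpha>) has_vector_derivative 1) (at w)"
    by (rule derivative_eq_intros refl has_vector_derivative_of_real)+ simp
  ultimately show "((\<lambda>w. 1 / csqrt (of_real w - \<i> * of_real \<alpha>)) has_vector_derivative
      (-1/2) * (1 / csqrt (of_real w - \<i> * of_real \<alpha>)) ^ 3) (at w)"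
    using field_vector_diff_chain_at[of "\<lambda>w. of_real w - \<i> * of_real \<alpha>" 1 w "\<lambda>z. 1 / csqrt z"]
    by (simp add: o_def z_def)
next
  fix n assume *: "ndiff n (\<lambda>w. 1 / csqrt (of_real w - \<i> * of_real \<alpha>))"
  show "ndiff n (\<lambda>w. (-1/2) * (1 / csqrt (of_real w - \<i> * of_real \<alpha>)) ^ 3)"
    unfolding power3_eq_cube by (intro ndiff_mult ndiff_const *)
qed

lemma smooth_of_real_sin: "smooth (\<lambda>x. of_real (sin (a * x)))"
proof -
  have "smooth (\<lambda>x. (exp (\<i> * of_real a * of_real x) - exp (- \<i> * of_real a * of_real x)) * (1 / (2 * \<i>)))"
    by (intro smooth_mult smooth_diff smooth_exp smooth_const smooth_of_real)
  moreover have "of_real (sin (a * x)) =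
    (exp (\<i> * of_real a * of_real x) - exp (- \<i> * of_real a * of_real x)) * (1 / (2 * \<i>))" for x
    using sin_exp_eq[of "complex_of_real (a * x)"] by (simp add: mult_ac flip: sin_of_real)
  ultimately show ?thesis by simp
qed

section \<open>Mean value and Taylor estimates\<close>

lemma vector_differentiable_bound:
  fixes f :: "real \<Rightarrow> complex"
  assumes "\<And>t. t \<in> closed_segment x y \<Longrightarrow> (f has_vector_derivative f' t) (at t)"
    and "\<And>t. t \<in> closed_segment x y \<Longrightarrow> norm (f' t) \<le> B"
  shows "norm (f y - f x) \<le> B * norm (y - x)"
proof (rule differentiable_bound[where f' = "\<lambda>t u. u *\<^sub>R f' t" and S = "closed_segment x y"])
  fix t assume t: "t \<in> closed_segment x y"
  show "(f has_derivative (\<lambda>u. u *\<^sub>R f' t)) (at t within closed_segment x y)"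
    using assms(1)[OF t] by (auto simp: has_vector_derivative_def intro: has_derivative_at_withinI)
  show "onorm (\<lambda>u. u *\<^sub>R f' t) \<le> B"
    using assms(2)[OF t] by (intro onorm_le) (simp add: mult.commute[of B] mult_left_mono)
qed auto

lemma has_vector_derivative_taylor_term:
  "((\<lambda>y. c * complex_of_real (y - x) ^ Suc j / fact (Suc j)) has_vector_derivative
     c * of_real (t - x) ^ j / fact j) (at t within S)"
proof -
  have "((\<lambda>y. 1 / fact (Suc j) * (y - x) ^ Suc j) has_real_derivative
      1 / fact (Suc j) * (of_nat (Suc j) * (t - x) ^ j)) (at t within S)"
    by (rule DERIV_cmult) (rule derivative_eq_intros refl | simp)+
  then have "((\<lambda>y. (y - x) ^ Suc j / fact (Suc j)) has_real_derivative (t - x) ^ j / fact j) (at t within S)"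
    by (simp add: fact_Suc del: of_nat_Suc)
  from has_vector_derivative_mult_right[OF has_vector_derivative_of_real[OF this], of c]
  show ?thesis by (simp only: of_real_divide of_real_power of_real_fact times_divide_eq_right)
qed

text \<open>The remainder of f vanishes at x and its derivative is the remainder of f' of one order
  less, so each induction step is one mean value inequality. The factor 1/m! is given up.\<close>

lemma smooth_taylor:
  assumes "smooth f" and "x \<in> {a..b}" "y \<in> {a..b}"
    and "\<And>t. t \<in> {a..b} \<Longrightarrow> norm ((vd ^^ m) f t) \<le> B"
  shows "norm (f y - (\<Sum>j<m. (vd ^^ j) f x * of_real (y - x) ^ j / fact j)) \<le> B * \<bar>y - x\<bar> ^ m"
  using assms
proof (induction m arbitrary: f y)
  case 0
  then show ?case by simp
next
  case (Suc m)
  define r where "r = (\<lambda>y. f y - (\<Sum>j<Suc m. (vd ^^ j) f x * of_real (y - x) ^ j / fact j))"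
  define r' where "r' = (\<lambda>y. vd f y - (\<Sum>j<m. (vd ^^ j) (vd f) x * of_real (y - x) ^ j / fact j))"
  have r'_le: "norm (r' t) \<le> B * \<bar>t - x\<bar> ^ m" if "t \<in> {a..b}" for t
    unfolding r'_def using Suc.prems that
    by (intro Suc.IH smooth_vd) (auto simp: funpow_Suc_right simp del: funpow.simps)
  have deriv: "(r has_vector_derivative r' t) (at t within S)" for t S
  proof -
    have 1: "((\<lambda>y. (vd ^^ Suc j) f x * of_real (y - x) ^ Suc j / fact (Suc j)) has_vector_derivative
       (vd ^^ Suc j) f x * of_real (t - x) ^ j / fact j) (at t within S)" for j
      by (rule has_vector_derivative_taylor_term)
    have req: "r = (\<lambda>y. f y - (f x + (\<Sum>j<m. (vd ^^ Suc j) f x * of_real (y - x) ^ Suc j / fact (Suc j))))"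
      unfolding r_def by (subst sum.lessThan_Suc_shift) simp
    have r'eq: "r' = (\<lambda>y. vd f y - (0 + (\<Sum>j<m. (vd ^^ Suc j) f x * of_real (y - x) ^ j / fact j)))"
      unfolding r'_def by (simp add: funpow_Suc_right del: funpow.simps)
    show ?thesis unfolding req r'eq
      by (intro has_vector_derivative_diff has_vector_derivative_add has_vector_derivative_const
          has_vector_derivative_sum 1 has_vector_derivative_at_within[OF smooth_has_vd] Suc.prems)
  qed
  have seg: "t \<in> {a..b} \<and> \<bar>t - x\<bar> \<le> \<bar>y - x\<bar>" if "t \<in> closed_segment x y" for t
    using that Suc.prems by (auto simp: closed_segment_eq_real_ivl split: if_splits)
  have "0 \<le> B" using Suc.prems(2,4) norm_ge_zero order_trans by blast
  have "norm (r y - r x) \<le> B * \<bar>y - x\<bar> ^ m * norm (y - x)"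
  proof (rule vector_differentiable_bound)
    fix t assume "t \<in> closed_segment x y"
    with seg have "t \<in> {a..b}" "\<bar>t - x\<bar> ^ m \<le> \<bar>y - x\<bar> ^ m" by (auto intro: power_mono)
    then show "norm (r' t) \<le> B * \<bar>y - x\<bar> ^ m"
      using r'_le \<open>0 \<le> B\<close> by (meson mult_left_mono order_trans)
  qed (auto intro: deriv)
  moreover have "r x = 0" unfolding r_def by (subst sum.lessThan_Suc_shift) simp
  ultimately show ?case by (simp add: r_def mult_ac)
qed

subsection \<open>Hadamard quotients and division by a sine\<close>

text \<open>A family closed under differentiation: a derivative in x raises m by one and replaces g
  by g'. This makes smoothness of Hadamard quotients at the origin immediate.\<close>

definition wmean :: "nat \<Rightarrow> (real \<Rightarrow> complex) \<Rightarrow> real \<Rightarrow> complex" where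
  "wmean m g x = integral {0..1} (\<lambda>t. of_real (t ^ m) * g (t * x))"

text \<open>The quotient (f(x) - f(0)) / x, extended by f'(0), in its integral form.\<close>

definition hadamard :: "(real \<Rightarrow> complex) \<Rightarrow> real \<Rightarrow> complex" where
  "hadamard f = wmean 0 (vd f)"

lemma wmean_integrand_continuous:
  assumes "smooth g"
  shows "continuous_on S (\<lambda>t. of_real (t ^ m) * g (t * x))"
  by (intro continuous_intros continuous_on_compose2[OF smooth_continuous_on[OF assms, of UNIV]]) auto

lemma wmean_has_vd:
  assumes "smooth g"
  shows "(wmean m g has_vector_derivative wmean (Suc m) (vd g) x) (at x)"
proof -
  have "((\<lambda>x. integral (cbox 0 1) (\<lambda>t. of_real (t ^ m) * g (t * x))) has_vector_derivative
     integral (cbox 0 1) (\<lambda>t. of_real (t ^ Suc m) * vd g (t * x))) (at x within UNIV)"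
  proof (rule leibniz_rule_vector_derivative[where fx = "\<lambda>x t. of_real (t ^ Suc m) * vd g (t * x)"])
    fix x t :: real
    have "((\<lambda>x. t * x) has_real_derivative t) (at x)"
      by (rule derivative_eq_intros refl | simp)+
    then have "(g \<circ> (\<lambda>x. t * x) has_vector_derivative t *\<^sub>R vd g (t * x)) (at x)"
      by (intro vector_diff_chain_at smooth_has_vd assms) (simp add: has_real_derivative_iff_has_vector_derivative)
    then have "((\<lambda>x. of_real (t ^ m) * g (t * x)) has_vector_derivative of_real (t ^ m) * (t *\<^sub>R vd g (t * x))) (at x)"
      by (intro has_vector_derivative_mult_right) (simp add: o_def)
    then show "((\<lambda>x. of_real (t ^ m) * g (t * x)) has_vector_derivative of_real (t ^ Suc m) * vd g (t * x)) (at x within UNIV)"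
      by (simp add: scaleR_conv_of_real mult_ac)
  next
    show "(\<lambda>t. of_real (t ^ m) * g (t * x)) integrable_on cbox 0 1" for x
      by (intro integrable_continuous wmean_integrand_continuous assms)
    show "continuous_on (UNIV \<times> cbox 0 1) (\<lambda>(x, t). of_real (t ^ Suc m) * vd g (t * x))"
      unfolding split_beta
      by (intro continuous_intros continuous_on_compose2[OF smooth_continuous_on[OF smooth_vd[OF assms], of UNIV]]) auto
  qed auto
  then show ?thesis by (simp add: wmean_def[abs_def])
qed

lemma funpow_vd_wmean: "smooth g \<Longrightarrow> (vd ^^ j) (wmean m g) = wmean (j + m) ((vd ^^ j) g)"
  by (induction j) (auto intro!: vd_eq wmean_has_vd smooth_vd_funpow)

lemma smooth_wmean: "smooth g \<Longrightarrow> smooth (wmean m g)"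
  unfolding smooth_def[of "wmean m g"]
  using wmean_has_vd[OF smooth_vd_funpow[of g]]
  by (auto simp: funpow_vd_wmean intro!: differentiableI_vector)

lemma smooth_hadamard: "smooth f \<Longrightarrow> smooth (hadamard f)"
  by (simp add: hadamard_def smooth_wmean smooth_vd)

lemma funpow_vd_hadamard: "smooth f \<Longrightarrow> (vd ^^ j) (hadamard f) = wmean j ((vd ^^ Suc j) f)"
  by (simp add: hadamard_def funpow_vd_wmean smooth_vd funpow_Suc_right del: funpow.simps)

lemma wmean_0: "wmean m g 0 = g 0 / of_nat (Suc m)"
proof -
  have "((\<lambda>t. 1 / real (Suc m) * t ^ Suc m) has_real_derivative
      1 / real (Suc m) * (real (Suc m) * t ^ m)) (at t within {0..1})" for t
    by (rule DERIV_cmult) (rule derivative_eq_intros refl | simp)+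
  then have "((\<lambda>t. t ^ m) has_integral 1 / real (Suc m) * 1 ^ Suc m - 1 / real (Suc m) * 0 ^ Suc m) {0..1}"
    by (intro fundamental_theorem_of_calculus)
       (auto simp: has_real_derivative_iff_has_vector_derivative[symmetric] simp del: of_nat_Suc)
  then have "((\<lambda>t. complex_of_real (t ^ m)) has_integral of_real (1 / real (Suc m))) {0..1}"
    by (intro has_integral_of_real) simp
  from integral_unique[OF has_integral_mult_left[OF this, of "g 0"]] show ?thesis
    by (simp add: wmean_def mult.commute del: of_nat_Suc integral_mult_left integral_mult_right)
qed

lemma hadamard_eq:
  assumes "smooth f" shows "f x = f 0 + of_real x * hadamard f x"
proof -
  have "((\<lambda>t. x *\<^sub>R vd f (t * x)) has_integral f (1 * x) - f (0 * x)) {0..1}"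
  proof (rule fundamental_theorem_of_calculus)
    fix t :: real
    have "((\<lambda>t. t * x) has_real_derivative x) (at t within {0..1})"
      by (rule derivative_eq_intros refl | simp)+
    then have "(f \<circ> (\<lambda>t. t * x) has_vector_derivative x *\<^sub>R vd f (t * x)) (at t within {0..1})"
      by (intro vector_diff_chain_within has_vector_derivative_at_within[OF smooth_has_vd] assms)
        (simp add: has_real_derivative_iff_has_vector_derivative)
    then show "((\<lambda>t. f (t * x)) has_vector_derivative x *\<^sub>R vd f (t * x)) (at t within {0..1})"
      by (simp add: o_def)
  qed auto
  then have "f x - f 0 = integral {0..1} (\<lambda>t. x *\<^sub>R vd f (t * x))"
    by (metis integral_unique mult_1 mult_zero_left)
  also have "\<dots> = x *\<^sub>R hadamard f x"
    by (simp add: hadamard_def wmean_def)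
  finally show ?thesis by (simp add: scaleR_conv_of_real algebra_simps)
qed

lemma norm_wmean_le:
  assumes "smooth g" and "\<And>x. norm (g x) \<le> B"
  shows "norm (wmean m g x) \<le> B"
proof -
  have "norm (integral {0..1} (\<lambda>t. of_real (t ^ m) * g (t * x))) \<le> B * (1 - 0)"
  proof (rule integral_bound)
    fix t :: real assume "t \<in> {0..1}"
    then have "\<bar>t ^ m\<bar> \<le> 1" by (auto simp: power_le_one)
    then have "\<bar>t ^ m\<bar> * norm (g (t * x)) \<le> 1 * B"
      using assms(2) by (intro mult_mono) auto
    then show "norm (of_real (t ^ m) * g (t * x)) \<le> B"
      by (simp add: norm_mult norm_power power_abs)
  qed (use wmean_integrand_continuous[OF assms(1)] in auto)
  then show ?thesis by (simp add: wmean_def)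
qed

section \<open>Supports, quotients and parity\<close>

definition supp_in :: "real \<Rightarrow> (real \<Rightarrow> complex) \<Rightarrow> bool" where
  "supp_in b f \<longleftrightarrow> (\<forall>x. \<bar>x\<bar> > b \<longrightarrow> f x = 0)"

lemma has_vd_zero_outside:
  assumes "supp_in b f" "\<bar>x\<bar> > b"
  shows "(f has_vector_derivative 0) (at x)"
proof -
  have "open {x. \<bar>x\<bar> > b}" by (intro open_Collect_less continuous_intros)
  with assms show ?thesis
    by - (rule has_vector_derivative_transform_within_open[of "\<lambda>x. 0" _ _ "{x. \<bar>x\<bar> > b}"],
      auto simp: supp_in_def)
qed

lemma supp_in_vd: "supp_in b f \<Longrightarrow> supp_in b (vd f)"
  using has_vd_zero_outside[of b f] by (auto simp: supp_in_def vd_def vector_derivative_at)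

lemma supp_in_vd_funpow: "supp_in b f \<Longrightarrow> supp_in b ((vd ^^ j) f)"
  by (induction j) (auto intro: supp_in_vd)

lemma smooth_supp_bounded:
  assumes "smooth f" "supp_in b f"
  obtains B where "B \<ge> 0" "\<And>x. norm (f x) \<le> B"
proof -
  have "compact (f ` {-b..b})"
    by (intro compact_continuous_image smooth_continuous_on assms) auto
  then obtain B where B: "\<And>x. x \<in> {-b..b} \<Longrightarrow> norm (f x) \<le> B"
    by (metis bounded_iff compact_imp_bounded imageI)
  show ?thesis
  proof (rule that[of "max B 0"])
    show "norm (f x) \<le> max B 0" for x
      using B[of x] assms(2) by (cases "\<bar>x\<bar> > b") (fastforce simp: supp_in_def)+
  qed auto
qed

text \<open>The junk value \<open>0 / 0 = 0\<close> makes the quotient meaningful at the zeros of \<open>s\<close>, all of which lie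
  outside the support of \<open>g\<close>.\<close>

lemma ndiff_divide:
  assumes s: "smooth s" "\<And>x. \<bar>x\<bar> < b' \<Longrightarrow> s x \<noteq> 0" and b: "b < b'"
  shows "ndiff n g \<Longrightarrow> supp_in b g \<Longrightarrow> ndiff n (\<lambda>x. g x / s x)"
proof (induction n arbitrary: g)
  case (Suc n)
  have supp: "supp_in b (\<lambda>x. g x * vd s x)" "supp_in b (\<lambda>x. g x * vd s x / s x)"
    using Suc.prems(2) by (auto simp: supp_in_def)
  show ?case
  \<comment> \<open>The second term is written as two successive divisions by s, because the
    induction hypothesis covers one division at a time; both numerators stay supported in
    [-b, b].\<close>
  proof (rule ndiff_SucI[where g = "\<lambda>x. vd g x / s x + (-1) * (g x * vd s x / s x / s x)"])
    fix x
    show "((\<lambda>x. g x / s x) has_vector_derivative vd g x / s x + (-1) * (g x * vd s x / s x / s x)) (at x)"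
    proof (cases "\<bar>x\<bar> > b")
      case True
      then show ?thesis
        using has_vd_zero_outside[of b "\<lambda>x. g x / s x" x] Suc.prems(2) supp_in_vd[OF Suc.prems(2)]
        by (auto simp: supp_in_def)
    next
      case False
      then have "s x \<noteq> 0" using s b by simp
      have "((\<lambda>x. inverse (s x)) has_vector_derivative vd s x * (- (inverse (s x) ^ 2))) (at x)"
        using field_vector_diff_chain_at[OF smooth_has_vd[OF s(1), of x] DERIV_inverse[OF \<open>s x \<noteq> 0\<close>]]
        by (simp add: o_def numeral_2_eq_2)
      from has_vector_derivative_mult[OF ndiff_Suc_has_vd[OF Suc.prems(1)] this]
      show ?thesis
        by (simp add: field_simps power2_eq_square)
    qed
    show "ndiff n (\<lambda>x. vd g x / s x + (-1) * (g x * vd s x / s x / s x))"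
      using Suc.prems supp smooth_vd[OF s(1)]
      by (intro ndiff_add ndiff_mult ndiff_const Suc.IH)
        (auto simp: smooth_iff_ndiff simp del: ndiff.simps(2) intro: supp_in_vd ndiff_SucD, simp)
  qed
qed simp

definition has_parity :: "complex \<Rightarrow> (real \<Rightarrow> complex) \<Rightarrow> bool" where
  "has_parity \<sigma> f \<longleftrightarrow> (\<forall>x. f (- x) = \<sigma> * f x)"

lemma has_parity_vd:
  assumes "smooth f" "has_parity \<sigma> f" shows "has_parity (- \<sigma>) (vd f)"
  unfolding has_parity_def
proof
  fix x
  have "((\<lambda>x. - x) has_vector_derivative - 1) (at x)"
    by (rule derivative_eq_intros refl)+
  from vector_diff_chain_at[OF this smooth_has_vd[OF assms(1)]]
  have 1: "((\<lambda>x. f (- x)) has_vector_derivative - vd f (- x)) (at x)"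
    by (simp add: o_def)
  have "((\<lambda>x. \<sigma> * f x) has_vector_derivative \<sigma> * vd f x) (at x)"
    by (intro has_vector_derivative_mult_right smooth_has_vd assms(1))
  with 1 have "- vd f (- x) = \<sigma> * vd f x"
    using assms(2) by (auto simp: has_parity_def intro: vector_derivative_unique_at)
  then show "vd f (- x) = - \<sigma> * vd f x"
    by (metis minus_minus mult_minus_left)
qed

lemma has_parity_vd_funpow:
  assumes "smooth f" "has_parity \<sigma> f" shows "has_parity ((-1) ^ j * \<sigma>) ((vd ^^ j) f)"
proof (induction j)
  case (Suc j)
  then show ?case
    using has_parity_vd[OF smooth_vd_funpow[OF assms(1)] Suc] by simp
qed (use assms in simp)

text \<open>Both f and the sine vanish at the origin, so both are first divided by x. The quotient
  of the sine is \<alpha>/2 at 0 and has no zero for |x| < 2 pi / |\<alpha>|, an open interval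
  around the support of f; there the remaining division is smooth.\<close>

lemma divide_by_sin:
  assumes f: "smooth f" "supp_in b f" "has_parity (- 1) f"
    and "\<alpha> \<noteq> 0" and b: "b < 2 * pi / \<bar>\<alpha>\<bar>"
  obtains h where "smooth h" "supp_in b h" "has_parity 1 h"
    "\<And>x. f x = of_real (sin (\<alpha> * x / 2)) * h x"
proof -
  define sn where "sn = (\<lambda>x. complex_of_real (sin (\<alpha> / 2 * x)))"
  define s where "s = hadamard sn"
  define h where "h = (\<lambda>x. hadamard f x / s x)"
  have "smooth sn" unfolding sn_def by (rule smooth_of_real_sin)
  then have "smooth s" by (simp add: s_def smooth_hadamard)
  have "f 0 = 0"
    using f(3) by (auto simp: has_parity_def dest!: spec[of _ 0])
  then have f_eq: "f x = of_real x * hadamard f x" for x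
    using hadamard_eq[OF f(1), of x] by simp
  have s_eq: "sn x = of_real x * s x" for x
    using hadamard_eq[OF \<open>smooth sn\<close>, of x] by (simp add: s_def sn_def)
  have "vd sn = (\<lambda>x. of_real (\<alpha> / 2 * cos (\<alpha> / 2 * x)))"
    unfolding sn_def
    by (rule vd_eq has_vector_derivative_of_real)+ (rule derivative_eq_intros refl | simp)+
  then have "s 0 = of_real (\<alpha> / 2)"
    by (simp add: s_def hadamard_def wmean_0)
  have s_nz: "s x \<noteq> 0" if "\<bar>x\<bar> < 2 * pi / \<bar>\<alpha>\<bar>" for x
  proof (cases "x = 0")
    case False
    have "\<bar>\<alpha> / 2 * x\<bar> < pi" "\<alpha> / 2 * x \<noteq> 0"
      using that False \<open>\<alpha> \<noteq> 0\<close> by (auto simp: abs_mult field_simps)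
    then have "sin (\<alpha> / 2 * x) \<noteq> 0"
      by (metis sin_zero_pi_iff)
    then show ?thesis using s_eq[of x] by (auto simp: sn_def)
  qed (use \<open>s 0 = _\<close> \<open>\<alpha> \<noteq> 0\<close> in \<open>auto simp del: of_real_divide\<close>)
  have supp: "hadamard f x = 0" if "\<bar>x\<bar> > b" "x \<noteq> 0" for x
    using f_eq[of x] f(2) that by (auto simp: supp_in_def)
  have "supp_in b (hadamard f)"
  \<comment> \<open>For negative b the origin is outside the claimed support, and division by x says
    nothing there; but then f is identically zero.\<close>
  proof (cases "b < 0")
    case True
    then have "f = (\<lambda>x. 0)" using f(2) by (auto simp: supp_in_def fun_eq_iff)
    then have "vd f = (\<lambda>x. 0)" by (intro vd_eq) auto
    then show ?thesis by (simp add: hadamard_def wmean_def supp_in_def)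
  next
    case False
    then show ?thesis using supp by (auto simp: supp_in_def)
  qed
  show ?thesis
  proof (rule that[of h])
    show "smooth h"
      unfolding smooth_iff_ndiff h_def
      using ndiff_divide[OF \<open>smooth s\<close> s_nz b] smooth_hadamard[OF f(1)] \<open>supp_in b (hadamard f)\<close>
      by (auto simp: smooth_iff_ndiff)
    show "supp_in b h"
      using \<open>supp_in b (hadamard f)\<close> by (auto simp: supp_in_def h_def)
    show eq: "f x = of_real (sin (\<alpha> * x / 2)) * h x" for x
    proof -
      have "hadamard f x = s x * h x"
        using s_nz[of x] b \<open>supp_in b (hadamard f)\<close>
        by (cases "\<bar>x\<bar> > b") (auto simp: h_def supp_in_def)
      then show ?thesis
        using f_eq[of x] s_eq[of x] by (simp add: sn_def)
    qed
    have "h (- x) = h x" for x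
    proof (cases "x = 0 \<or> \<bar>x\<bar> > b")
      case True
      then show ?thesis using \<open>supp_in b h\<close> by (auto simp: supp_in_def)
    next
      case False
      then have "sn x \<noteq> 0" using s_nz[of x] s_eq[of x] b by auto
      moreover have "sn x * h (- x) = sn x * h x"
        using eq[of x] eq[of "- x"] f(3) by (auto simp: has_parity_def sn_def)
      ultimately show ?thesis by simp
    qed
    then show "has_parity 1 h" by (simp add: has_parity_def)
  qed
qed

subsection \<open>Chirped lattice sums and summation by parts\<close>

definition chirp :: "real \<Rightarrow> nat \<Rightarrow> real \<Rightarrow> complex" where
  "chirp \<alpha> k t = exp (\<i> * of_real (\<alpha> / 2 * t\<^sup>2 / real k))"

text \<open>\<open>S_plus\<close> is the offset 1 plus the halved term at the origin. The offset is
  a real parameter because the recursion shifts it by 1/2, and because the even case differentiates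
  in it.\<close>

definition lattice_sum :: "real \<Rightarrow> (real \<Rightarrow> complex) \<Rightarrow> real \<Rightarrow> nat \<Rightarrow> complex" where
  "lattice_sum \<alpha> f \<theta> k = (\<Sum>l. chirp \<alpha> k (real l + \<theta>) * f ((real l + \<theta>) / real k))"

definition chirp_const :: "real \<Rightarrow> nat \<Rightarrow> complex" where
  "chirp_const \<alpha> k = exp (- (\<i> * of_real (\<alpha> / (8 * real k)))) / (2 * \<i>)"

lemma norm_chirp [simp]: "norm (chirp \<alpha> k t) = 1"
  unfolding chirp_def by (rule norm_exp_i_times)

lemma norm_chirp_const [simp]: "norm (chirp_const \<alpha> k) = 1 / 2"
proof -
  have "norm (exp (\<i> * of_real (- (\<alpha> / (8 * real k))))) = 1" by (rule norm_exp_i_times)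
  then show ?thesis by (simp add: chirp_const_def norm_divide norm_mult)
qed

text \<open>(t + 1/2)^2 and (t - 1/2)^2 are t^2 + t + 1/4 and t^2 - t + 1/4. The common 1/4 produces
  the phase that \<open>chirp_const\<close> removes, together with the 2i of the sine.\<close>

lemma chirp_difference:
  assumes "k > 0"
  shows "chirp_const \<alpha> k * (chirp \<alpha> k (t + 1/2) - chirp \<alpha> k (t - 1/2)) =
    chirp \<alpha> k t * of_real (sin (\<alpha> * (t / real k) / 2))"
proof -
  define u where "u = \<i> * complex_of_real (\<alpha> / 2 * t\<^sup>2 / real k)"
  define v where "v = \<i> * complex_of_real (\<alpha> * (t / real k) / 2)"
  define w where "w = \<i> * complex_of_real (\<alpha> / (8 * real k))"
  have "\<alpha> / 2 * (t + 1/2)\<^sup>2 / real k = \<alpha> / 2 * t\<^sup>2 / real k + \<alpha> * (t / real k) / 2 + \<alpha> / (8 * real k)"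
    "\<alpha> / 2 * (t - 1/2)\<^sup>2 / real k = \<alpha> / 2 * t\<^sup>2 / real k - \<alpha> * (t / real k) / 2 + \<alpha> / (8 * real k)"
    using assms by (auto simp: field_simps power2_eq_square)
  then have "\<i> * complex_of_real (\<alpha> / 2 * (t + 1/2)\<^sup>2 / real k) = u + v + w"
    "\<i> * complex_of_real (\<alpha> / 2 * (t - 1/2)\<^sup>2 / real k) = u - v + w"
    by (simp_all only: u_def v_def w_def of_real_add of_real_diff distrib_left right_diff_distrib)
  then have "chirp_const \<alpha> k * (chirp \<alpha> k (t + 1/2) - chirp \<alpha> k (t - 1/2)) =
      exp (- w) / (2 * \<i>) * (exp (u + v + w) - exp (u - v + w))"
    by (simp only: chirp_def chirp_const_def w_def)
  also have "\<dots> = exp u * ((exp v - exp (- v)) / (2 * \<i>))"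
    by (simp add: exp_add exp_diff exp_minus field_simps)
  also have "(exp v - exp (- v)) / (2 * \<i>) = of_real (sin (\<alpha> * (t / real k) / 2))"
    by (simp only: v_def sin_of_real[symmetric] sin_exp_eq)
  finally show ?thesis by (simp only: u_def chirp_def)
qed

text \<open>The count is independent of \<theta>, which makes the later estimates uniform in the
  offset.\<close>

lemma card_lattice_interval:
  assumes "c \<ge> 0"
  shows "finite {l::nat. \<bar>real l + \<theta>\<bar> \<le> c}" "real (card {l::nat. \<bar>real l + \<theta>\<bar> \<le> c}) \<le> 2 * c + 1"
proof -
  let ?A = "{l::nat. \<bar>real l + \<theta>\<bar> \<le> c}"
  have "?A \<subseteq> {..nat \<lfloor>c - \<theta>\<rfloor>}"
    by (auto simp: le_nat_floor abs_le_iff)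
  then show fin: "finite ?A" by (rule finite_subset) simp
  show "real (card ?A) \<le> 2 * c + 1"
  proof (cases "?A = {}")
    case True
    then show ?thesis using assms by simp
  next
    case False
    have "?A \<subseteq> {Min ?A..Max ?A}" using fin by auto
    then have "card ?A \<le> Suc (Max ?A) - Min ?A"
      using card_mono[of "{Min ?A..Max ?A}" ?A] by simp
    moreover have "Min ?A \<in> ?A" "Max ?A \<in> ?A" using fin False Min_in Max_in by blast+
    then have "Min ?A \<le> Max ?A" "real (Max ?A) - real (Min ?A) \<le> 2 * c"
      using fin by (auto simp: abs_le_iff)
    ultimately show ?thesis by linarith
  qed
qed

lemma lattice_sum_eq_sum:
  assumes "finite N" "supp_in b f" "k > 0"
    and "\<And>l. \<bar>real l + \<theta>\<bar> \<le> real k * b \<Longrightarrow> l \<in> N"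
  shows "lattice_sum \<alpha> f \<theta> k = (\<Sum>l\<in>N. chirp \<alpha> k (real l + \<theta>) * f ((real l + \<theta>) / real k))"
  unfolding lattice_sum_def
proof (rule suminf_finite)
  fix l assume "l \<notin> N"
  then have "\<bar>real l + \<theta>\<bar> > real k * b" using assms(4) by force
  then have "\<bar>(real l + \<theta>) / real k\<bar> > b"
    using \<open>k > 0\<close> by (simp add: field_simps)
  then show "chirp \<alpha> k (real l + \<theta>) * f ((real l + \<theta>) / real k) = 0"
    using assms(2) by (simp add: supp_in_def)
qed (rule assms)

lemma norm_lattice_sum_le:
  assumes "supp_in b f" "b \<ge> 0" "k > 0" "\<And>x. norm (f x) \<le> B" "B \<ge> 0"
  shows "norm (lattice_sum \<alpha> f \<theta> k) \<le> (2 * b + 1) * B * real k"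
proof -
  let ?N = "{l. \<bar>real l + \<theta>\<bar> \<le> real k * b}"
  have fin: "finite ?N" "real (card ?N) \<le> 2 * (real k * b) + 1"
    using card_lattice_interval[of "real k * b"] assms by simp_all
  have "norm (lattice_sum \<alpha> f \<theta> k) \<le> (\<Sum>l\<in>?N. B)"
    by (subst lattice_sum_eq_sum[OF fin(1) assms(1)], simp_all add: assms(3))
      (rule sum_norm_le[of _ _ "\<lambda>_. B", simplified], simp add: norm_mult assms(4))
  also have "\<dots> = real (card ?N) * B" by simp
  also have "\<dots> \<le> ((2 * b + 1) * real k) * B"
    using fin assms by (intro mult_right_mono) (auto simp: algebra_simps)
  finally show ?thesis by (simp add: mult_ac)
qed

text \<open>The sine turns the chirp into a difference of chirps at half-integer shifts, and the
  difference is moved onto h. The set \<open>N\<close> is centred at \<theta> + 1/2 with radius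
  enlarged by 1/2 so that it contains l as soon as l + \<theta> or l + \<theta> + 1 meets the scaled
  support. Only the left end of the lattice leaves a boundary term.\<close>

lemma lattice_sum_by_parts:
  assumes "supp_in b h" "b \<ge> 0" "k > 0" and f: "\<And>x. f x = of_real (sin (\<alpha> * x / 2)) * h x"
    and N: "finite N" "\<And>l. \<bar>real l + \<theta> + 1/2\<bar> \<le> real k * b + 1/2 \<Longrightarrow> l \<in> N"
  shows "lattice_sum \<alpha> f \<theta> k = chirp_const \<alpha> k *
    ((\<Sum>l\<in>N. chirp \<alpha> k (real l + \<theta> + 1/2) * (h ((real l + \<theta>) / k) - h ((real l + \<theta> + 1) / k)))
      - chirp \<alpha> k (\<theta> - 1/2) * h (\<theta> / k))"
proof -
  define H where "H = (\<lambda>t. h (t / real k))"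
  define a where "a = chirp \<alpha> k"
  define p where "p = (\<lambda>l. a (real l + \<theta> - 1/2) * H (real l + \<theta>))"
  have H0: "H t = 0" if "\<bar>t\<bar> > real k * b" for t
    using that assms(1,3) by (auto simp: H_def supp_in_def field_simps)
  have zero: "H (real l + \<theta>) = 0" "H (real l + \<theta> + 1) = 0" if "l \<notin> N" for l
    by (rule H0; use N(2)[of l] that in linarith)+
  have "eventually (\<lambda>l. p l = 0) sequentially"
    using eventually_ge_at_top[of "nat \<lceil>real k * b - \<theta>\<rceil> + 1"]
  proof eventually_elim
    case (elim l)
    then have "\<bar>real l + \<theta>\<bar> > real k * b" by linarith
    then show ?case by (simp add: p_def H0)
  qed
  then have "p \<longlonglongrightarrow> 0" by (rule tendsto_eventually)
  then have "(\<lambda>l. p (Suc l) - p l) sums (0 - p 0)" by (rule telescope_sums)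
  \<comment> \<open>Off \<open>N\<close> both values of \<open>H\<close> vanish, so the telescoping
    series is also the finite sum over \<open>N\<close>.\<close>
  moreover have "(\<lambda>l. p (Suc l) - p l) sums (\<Sum>l\<in>N. p (Suc l) - p l)"
    using zero by (intro sums_finite N) (simp add: p_def algebra_simps)
  ultimately have tel: "(\<Sum>l\<in>N. p (Suc l) - p l) = - p 0"
    using sums_unique2 by fastforce
  have "supp_in b f" using assms(1) f by (simp add: supp_in_def)
  have "lattice_sum \<alpha> f \<theta> k = (\<Sum>l\<in>N. a (real l + \<theta>) * f ((real l + \<theta>) / k))"
    unfolding a_def
    by (rule lattice_sum_eq_sum[OF N(1) \<open>supp_in b f\<close> \<open>k > 0\<close>]) (use N(2) in \<open>simp add: abs_le_iff\<close>)
  also have "\<dots> = (\<Sum>l\<in>N. chirp_const \<alpha> k *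
      (a (real l + \<theta> + 1/2) - a (real l + \<theta> - 1/2)) * H (real l + \<theta>))"
    by (simp add: chirp_difference[OF \<open>k > 0\<close>] a_def H_def f mult.assoc)
  also have "\<dots> = chirp_const \<alpha> k * (\<Sum>l\<in>N. a (real l + \<theta> + 1/2) * (H (real l + \<theta>) - H (real l + \<theta> + 1))
      + (p (Suc l) - p l))"
    unfolding sum_distrib_left
    by (intro sum.cong refl) (simp add: p_def algebra_simps)
  also have "\<dots> = chirp_const \<alpha> k * ((\<Sum>l\<in>N. a (real l + \<theta> + 1/2) * (H (real l + \<theta>) - H (real l + \<theta> + 1)))
      - p 0)"
    by (simp add: sum.distrib tel)
  finally show ?thesis by (simp add: p_def a_def H_def)
qed

lemma sum_odd_part:
  fixes c :: "nat \<Rightarrow> complex"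
  shows "(\<Sum>i<2*M+1. c i * d ^ i) - (\<Sum>i<2*M+1. c i * (- d) ^ i) = (\<Sum>j<M. 2 * c (2*j+1) * d ^ (2*j+1))"
  by (induction M) (simp_all add: algebra_simps)

text \<open>Expanding about the midpoint cancels the even orders. Only odd derivatives remain, which
  for even h are odd functions.\<close>

lemma smooth_central_difference:
  assumes "smooth h" "\<And>t. norm ((vd ^^ (2*M+1)) h t) \<le> B" "\<delta> \<ge> 0"
  shows "norm (h (x + \<delta>) - h (x - \<delta>) -
    (\<Sum>j<M. of_real (2 * \<delta> ^ (2*j+1) / fact (2*j+1)) * (vd ^^ (2*j+1)) h x)) \<le> 2 * B * \<delta> ^ (2*M+1)"
proof -
  define c where "c = (\<lambda>i. (vd ^^ i) h x / fact i)"
  have 1: "norm (h (x + \<delta>) - (\<Sum>i<2*M+1. c i * of_real \<delta> ^ i)) \<le> B * \<delta> ^ (2*M+1)"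
    using smooth_taylor[OF assms(1), of x "x - \<delta>" "x + \<delta>" "x + \<delta>" "2*M+1" B] assms(2,3)
    by (simp add: c_def)
  have 2: "norm (h (x - \<delta>) - (\<Sum>i<2*M+1. c i * (- of_real \<delta>) ^ i)) \<le> B * \<delta> ^ (2*M+1)"
    using smooth_taylor[OF assms(1), of x "x - \<delta>" "x + \<delta>" "x - \<delta>" "2*M+1" B] assms(2,3)
    by (simp add: c_def)
  have "(\<Sum>j<M. of_real (2 * \<delta> ^ (2*j+1) / fact (2*j+1)) * (vd ^^ (2*j+1)) h x) =
      (\<Sum>i<2*M+1. c i * of_real \<delta> ^ i) - (\<Sum>i<2*M+1. c i * (- of_real \<delta>) ^ i)"
    unfolding sum_odd_part by (intro sum.cong) (simp_all add: c_def)
  then have "h (x + \<delta>) - h (x - \<delta>) - (\<Sum>j<M. of_real (2 * \<delta> ^ (2*j+1) / fact (2*j+1)) * (vd ^^ (2*j+1)) h x) =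
     (h (x + \<delta>) - (\<Sum>i<2*M+1. c i * of_real \<delta> ^ i)) -
     (h (x - \<delta>) - (\<Sum>i<2*M+1. c i * (- of_real \<delta>) ^ i))" (is "?l = ?u - ?v")
    by (simp only:) (simp only: diff_diff_eq2 diff_add_eq add_diff_eq diff_diff_eq add_ac)
  moreover have "norm (?u - ?v) \<le> norm ?u + norm ?v" by (rule norm_triangle_ineq4)
  ultimately show ?thesis using 1 2 by (simp only: mult.assoc mult_2 distrib_right)
qed

text \<open>The midpoints of consecutive lattice points form the lattice with offset \<theta> + 1/2,
  seen at half-width 1/(2k). The Taylor error of order k^-(2M+1) is summed over at most (2b + 2) k
  points, which costs one power of k.\<close>

lemma lattice_sum_step:
  assumes h: "smooth h" "supp_in b h" "b \<ge> 0" and f: "\<And>x. f x = of_real (sin (\<alpha> * x / 2)) * h x"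
  obtains C where "C \<ge> 0" "\<And>k \<theta>. k > 0 \<Longrightarrow> norm (lattice_sum \<alpha> f \<theta> k + chirp_const \<alpha> k *
    ((\<Sum>j<M. of_real (2 * (1 / (2 * real k)) ^ (2*j+1) / fact (2*j+1)) *
        lattice_sum \<alpha> ((vd ^^ (2*j+1)) h) (\<theta> + 1/2) k)
      + chirp \<alpha> k (\<theta> - 1/2) * h (\<theta> / k))) \<le> C / real k ^ (2*M)"
proof -
  obtain B where B: "B \<ge> 0" "\<And>x. norm ((vd ^^ (2*M+1)) h x) \<le> B"
    using smooth_supp_bounded[OF smooth_vd_funpow[OF h(1)] supp_in_vd_funpow[OF h(2)]] by blast
  show ?thesis
  proof (rule that[of "(2 * b + 2) * B"])
    fix k :: nat and \<theta> :: real assume k: "k > 0"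
    define N where "N = {l. \<bar>real l + (\<theta> + 1/2)\<bar> \<le> real k * b + 1/2}"
    define \<delta> where "\<delta> = 1 / (2 * real k)"
    define x where "x = (\<lambda>l. (real l + (\<theta> + 1/2)) / real k)"
    define a where "a = (\<lambda>l. chirp \<alpha> k (real l + (\<theta> + 1/2)))"
    define w where "w = (\<lambda>j. complex_of_real (2 * \<delta> ^ (2*j+1) / fact (2*j+1)))"
    have fin: "finite N" "real (card N) \<le> 2 * (real k * b + 1/2) + 1"
      using card_lattice_interval[of "real k * b + 1/2"] assms by (simp_all add: N_def)
    have L: "lattice_sum \<alpha> ((vd ^^ i) h) (\<theta> + 1/2) k = (\<Sum>l\<in>N. a l * (vd ^^ i) h (x l))" for i
      unfolding a_def x_def
      by (rule lattice_sum_eq_sum[OF fin(1) supp_in_vd_funpow[OF h(2)] k]) (simp add: N_def)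
    have "lattice_sum \<alpha> f \<theta> k = chirp_const \<alpha> k *
      ((\<Sum>l\<in>N. a l * (h (x l - \<delta>) - h (x l + \<delta>))) - chirp \<alpha> k (\<theta> - 1/2) * h (\<theta> / k))"
    proof -
      have "x l - \<delta> = (real l + \<theta>) / k" "x l + \<delta> = (real l + \<theta> + 1) / k" for l
        using k by (simp_all add: x_def \<delta>_def field_simps)
      then show ?thesis
        using lattice_sum_by_parts[OF h(2,3) k f fin(1), of \<theta>] by (simp add: a_def N_def add.assoc)
    qed
    then have "lattice_sum \<alpha> f \<theta> k + chirp_const \<alpha> k *
       ((\<Sum>j<M. w j * lattice_sum \<alpha> ((vd ^^ (2*j+1)) h) (\<theta> + 1/2) k) + chirp \<alpha> k (\<theta> - 1/2) * h (\<theta> / k))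
      = chirp_const \<alpha> k * ((\<Sum>l\<in>N. a l * (h (x l - \<delta>) - h (x l + \<delta>))) +
          (\<Sum>j<M. \<Sum>l\<in>N. w j * (a l * (vd ^^ (2*j+1)) h (x l))))"
      by (simp only: L sum_distrib_left[symmetric]) (simp add: algebra_simps)
    also have "\<dots> = chirp_const \<alpha> k * (\<Sum>l\<in>N. - a l * (h (x l + \<delta>) - h (x l - \<delta>) -
          (\<Sum>j<M. w j * (vd ^^ (2*j+1)) h (x l))))"
      unfolding sum.swap[of _ N] sum.distrib[symmetric]
      by (intro arg_cong[of _ _ "\<lambda>z. chirp_const \<alpha> k * z"] sum.cong refl)
        (simp add: algebra_simps sum_distrib_left sum_negf)
    also have "norm \<dots> \<le> 1 / 2 * (\<Sum>l\<in>N. 2 * B * \<delta> ^ (2*M+1))"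
      unfolding norm_mult norm_chirp_const
    proof (intro mult_left_mono sum_norm_le)
      fix l
      show "norm (- a l * (h (x l + \<delta>) - h (x l - \<delta>) - (\<Sum>j<M. w j * (vd ^^ (2*j+1)) h (x l))))
         \<le> 2 * B * \<delta> ^ (2*M+1)"
        using smooth_central_difference[OF h(1) B(2), of \<delta> "x l"]
        by (simp only: norm_mult norm_minus_cancel a_def norm_chirp w_def mult_1) (simp add: \<delta>_def)
    qed simp
    also have "\<dots> = real (card N) * (B * \<delta> ^ (2*M+1))" by simp
    also have "\<dots> \<le> ((2 * b + 2) * real k) * (B * (1 / real k) ^ (2*M+1))"
      using fin(2) k B(1) h(3)
      by (intro mult_mono power_mono) (auto simp: \<delta>_def field_simps)
    also have "\<dots> = (2 * b + 2) * B / real k ^ (2*M)"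
      using k by (simp add: field_simps power_divide)
    finally show "norm (lattice_sum \<alpha> f \<theta> k + chirp_const \<alpha> k *
      ((\<Sum>j<M. of_real (2 * (1 / (2 * real k)) ^ (2*j+1) / fact (2*j+1)) *
          lattice_sum \<alpha> ((vd ^^ (2*j+1)) h) (\<theta> + 1/2) k)
        + chirp \<alpha> k (\<theta> - 1/2) * h (\<theta> / k))) \<le> (2 * b + 2) * B / real k ^ (2*M)"
      by (simp only: w_def \<delta>_def)
  qed (use B h in simp)
qed

subsection \<open>Expansions in inverse powers of \<open>k\<close>\<close>

abbreviation ik :: "nat \<Rightarrow> complex" where
  "ik k \<equiv> inverse (of_nat k)"

text \<open>The degree of the polynomial is left free, so that products need no truncation; only its
  coefficients below \<open>N\<close> are determined by u.\<close>

definition pexp :: "nat \<Rightarrow> (nat \<Rightarrow> complex) \<Rightarrow> bool" where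
  "pexp N u \<longleftrightarrow> (\<exists>p. (\<lambda>k. u k - poly p (ik k)) \<in> O(\<lambda>k. ik k ^ N))"

lemma ik_tendsto: "ik \<longlonglongrightarrow> 0"
  by (rule lim_inverse_n)

lemma poly_ik_tendsto: "(\<lambda>k. poly p (ik k)) \<longlonglongrightarrow> poly p 0"
  by (intro tendsto_intros ik_tendsto)

lemma poly_ik_bigo: "(\<lambda>k. poly p (ik k)) \<in> O(\<lambda>_. 1)"
  using poly_ik_tendsto by (intro bigoI_tendsto[where c = "poly p 0"]) auto

lemma ik_power_mono: "M \<le> N \<Longrightarrow> (\<lambda>k. ik k ^ N) \<in> O(\<lambda>k. ik k ^ M)"
  by (rule bigoI[where c = 1], rule eventually_mono[OF eventually_gt_at_top[of 0]])
    (auto simp: norm_power norm_inverse intro!: power_decreasing simp: inverse_le_1_iff)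

lemma pexp_bigo: "pexp N u \<Longrightarrow> u \<in> O(\<lambda>_. 1)"
proof -
  assume "pexp N u"
  then obtain p where "(\<lambda>k. u k - poly p (ik k)) \<in> O(\<lambda>k. ik k ^ N)" by (auto simp: pexp_def)
  then have "(\<lambda>k. u k - poly p (ik k)) \<in> O(\<lambda>_. 1)"
    using landau_o.big_trans ik_power_mono[of 0 N] by fastforce
  from sum_in_bigo(1)[OF this poly_ik_bigo[of p]] show ?thesis by simp
qed

lemma pexp_perturb:
  assumes "pexp N v" "(\<lambda>k. u k - v k) \<in> O(\<lambda>k. ik k ^ N)" shows "pexp N u"
proof -
  obtain p where "(\<lambda>k. v k - poly p (ik k)) \<in> O(\<lambda>k. ik k ^ N)" using assms(1) by (auto simp: pexp_def)
  from sum_in_bigo(1)[OF assms(2) this] show ?thesis by (auto simp: pexp_def)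
qed

lemma pexp_const: "pexp N (\<lambda>_. c)"
  unfolding pexp_def by (rule exI[of _ "[:c:]"]) simp

lemma pexp_ik: "pexp N ik"
  unfolding pexp_def by (rule exI[of _ "[:0, 1:]"]) simp

lemma pexp_add:
  assumes "pexp N u" "pexp N v" shows "pexp N (\<lambda>k. u k + v k)"
proof -
  obtain p q where p: "(\<lambda>k. u k - poly p (ik k)) \<in> O(\<lambda>k. ik k ^ N)"
    and q: "(\<lambda>k. v k - poly q (ik k)) \<in> O(\<lambda>k. ik k ^ N)"
    using assms by (auto simp: pexp_def)
  have "(\<lambda>k. u k + v k - poly (p + q) (ik k)) \<in> O(\<lambda>k. ik k ^ N)"
    using sum_in_bigo(1)[OF p q] by (simp add: algebra_simps)
  then show ?thesis unfolding pexp_def by (rule exI)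
qed

lemma pexp_mult:
  assumes "pexp N u" "pexp N v" shows "pexp N (\<lambda>k. u k * v k)"
proof -
  obtain p q where p: "(\<lambda>k. u k - poly p (ik k)) \<in> O(\<lambda>k. ik k ^ N)"
    and q: "(\<lambda>k. v k - poly q (ik k)) \<in> O(\<lambda>k. ik k ^ N)"
    using assms by (auto simp: pexp_def)
  have "(\<lambda>k. u k * (v k - poly q (ik k)) + poly q (ik k) * (u k - poly p (ik k))) \<in> O(\<lambda>k. ik k ^ N)"
    using landau_o.big.mult[OF pexp_bigo[OF assms(1)] q] landau_o.big.mult[OF poly_ik_bigo[of q] p]
    by (intro sum_in_bigo) simp_all
  then have "(\<lambda>k. u k * v k - poly (p * q) (ik k)) \<in> O(\<lambda>k. ik k ^ N)"
    by (simp add: algebra_simps)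
  then show ?thesis unfolding pexp_def by (rule exI)
qed

lemma pexp_minus: "pexp N u \<Longrightarrow> pexp N (\<lambda>k. - u k)"
  using pexp_mult[OF pexp_const[of N "-1"]] by simp

lemma pexp_power: "pexp N u \<Longrightarrow> pexp N (\<lambda>k. u k ^ n)"
  by (induction n) (auto intro: pexp_const pexp_mult)

lemma pexp_sum: "(\<And>i. i \<in> A \<Longrightarrow> pexp N (u i)) \<Longrightarrow> pexp N (\<lambda>k. \<Sum>i\<in>A. u i k)"
  by (induction A rule: infinite_finite_induct) (auto intro: pexp_const pexp_add)

lemma pexp_ik_mult:
  assumes "pexp N u" shows "pexp (Suc N) (\<lambda>k. ik k * u k)"
proof -
  obtain p where "(\<lambda>k. u k - poly p (ik k)) \<in> O(\<lambda>k. ik k ^ N)" using assms by (auto simp: pexp_def)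
  then have "(\<lambda>k. ik k * (u k - poly p (ik k))) \<in> O(\<lambda>k. ik k * ik k ^ N)"
    by (rule landau_o.big.mult[OF landau_o.big_refl])
  then show ?thesis unfolding pexp_def
    by (intro exI[of _ "pCons 0 p"]) (simp add: algebra_simps)
qed

lemma smooth_taylor_ik:
  assumes "smooth g"
  shows "(\<lambda>k. g (c / real k) - (\<Sum>j<N. (vd ^^ j) g 0 * of_real c ^ j / fact j * ik k ^ j)) \<in> O(\<lambda>k. ik k ^ N)"
proof -
  have "compact ((vd ^^ N) g ` {-\<bar>c\<bar>..\<bar>c\<bar>})"
    by (intro compact_continuous_image smooth_continuous_on smooth_vd_funpow assms) auto
  then obtain B where B: "\<And>x. x \<in> {-\<bar>c\<bar>..\<bar>c\<bar>} \<Longrightarrow> norm ((vd ^^ N) g x) \<le> B"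
    by (metis bounded_iff compact_imp_bounded imageI)
  show ?thesis
  proof (rule bigoI, use eventually_gt_at_top[of "0::nat"] in eventually_elim)
    fix k :: nat assume "k > 0"
    then have "\<bar>c / real k\<bar> \<le> \<bar>c\<bar>"
      using mult_left_mono[of 1 "real k" "\<bar>c\<bar>"] by (simp add: pos_divide_le_eq)
    then have "c / real k \<in> {-\<bar>c\<bar>..\<bar>c\<bar>}" unfolding abs_le_iff by auto
    from smooth_taylor[OF assms _ this B, of 0]
    have "norm (g (c / real k) - (\<Sum>j<N. (vd ^^ j) g 0 * of_real (c / real k) ^ j / fact j)) \<le> B * \<bar>c / real k\<bar> ^ N"
      by simp
    then show "norm (g (c / real k) - (\<Sum>j<N. (vd ^^ j) g 0 * of_real c ^ j / fact j * ik k ^ j)) \<le> (B * \<bar>c\<bar> ^ N) * norm (ik k ^ N)"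
      by (simp add: norm_power norm_inverse divide_inverse power_mult_distrib mult_ac power_abs abs_mult)
  qed
qed

lemma pexp_smooth:
  assumes "smooth g" shows "pexp N (\<lambda>k. g (c / real k))"
  by (rule pexp_perturb[OF _ smooth_taylor_ik[OF assms]])
    (intro pexp_sum pexp_mult pexp_const pexp_power pexp_ik)

lemma pexp_chirp: "pexp N (\<lambda>k. chirp \<alpha> k t)"
  using pexp_smooth[OF smooth_exp[OF smooth_mult[OF smooth_const smooth_of_real]], of N \<i> "\<alpha> / 2 * t\<^sup>2"]
  by (simp add: chirp_def)

lemma pexp_chirp_const: "pexp N (chirp_const \<alpha>)"
  using pexp_mult[OF pexp_smooth[OF smooth_exp[OF smooth_mult[OF smooth_const smooth_of_real]], of N "- \<i>" "\<alpha> / 8"]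
      pexp_const[of N "1 / (2 * \<i>)"]]
  by (simp add: chirp_const_def[abs_def] mult_ac)

text \<open>The constant term is the limit along 1/k, hence zero; a factor 1/k then cancels on both
  sides. This is the uniqueness of asymptotic coefficients.\<close>

lemma poly_ik_bigo_imp_coeff_0:
  "(\<lambda>k. poly p (ik k)) \<in> O(\<lambda>k. ik k ^ N) \<Longrightarrow> l < N \<Longrightarrow> coeff p l = 0"
proof (induction N arbitrary: p l)
  case 0
  then show ?case by (meson not_less_zero)
next
  case (Suc N)
  obtain a q where p: "p = pCons a q" by (cases p)
  have "(\<lambda>k. poly p (ik k)) \<in> O(\<lambda>k. ik k ^ 1)"
    using Suc.prems(1) ik_power_mono[of 1 "Suc N"] by (auto intro: landau_o.big_trans)
  moreover have "(\<lambda>k. ik k ^ 1) \<in> o(\<lambda>_. 1)"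
    using ik_tendsto by (intro smalloI_tendsto) auto
  ultimately have "(\<lambda>k. poly p (ik k)) \<in> o(\<lambda>_. 1)"
    by (rule landau_o.big_small_trans)
  then have "(\<lambda>k. poly p (ik k)) \<longlonglongrightarrow> 0"
    using smalloD_tendsto by fastforce
  then have "poly p 0 = 0" using poly_ik_tendsto LIMSEQ_unique by blast
  then have a: "a = 0" by (simp add: p)
  have "(\<lambda>k. ik k * poly q (ik k)) \<in> O(\<lambda>k. ik k * ik k ^ N)"
    using Suc.prems(1) by (simp add: p a)
  then have "(\<lambda>k. poly q (ik k)) \<in> O(\<lambda>k. ik k ^ N)"
    by (subst (asm) landau_o.big.mult_cancel_left) (auto simp: eventually_sequentially intro!: exI[of _ 1])
  then show ?case
    using Suc.IH Suc.prems(2) by (cases l) (auto simp: p a)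
qed

subsection \<open>Odd functions\<close>

text \<open>Samples at 1/k already determine the derivatives at 0, by uniqueness of coefficients.
  Products and quotients can thus be treated through their leading terms, without a Leibniz
  formula.\<close>

lemma taylor_of_leading_term:
  assumes "smooth f" and lead: "(\<lambda>k. f (1 / real k) - c * ik k ^ m) \<in> O(\<lambda>k. ik k ^ Suc m)"
  shows "\<And>j. j < m \<Longrightarrow> (vd ^^ j) f 0 = 0" and "(vd ^^ m) f 0 = fact m * c"
proof -
  define p where "p = (\<Sum>j<Suc m. monom ((vd ^^ j) f 0 / fact j) j) - monom c m"
  have "poly p (ik k) = (\<Sum>j<Suc m. (vd ^^ j) f 0 / fact j * ik k ^ j) - c * ik k ^ m" for k
    by (simp only: p_def poly_diff poly_sum poly_monom)
  then have "(\<lambda>k. poly p (ik k)) = (\<lambda>k. (f (1 / real k) - c * ik k ^ m) -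
     (f (1 / real k) - (\<Sum>j<Suc m. (vd ^^ j) f 0 * of_real 1 ^ j / fact j * ik k ^ j)))"
    by (simp add: fun_eq_iff del: sum.lessThan_Suc)
  also have "\<dots> \<in> O(\<lambda>k. ik k ^ Suc m)"
    using lead smooth_taylor_ik[OF assms(1)] by (rule sum_in_bigo)
  finally have p0: "coeff p l = 0" if "l < Suc m" for l
    using that by (rule poly_ik_bigo_imp_coeff_0)
  have coeff_p: "coeff p l = (vd ^^ l) f 0 / fact l - (if l = m then c else 0)" if "l < Suc m" for l
    using that by (auto simp: p_def coeff_sum sum.delta simp del: sum.lessThan_Suc)
  show "(vd ^^ j) f 0 = 0" if "j < m" for j
    using p0[of j] coeff_p[of j] that by simp
  show "(vd ^^ m) f 0 = fact m * c"
    using p0[of m] coeff_p[of m] by (simp add: field_simps)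
qed

lemma leading_term_of_taylor:
  assumes "smooth f" and "\<And>j. j < m \<Longrightarrow> (vd ^^ j) f 0 = 0"
  shows "(\<lambda>k. f (x / real k) - (vd ^^ m) f 0 * of_real x ^ m / fact m * ik k ^ m) \<in> O(\<lambda>k. ik k ^ Suc m)"
  using smooth_taylor_ik[OF assms(1), of x "Suc m"] assms(2) by simp

lemma inverse_sin_leading_term:
  assumes "\<alpha> \<noteq> 0"
  shows "(\<lambda>k. complex_of_real (1 / real k / sin (\<alpha> * (1 / real k) / 2)) - 2 / of_real \<alpha>) \<in> O(ik)"
proof -
  have "(\<lambda>k. 1 / real k / sin (\<alpha> * (1 / real k) / 2) - 2 / \<alpha>) \<in> O(\<lambda>k. 1 / real k)"
    using assms by real_asymp
  then have "(\<lambda>k. complex_of_real (1 / real k / sin (\<alpha> * (1 / real k) / 2) - 2 / \<alpha>)) \<in> O(\<lambda>k. complex_of_real (1 / real k))"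
    by (subst landau_o.big.of_real_iff)
  then show ?thesis by (simp add: inverse_eq_divide)
qed

text \<open>Since sin(\<alpha>x/2) behaves like \<alpha>x/2, the division lowers the order of
  vanishing by one and multiplies the leading Taylor coefficient by 2/\<alpha>; the factor 1/(m+1)
  is m!/(m+1)!.\<close>

lemma divide_by_sin_taylor:
  assumes "smooth f" "smooth h" "\<alpha> \<noteq> 0" and f: "\<And>x. f x = of_real (sin (\<alpha> * x / 2)) * h x"
    and van: "\<And>j. j \<le> m \<Longrightarrow> (vd ^^ j) f 0 = 0"
  shows "\<And>j. j < m \<Longrightarrow> (vd ^^ j) h 0 = 0"
    and "(vd ^^ m) h 0 = 2 / (of_real \<alpha> * of_nat (Suc m)) * (vd ^^ Suc m) f 0"
proof -
  define c where "c = (vd ^^ Suc m) f 0 / fact (Suc m)"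
  define q where "q = (\<lambda>k. complex_of_real (1 / real k / sin (\<alpha> * (1 / real k) / 2)))"
  have q: "(\<lambda>k. q k - 2 / of_real \<alpha>) \<in> O(ik)"
    unfolding q_def by (rule inverse_sin_leading_term[OF \<open>\<alpha> \<noteq> 0\<close>])
  have "(\<lambda>k. q k - 2 / of_real \<alpha>) \<in> O(\<lambda>k. ik k ^ 0)"
    using landau_o.big_trans[OF q] ik_power_mono[of 0 1] by simp
  then have "(\<lambda>k. (q k - 2 / of_real \<alpha>) + 2 / of_real \<alpha>) \<in> O(\<lambda>k. ik k ^ 0)"
    by (rule sum_in_bigo) simp
  then have q1: "q \<in> O(\<lambda>_. 1)" by simp
  \<comment> \<open>At x = 1/k the product \<open>q k * of_nat k\<close> is 1/sin(\<alpha>x/2), so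
    h(1/k) is \<open>q k\<close> times k f(1/k), two factors with known leading terms.\<close>
  have "(\<lambda>k. of_nat k * (f (1 / real k) - c * ik k ^ Suc m)) \<in> O(\<lambda>k. of_nat k * ik k ^ Suc (Suc m))"
    using leading_term_of_taylor[OF assms(1), of "Suc m" 1] van
    by (intro landau_o.big.mult_left) (simp add: c_def del: funpow.simps fact_Suc power_Suc)
  also have "(\<lambda>k. of_nat k * ik k ^ Suc (Suc m)) \<in> O(\<lambda>k. ik k ^ Suc m)"
    by (intro landau_o.big_mono eventually_mono[OF eventually_gt_at_top[of 0]])
      (simp add: norm_mult norm_inverse)
  finally have 1: "(\<lambda>k. of_nat k * (f (1 / real k) - c * ik k ^ Suc m)) \<in> O(\<lambda>k. ik k ^ Suc m)" .
  have "(\<lambda>k. q k * (of_nat k * (f (1 / real k) - c * ik k ^ Suc m)) + c * ((q k - 2 / of_real \<alpha>) * ik k ^ m))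
      \<in> O(\<lambda>k. ik k ^ Suc m)"
    using landau_o.big.mult[OF q1 1] landau_o.big.mult[OF q landau_o.big_refl[of "\<lambda>k. ik k ^ m"]]
    by (intro sum_in_bigo) (simp_all add: mult_ac)
  also have "?this \<longleftrightarrow> (\<lambda>k. h (1 / real k) - (2 / of_real \<alpha> * c) * ik k ^ m) \<in> O(\<lambda>k. ik k ^ Suc m)"
  proof (rule landau_o.big.in_cong)
    have "\<forall>\<^sub>F k in sequentially. sin (\<alpha> * (1 / real k) / 2) \<noteq> 0"
    proof (rule eventually_mono)
      have "(\<lambda>k. inverse (real k)) \<longlonglongrightarrow> 0" by (rule lim_inverse_n)
      then show "\<forall>\<^sub>F k in sequentially. k > 0 \<and> inverse (real k) < 2 * pi / \<bar>\<alpha>\<bar>"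
        using \<open>\<alpha> \<noteq> 0\<close> by (intro eventually_conj eventually_gt_at_top order_tendstoD(2)) auto
      fix k :: nat assume "k > 0 \<and> inverse (real k) < 2 * pi / \<bar>\<alpha>\<bar>"
      then have "\<bar>\<alpha> * (1 / real k) / 2\<bar> < pi" "\<alpha> * (1 / real k) / 2 \<noteq> 0"
        using \<open>\<alpha> \<noteq> 0\<close> by (auto simp: field_simps)
      then show "sin (\<alpha> * (1 / real k) / 2) \<noteq> 0"
        by (metis sin_zero_pi_iff)
    qed
    with eventually_gt_at_top[of "0::nat"]
    show "\<forall>\<^sub>F k in sequentially. q k * (of_nat k * (f (1 / real k) - c * ik k ^ Suc m)) + c * ((q k - 2 / of_real \<alpha>) * ik k ^ m)
        = h (1 / real k) - (2 / of_real \<alpha> * c) * ik k ^ m"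
    proof eventually_elim
      case (elim k)
      have "of_nat k * q k * f (1 / real k) = h (1 / real k)"
        using elim by (simp add: q_def f)
      moreover have "of_nat k * ik k ^ Suc m = ik k ^ m" using elim by simp
      ultimately show ?case by (simp add: algebra_simps del: power_Suc)
    qed
  qed
  finally have lead: "(\<lambda>k. h (1 / real k) - (2 / of_real \<alpha> * c) * ik k ^ m) \<in> O(\<lambda>k. ik k ^ Suc m)" .
  show "(vd ^^ j) h 0 = 0" if "j < m" for j
    using taylor_of_leading_term(1)[OF assms(2) lead that] .
  show "(vd ^^ m) h 0 = 2 / (of_real \<alpha> * of_nat (Suc m)) * (vd ^^ Suc m) f 0"
    using taylor_of_leading_term(2)[OF assms(2) lead] 
    by (simp add: c_def fact_Suc divide_simps del: of_nat_Suc funpow.simps)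
qed

lemma lattice_sum_bigo:
  assumes "smooth f" "supp_in b f" "b \<ge> 0"
  shows "(\<lambda>k. ik k * lattice_sum \<alpha> f \<theta> k) \<in> O(\<lambda>_. 1)"
proof -
  obtain B where B: "B \<ge> 0" "\<And>x. norm (f x) \<le> B"
    using smooth_supp_bounded[OF assms(1,2)] by blast
  show ?thesis
  proof (rule bigoI, use eventually_gt_at_top[of "0::nat"] in eventually_elim)
    fix k :: nat assume "k > 0"
    then have "norm (ik k * lattice_sum \<alpha> f \<theta> k) = norm (lattice_sum \<alpha> f \<theta> k) / real k"
      by (simp add: norm_mult norm_inverse divide_inverse)
    also have "\<dots> \<le> (2 * b + 1) * B"
      using norm_lattice_sum_le[OF assms(2,3) _ B(2,1), of k \<alpha> \<theta>] \<open>k > 0\<close>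
      by (simp add: pos_divide_le_eq)
    finally show "norm (ik k * lattice_sum \<alpha> f \<theta> k) \<le> ((2 * b + 1) * B) * norm (1::complex)"
      by simp
  qed
qed

text \<open>At x = t/k the phase of the chirp has derivative \<alpha>x in t, that is, per lattice
  step. The bound on b keeps this below a full turn on the support, so the origin is the only point
  there at which it is a multiple of 2 pi.\<close>

locale resolved =
  fixes \<alpha> b :: real
  assumes \<alpha>: "\<alpha> \<noteq> 0" and b: "0 \<le> b" "b < 2 * pi / \<bar>\<alpha>\<bar>"
begin

definition resolved_odd :: "(real \<Rightarrow> complex) \<Rightarrow> bool" where
  "resolved_odd f \<longleftrightarrow> smooth f \<and> supp_in b f \<and> has_parity (- 1) f"

lemma resolved_odd_divide:
  assumes "resolved_odd f"
  obtains h where "smooth h" "supp_in b h" "has_parity 1 h"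
    "\<And>x. f x = of_real (sin (\<alpha> * x / 2)) * h x" "\<And>j. resolved_odd ((vd ^^ (2 * j + 1)) h)"
proof -
  obtain h where h: "smooth h" "supp_in b h" "has_parity 1 h" "\<And>x. f x = of_real (sin (\<alpha> * x / 2)) * h x"
    using divide_by_sin[of f b \<alpha>] assms \<alpha> b by (auto simp: resolved_odd_def)
  have "resolved_odd ((vd ^^ (2 * j + 1)) h)" for j
    using h smooth_vd_funpow[of h "2*j+1"] supp_in_vd_funpow[of b h "2*j+1"] has_parity_vd_funpow[of h 1 "2*j+1"]
    unfolding resolved_odd_def by simp
  with h that show ?thesis by blast
qed

lemma lattice_sum_recursion:
  assumes "smooth h" "supp_in b h" "\<And>x. f x = of_real (sin (\<alpha> * x / 2)) * h x"
  shows "(\<lambda>k. lattice_sum \<alpha> f \<theta> k - (- chirp_const \<alpha> k *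
    ((\<Sum>j<M. of_real (2 * (1/2) ^ (2*j+1) / fact (2*j+1)) * ik k ^ (2*j+1) *
        lattice_sum \<alpha> ((vd ^^ (2*j+1)) h) (\<theta> + 1/2) k)
      + chirp \<alpha> k (\<theta> - 1/2) * h (\<theta> / k)))) \<in> O(\<lambda>k. ik k ^ (2*M))"
proof -
  obtain C where C: "C \<ge> 0" "\<And>k \<theta>. k > 0 \<Longrightarrow> norm (lattice_sum \<alpha> f \<theta> k + chirp_const \<alpha> k *
    ((\<Sum>j<M. of_real (2 * (1 / (2 * real k)) ^ (2*j+1) / fact (2*j+1)) *
        lattice_sum \<alpha> ((vd ^^ (2*j+1)) h) (\<theta> + 1/2) k)
      + chirp \<alpha> k (\<theta> - 1/2) * h (\<theta> / k))) \<le> C / real k ^ (2*M)"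
    using lattice_sum_step[OF assms(1,2) b(1) assms(3), of M] by blast
  have "complex_of_real (2 * (1 / (2 * real k)) ^ (2*j+1) / fact (2*j+1)) =
    of_real (2 * (1/2) ^ (2*j+1) / fact (2*j+1)) * ik k ^ (2*j+1)" for k j
  proof -
    have "(1 / (2 * real k)) ^ (2*j+1) = (1/2) ^ (2*j+1) * inverse (real k) ^ (2*j+1)"
      unfolding power_mult_distrib[symmetric] by (rule arg_cong[of _ _ "\<lambda>x. x ^ (2*j+1)"]) (simp add: inverse_eq_divide)
    then show ?thesis
      by (simp only: of_real_mult of_real_divide of_real_power of_real_inverse of_real_of_nat_eq times_divide_eq_left mult.assoc)
  qed
  note C' = C(2)[unfolded this]
  show ?thesis
  proof (rule bigoI, use eventually_gt_at_top[of "0::nat"] in eventually_elim)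
    fix k :: nat assume "k > 0"
    have "C / real k ^ (2*M) = C * norm (ik k ^ (2*M))"
      by (simp only: norm_power norm_inverse norm_of_nat divide_inverse power_inverse)
    with C'[OF \<open>k > 0\<close>, of \<theta>]
    show "norm (lattice_sum \<alpha> f \<theta> k - (- chirp_const \<alpha> k *
    ((\<Sum>j<M. of_real (2 * (1/2) ^ (2*j+1) / fact (2*j+1)) * ik k ^ (2*j+1) *
        lattice_sum \<alpha> ((vd ^^ (2*j+1)) h) (\<theta> + 1/2) k)
      + chirp \<alpha> k (\<theta> - 1/2) * h (\<theta> / k)))) \<le> C * norm (ik k ^ (2*M))"
      by (simp only: mult_minus_left diff_minus_eq_add)
  qed
qed

text \<open>Each weight k^-(2j+1) splits into k^-(2j) and one factor 1/k, and that factor is the one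
  the hypothesis requires.\<close>

lemma pexp_lattice_sum_step:
  assumes f: "resolved_odd f" and IH: "\<And>g \<theta>. resolved_odd g \<Longrightarrow> pexp N (\<lambda>k. ik k * lattice_sum \<alpha> g \<theta> k)"
  shows "pexp N (lattice_sum \<alpha> f \<theta>)"
proof -
  obtain h where h: "smooth h" "supp_in b h" "\<And>x. f x = of_real (sin (\<alpha> * x / 2)) * h x"
     "\<And>j. resolved_odd ((vd ^^ (2 * j + 1)) h)"
    using resolved_odd_divide[OF f] by metis
  let ?w = "\<lambda>j. complex_of_real (2 * (1/2) ^ (2*j+1) / fact (2*j+1))"
  show ?thesis
  proof (rule pexp_perturb)
    show "(\<lambda>k. lattice_sum \<alpha> f \<theta> k - (- chirp_const \<alpha> k *
    ((\<Sum>j<N. ?w j * ik k ^ (2*j+1) * lattice_sum \<alpha> ((vd ^^ (2*j+1)) h) (\<theta> + 1/2) k)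
      + chirp \<alpha> k (\<theta> - 1/2) * h (\<theta> / k)))) \<in> O(\<lambda>k. ik k ^ N)"
      using lattice_sum_recursion[OF h(1-3), of \<theta> N] ik_power_mono[of N "2 * N"]
      by (auto intro: landau_o.big_trans)
    have "pexp N (\<lambda>k. ?w j * ik k ^ (2*j+1) * lattice_sum \<alpha> ((vd ^^ (2*j+1)) h) (\<theta> + 1/2) k)" for j
    proof -
      have "pexp N (\<lambda>k. ?w j * ik k ^ (2*j) * (ik k * lattice_sum \<alpha> ((vd ^^ (2*j+1)) h) (\<theta> + 1/2) k))"
        by (intro pexp_mult pexp_const pexp_power pexp_ik IH h(4))
      then show ?thesis by (simp only: power_add power_one_right mult.assoc)
    qed
    from pexp_sum[OF this]
    show "pexp N (\<lambda>k. - chirp_const \<alpha> k *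
      ((\<Sum>j<N. ?w j * ik k ^ (2*j+1) * lattice_sum \<alpha> ((vd ^^ (2*j+1)) h) (\<theta> + 1/2) k)
        + chirp \<alpha> k (\<theta> - 1/2) * h (\<theta> / k)))"
      by (intro pexp_mult pexp_minus pexp_add pexp_chirp pexp_chirp_const pexp_smooth h(1))
  qed
qed

text \<open>The induction runs over the sum divided by k. Order 0 is then the trivial bound; a step
  gives order N for the sum itself, hence order N + 1 after the division.\<close>

lemma pexp_lattice_sum:
  assumes "resolved_odd f" shows "pexp N (lattice_sum \<alpha> f \<theta>)"
proof (rule pexp_lattice_sum_step[OF assms])
  show "resolved_odd g \<Longrightarrow> pexp N (\<lambda>k. ik k * lattice_sum \<alpha> g \<theta> k)" for g \<theta>
  proof (induction N arbitrary: g \<theta>)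
    case 0
    then show ?case
      using lattice_sum_bigo[OF _ _ b(1), of g \<alpha> \<theta>] unfolding pexp_def
      by (intro exI[of _ 0]) (simp add: resolved_odd_def)
  next
    case (Suc N)
    show ?case by (rule pexp_ik_mult pexp_lattice_sum_step Suc)+
  qed
qed

text \<open>The leading coefficient per unit of the derivative of order 2n + 1 at 0. The (2n+1)! in
  the denominator cancels once that derivative is (2n+1)! times \<lambda>.\<close>

definition odd_const :: "nat \<Rightarrow> complex" where
  "odd_const n = (2 * \<i> / of_real \<alpha>) ^ (n + 1) * fact n / (2 * fact (2 * n + 1))"

lemma odd_const_0: "odd_const 0 = \<i> / of_real \<alpha>"
  by (simp add: odd_const_def)

text \<open>One pass of the recursion: i/2 is the limit of \<open>- chirp_const\<close>, the weight
  at j = 0 is exactly 1/k, and 2/(\<alpha>(2n+3)) comes from dividing by the sine.\<close>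

lemma odd_const_Suc: "odd_const (Suc n) = \<i> / (of_real \<alpha> * of_nat (2 * n + 3)) * odd_const n"
proof -
  have "fact (2 * Suc n + 1) = of_nat (2 * n + 3) * (2 * of_nat (Suc n) * (fact (2 * n + 1) :: complex))"
    by (simp add: fact_Suc algebra_simps numeral_3_eq_3)
  moreover have "fact (Suc n) = of_nat (Suc n) * (fact n :: complex)" by simp
  ultimately show ?thesis
    using \<alpha> by (simp add: odd_const_def divide_simps del: of_nat_Suc fact_Suc of_nat_add of_nat_mult)
qed

lemma chirp_leading_term: "(\<lambda>k. chirp \<alpha> k t - 1) \<in> O(ik)"
  using smooth_taylor_ik[OF smooth_exp[OF smooth_mult[OF smooth_const smooth_of_real]], of \<i> "\<alpha> / 2 * t\<^sup>2" 1]
  by (simp add: chirp_def)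

lemma chirp_const_leading_term: "(\<lambda>k. - chirp_const \<alpha> k - \<i> / 2) \<in> O(ik)"
proof -
  have "(\<lambda>k. exp (- \<i> * of_real (\<alpha> / 8 / real k)) - 1) \<in> O(ik)"
    using smooth_taylor_ik[OF smooth_exp[OF smooth_mult[OF smooth_const smooth_of_real]], of "- \<i>" "\<alpha> / 8" 1]
    by simp
  then have "(\<lambda>k. \<i> / 2 * (exp (- \<i> * of_real (\<alpha> / 8 / real k)) - 1)) \<in> O(ik)"
    by simp
  moreover have "- chirp_const \<alpha> k = \<i> / 2 * exp (- \<i> * of_real (\<alpha> / 8 / real k))" for k
    unfolding chirp_const_def by (subst minus_divide_left, subst nonzero_divide_eq_eq) (simp_all add: mult_ac)
  ultimately show ?thesis by (simp only: right_diff_distrib mult_1_right)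
qed

text \<open>For n > 0 only the sum of h' matters: h' vanishes to order 2(n-1)+1, so its sum has
  order k^-(n-1) and carries the weight 1/k. The terms with j > 0 and the boundary value
  h(\<theta>/k) = O(k^(-2n)) are smaller. For n = 0 the boundary value itself leads. Neither
  contribution sees \<theta> at leading order.\<close>

lemma lattice_sum_leading_term:
  assumes "resolved_odd f" "\<And>j. j < 2 * n + 1 \<Longrightarrow> (vd ^^ j) f 0 = 0"
  shows "(\<lambda>k. lattice_sum \<alpha> f \<theta> k - odd_const n * (vd ^^ (2 * n + 1)) f 0 * ik k ^ n) \<in> O(\<lambda>k. ik k ^ (n + 1))"
  using assms
proof (induction n arbitrary: f \<theta> rule: less_induct)
  case (less n)
  obtain h where h: "smooth h" "supp_in b h" "\<And>x. f x = of_real (sin (\<alpha> * x / 2)) * h x"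
     "\<And>j. resolved_odd ((vd ^^ (2 * j + 1)) h)"
    using resolved_odd_divide[OF less.prems(1)] by metis
  have "smooth f" using less.prems(1) by (simp add: resolved_odd_def)
  have van: "(vd ^^ j) h 0 = 0" if "j < 2 * n" for j
    using divide_by_sin_taylor(1)[OF \<open>smooth f\<close> h(1) \<alpha> h(3) _ that] less.prems(2) by simp
  have val: "(vd ^^ (2 * n)) h 0 = 2 / (of_real \<alpha> * of_nat (2 * n + 1)) * (vd ^^ (2 * n + 1)) f 0"
    using divide_by_sin_taylor(2)[OF \<open>smooth f\<close> h(1) \<alpha> h(3), of "2 * n"] less.prems(2)
    by (simp del: funpow.simps)
  let ?w = "\<lambda>j. complex_of_real (2 * (1/2) ^ (2*j+1) / fact (2*j+1))"
  let ?S = "\<lambda>j. lattice_sum \<alpha> ((vd ^^ (2*j+1)) h) (\<theta> + 1/2)"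
  let ?P = "\<lambda>k. chirp \<alpha> k (\<theta> - 1/2)"
  let ?X = "\<lambda>k. (\<Sum>j<n+1. ?w j * ik k ^ (2*j+1) * ?S j k) + ?P k * h (\<theta> / k)"
  \<comment> \<open>The leading coefficient of the bracket \<open>?X\<close>: boundary term for n =
    0, the sum of h' otherwise.\<close>
  define d where "d = (if n = 0 then h 0 else odd_const (n - 1) * (vd ^^ (2 * n)) h 0)"
  have S_bigo: "?S j \<in> O(\<lambda>k. ik k ^ (n - 1 - j))" for j
  proof (cases "n = 0")
    case True
    then show ?thesis using pexp_bigo[OF pexp_lattice_sum[OF h(4)]] by simp
  next
    case False
    define m where "m = n - 1 - j"
    have "(vd ^^ i) ((vd ^^ (2*j+1)) h) 0 = 0" if "i < 2 * m + 1" for i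
    proof (cases "j \<le> n - 1")
      case True
      then have "i + (2*j+1) < 2 * n" using that False by (simp add: m_def)
      from van[OF this] show ?thesis by (simp only: funpow_add o_apply)
    next
      \<comment> \<open>Here truncated subtraction makes m = 0, and the only condition left is
        vanishing at the origin, which follows from oddness.\<close>
      case outside: False
      then have "i = 0" using that by (simp add: m_def)
      moreover have "(vd ^^ (2*j+1)) h 0 = 0"
        using h(4)[of j] by (auto simp: resolved_odd_def has_parity_def dest!: spec[of _ 0] simp del: funpow.simps)
      ultimately show ?thesis by simp
    qed
    then have "(\<lambda>k. ?S j k - odd_const m * (vd ^^ (2*m+1)) ((vd ^^ (2*j+1)) h) 0 * ik k ^ m) \<in> O(\<lambda>k. ik k ^ (m+1))"
      using False by (intro less.IH h(4)) (simp add: m_def)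
    then have "(\<lambda>k. ?S j k - odd_const m * (vd ^^ (2*m+1)) ((vd ^^ (2*j+1)) h) 0 * ik k ^ m) \<in> O(\<lambda>k. ik k ^ m)"
      by (rule landau_o.big_trans) (rule ik_power_mono, simp)
    from sum_in_bigo(1)[OF this, of "\<lambda>k. odd_const m * (vd ^^ (2*m+1)) ((vd ^^ (2*j+1)) h) 0 * ik k ^ m"]
    show ?thesis unfolding m_def[symmetric] by (simp only: diff_add_cancel) simp
  qed
  have term_bigo: "(\<lambda>k. ?w j * ik k ^ (2*j+1) * ?S j k) \<in> O(\<lambda>k. ik k ^ (n+1))" if "j \<ge> 1 \<or> n = 0" for j
  proof -
    have "(\<lambda>k. (?w j * ik k ^ (2*j+1)) * ?S j k) \<in> O(\<lambda>k. ik k ^ (2*j+1) * ik k ^ (n-1-j))"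
      by (intro landau_o.big.mult S_bigo bigoI[where c = "norm (?w j)"] always_eventually allI)
        (simp only: norm_mult order.refl)
    also have "(\<lambda>k. ik k ^ (2*j+1) * ik k ^ (n-1-j)) \<in> O(\<lambda>k. ik k ^ (n+1))"
      unfolding power_add[symmetric] using that by (intro ik_power_mono) linarith
    finally show ?thesis .
  qed
  have h_bigo: "(\<lambda>k. h (\<theta> / k) - (vd ^^ (2*n)) h 0 * of_real \<theta> ^ (2*n) / fact (2*n) * ik k ^ (2*n)) \<in> O(\<lambda>k. ik k ^ Suc (2*n))"
    using leading_term_of_taylor[OF h(1) van] by blast
  have X: "(\<lambda>k. ?X k - d * ik k ^ n) \<in> O(\<lambda>k. ik k ^ (n+1))"
  proof (cases n)
    case 0
    have "(\<lambda>k. ?P k * (h (\<theta> / k) - h 0) + h 0 * (?P k - 1)) \<in> O(ik)"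
      using h_bigo 0 landau_o.big.mult[OF pexp_bigo[OF pexp_chirp[of 0 \<alpha> "\<theta> - 1/2"]], of "\<lambda>k. h (\<theta> / k) - h 0" ik]
        chirp_leading_term[of "\<theta> - 1/2"]
      by (intro sum_in_bigo) simp_all
    then have "(\<lambda>k. ?P k * (h (\<theta> / k) - h 0) + h 0 * (?P k - 1)) \<in> O(\<lambda>k. ik k ^ (n+1))"
      using 0 by simp
    from sum_in_bigo(1)[OF term_bigo[of 0] this]
    show ?thesis using 0 by (simp add: d_def algebra_simps)
  next
    case (Suc m)
    have "(\<lambda>k. ?S 0 k - odd_const m * (vd ^^ (2*m+1)) ((vd ^^ (2*0+1)) h) 0 * ik k ^ m) \<in> O(\<lambda>k. ik k ^ (m+1))"
    proof (intro less.IH h(4))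
      fix j assume "j < 2 * m + 1"
      then have "j + (2*0+1) < 2 * n" using Suc by simp
      from van[OF this] show "(vd ^^ j) ((vd ^^ (2*0+1)) h) 0 = 0"
        by (simp only: funpow_add o_apply)
    qed (simp add: Suc)
    moreover have "odd_const m * (vd ^^ (2*m+1)) ((vd ^^ (2*0+1)) h) 0 = d"
      using Suc by (simp add: d_def funpow_Suc_right del: funpow.simps)
    ultimately have "(\<lambda>k. ik k * (?S 0 k - d * ik k ^ m)) \<in> O(\<lambda>k. ik k * ik k ^ (m+1))"
      by (intro landau_o.big.mult_left) simp
    then have 1: "(\<lambda>k. ik k * ?S 0 k - d * ik k ^ n) \<in> O(\<lambda>k. ik k ^ (n+1))"
      using Suc by (simp add: algebra_simps)
    have "(\<lambda>k. \<Sum>j=1..<n+1. ?w j * ik k ^ (2*j+1) * ?S j k) \<in> O(\<lambda>k. ik k ^ (n+1))"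
      by (intro big_sum_in_bigo term_bigo) simp
    note 2 = sum_in_bigo(1)[OF 1 this]
    have "(\<lambda>k. h (\<theta> / k)) \<in> O(\<lambda>k. ik k ^ (2*n))"
      using smooth_taylor_ik[OF h(1), of \<theta> "2*n"] van by simp
    also have "(\<lambda>k. ik k ^ (2*n)) \<in> O(\<lambda>k. ik k ^ (n+1))"
      using Suc by (intro ik_power_mono) simp
    finally have "(\<lambda>k. ?P k * h (\<theta> / k)) \<in> O(\<lambda>k. 1 * ik k ^ (n+1))"
      by (rule landau_o.big.mult[OF pexp_bigo[OF pexp_chirp[of 0]]])
    then have 3: "(\<lambda>k. ?P k * h (\<theta> / k)) \<in> O(\<lambda>k. ik k ^ (n+1))" by simp
    have split: "(\<Sum>j<n+1. g j) = g 0 + (\<Sum>j=1..<n+1. g j)" for g :: "nat \<Rightarrow> complex"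
      using sum.atLeast_Suc_lessThan[of 0 "n+1" g] by (simp add: lessThan_atLeast0)
    have "(\<Sum>j<n+1. ?w j * ik k ^ (2*j+1) * ?S j k) = ik k * ?S 0 k + (\<Sum>j=1..<n+1. ?w j * ik k ^ (2*j+1) * ?S j k)" for k
      unfolding split by simp
    then have "?X k - d * ik k ^ n = ik k * ?S 0 k - d * ik k ^ n +
       (\<Sum>j=1..<n+1. ?w j * ik k ^ (2*j+1) * ?S j k) + ?P k * h (\<theta> / k)" for k
      by (simp only: diff_conv_add_uminus add_ac)
    then show ?thesis using sum_in_bigo(1)[OF 2 3] by (simp only:)
  qed
  have "- chirp_const \<alpha> \<in> O(\<lambda>_. 1)"
    using pexp_bigo[OF pexp_minus[OF pexp_chirp_const[of 0 \<alpha>]]] by (simp add: fun_Compl_def)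
  then have "(\<lambda>k. - chirp_const \<alpha> k * (?X k - d * ik k ^ n) + d * ((- chirp_const \<alpha> k - \<i> / 2) * ik k ^ n)) \<in> O(\<lambda>k. ik k ^ (n+1))"
    using landau_o.big.mult[OF _ X, of "- chirp_const \<alpha>" "\<lambda>_. 1"]
      landau_o.big.mult[OF chirp_const_leading_term landau_o.big_refl[of "\<lambda>k. ik k ^ n"]]
    by (intro sum_in_bigo) simp_all
  moreover have "c * (x - d * y) + d * ((c - \<i> / 2) * y) = c * x - \<i> / 2 * d * y" for c x y
    by (simp add: algebra_simps)
  ultimately have "(\<lambda>k. - chirp_const \<alpha> k * ?X k - \<i> / 2 * d * ik k ^ n) \<in> O(\<lambda>k. ik k ^ (n+1))"
    by (simp only:)
  moreover have "(\<lambda>k. lattice_sum \<alpha> f \<theta> k - - chirp_const \<alpha> k * ?X k) \<in> O(\<lambda>k. ik k ^ (n+1))"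
    using lattice_sum_recursion[OF h(1-3), of \<theta> "n+1"]
    by (rule landau_o.big_trans) (rule ik_power_mono, simp)
  ultimately have "(\<lambda>k. (lattice_sum \<alpha> f \<theta> k - - chirp_const \<alpha> k * ?X k) + (- chirp_const \<alpha> k * ?X k - \<i> / 2 * d * ik k ^ n)) \<in> O(\<lambda>k. ik k ^ (n+1))"
    by (rule sum_in_bigo(1)[rotated])
  moreover have "\<i> / 2 * d = odd_const n * (vd ^^ (2 * n + 1)) f 0"
  proof (cases n)
    case 0
    then show ?thesis using val by (simp add: d_def odd_const_0)
  next
    case (Suc m)
    have "2 * n + 1 = 2 * m + 3" using Suc by simp
    have "\<i> / 2 * d = \<i> / 2 * odd_const m * (2 / (of_real \<alpha> * of_nat (2 * m + 3)) * (vd ^^ (2 * n + 1)) f 0)"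
      using val unfolding \<open>2 * n + 1 = 2 * m + 3\<close> by (simp add: d_def Suc del: funpow.simps)
    also have "\<dots> = odd_const n * (vd ^^ (2 * n + 1)) f 0"
      by (simp add: Suc odd_const_Suc del: funpow.simps of_nat_add of_nat_mult)
    finally show ?thesis .
  qed
  ultimately show ?case by (simp only: add_diff_eq diff_add_cancel)
qed

end

subsection \<open>Even functions: from the lattice sum to the integral\<close>

context resolved
begin

text \<open>If the lattice starts to the left of the support, the boundary terms of the recursion vanish.\<close>

lemma full_lattice_sum_bound:
  assumes "resolved_odd f"
  shows "\<exists>C\<ge>0. \<forall>k>0. \<forall>\<theta>. \<theta> \<le> - (real k * b + real N) \<longrightarrow> norm (lattice_sum \<alpha> f \<theta> k) \<le> C * real k / real k ^ N"
  using assms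
proof (induction N arbitrary: f)
  case 0
  obtain B where "B \<ge> 0" "\<And>x. norm (f x) \<le> B"
    using smooth_supp_bounded 0 by (auto simp: resolved_odd_def)
  then show ?case
    using norm_lattice_sum_le[of b f _ B \<alpha>] 0 b by (intro exI[of _ "(2 * b + 1) * B"]) (auto simp: resolved_odd_def)
next
  case (Suc N)
  obtain h where h: "smooth h" "supp_in b h" "\<And>x. f x = of_real (sin (\<alpha> * x / 2)) * h x"
     "\<And>j. resolved_odd ((vd ^^ (2 * j + 1)) h)"
    using resolved_odd_divide[OF Suc.prems] by metis
  let ?w = "\<lambda>k j. complex_of_real (2 * (1 / (2 * real k)) ^ (2*j+1) / fact (2*j+1))"
  let ?S = "\<lambda>j. lattice_sum \<alpha> ((vd ^^ (2*j+1)) h)"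
  obtain D where D: "\<And>j. D j \<ge> 0" "\<And>j k \<theta>. k > 0 \<Longrightarrow> \<theta> \<le> - (real k * b + real N) \<Longrightarrow>
     norm (?S j \<theta> k) \<le> D j * real k / real k ^ N"
    using Suc.IH[OF h(4)] by metis
  obtain C where C: "C \<ge> 0" "\<And>k \<theta>. k > 0 \<Longrightarrow> norm (lattice_sum \<alpha> f \<theta> k + chirp_const \<alpha> k *
    ((\<Sum>j<N. ?w k j * ?S j (\<theta> + 1/2) k) + chirp \<alpha> k (\<theta> - 1/2) * h (\<theta> / k))) \<le> C / real k ^ (2*N)"
    using lattice_sum_step[OF h(1,2) b(1) h(3), of N] by blast
  show ?case
  proof (intro exI[of _ "(\<Sum>j<N. D j) + C"] conjI allI impI)
    show "0 \<le> (\<Sum>j<N. D j) + C" using C D by (simp add: sum_nonneg)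
    fix k :: nat and \<theta> :: real assume k: "0 < k" and \<theta>: "\<theta> \<le> - (real k * b + real (Suc N))"
    have "\<bar>\<theta> / real k\<bar> > b"
      using k \<theta> b(1) by (auto simp: field_simps abs_if mult_nonneg_nonneg)
    then have "h (\<theta> / k) = 0" using h(2) by (simp add: supp_in_def)
    then have 1: "norm (lattice_sum \<alpha> f \<theta> k + chirp_const \<alpha> k * (\<Sum>j<N. ?w k j * ?S j (\<theta> + 1/2) k)) \<le> C / real k ^ (2*N)"
      using C(2)[OF k, of \<theta>] by simp
    have 2: "norm (\<Sum>j<N. ?w k j * ?S j (\<theta> + 1/2) k) \<le> (\<Sum>j<N. 1 / real k * (D j * real k / real k ^ N))"
    proof (rule sum_norm_le)
      fix j
      have "2 * (1 / (2 * real k)) ^ (2*j+1) / fact (2*j+1) \<le> 2 * (1 / (2 * real k)) ^ 1 / 1"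
        using k by (intro frac_le mult_left_mono power_decreasing fact_ge_1) auto
      then have "norm (?w k j) \<le> 1 / real k"
        by (simp only: norm_of_real) simp
      \<comment> \<open>The margin shrinks from \<open>Suc N\<close> to \<open>N\<close> in one
        pass, more than enough for the shift of the offset by 1/2.\<close>
      moreover have "norm (?S j (\<theta> + 1/2) k) \<le> D j * real k / real k ^ N"
        using \<theta> by (intro D(2) k) simp
      ultimately show "norm (?w k j * ?S j (\<theta> + 1/2) k) \<le> 1 / real k * (D j * real k / real k ^ N)"
        unfolding norm_mult by (intro mult_mono) auto
    qed
    also have "(\<Sum>j<N. 1 / real k * (D j * real k / real k ^ N)) = (\<Sum>j<N. D j) / real k ^ N"
      using k by (simp add: sum_divide_distrib)
    finally have 2: "norm (chirp_const \<alpha> k * (\<Sum>j<N. ?w k j * ?S j (\<theta> + 1/2) k)) \<le> 1/2 * ((\<Sum>j<N. D j) / real k ^ N)"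
      by (simp only: norm_mult norm_chirp_const)
    have "norm (lattice_sum \<alpha> f \<theta> k) \<le> C / real k ^ (2*N) + 1/2 * ((\<Sum>j<N. D j) / real k ^ N)"
      using norm_triangle_ineq4[of "lattice_sum \<alpha> f \<theta> k + chirp_const \<alpha> k * (\<Sum>j<N. ?w k j * ?S j (\<theta> + 1/2) k)"
          "chirp_const \<alpha> k * (\<Sum>j<N. ?w k j * ?S j (\<theta> + 1/2) k)"] 1 2
      by (simp only: add_diff_cancel_right')
    also have "\<dots> \<le> C / real k ^ N + 1 * ((\<Sum>j<N. D j) / real k ^ N)"
      using C D k by (intro add_mono divide_left_mono mult_right_mono power_increasing) (auto intro!: sum_nonneg divide_nonneg_nonneg)
    also have "\<dots> = ((\<Sum>j<N. D j) + C) * real k / real k ^ Suc N"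
      using k by (simp add: field_simps)
    finally show "norm (lattice_sum \<alpha> f \<theta> k) \<le> ((\<Sum>j<N. D j) + C) * real k / real k ^ Suc N" .
  qed
qed

text \<open>For even f this is half of the sum over all integers: the weight 1/2 shares the origin
  between the two halves.\<close>

definition trapezoid_sum :: "(real \<Rightarrow> complex) \<Rightarrow> nat \<Rightarrow> complex" where
  "trapezoid_sum f k = f 0 / 2 + lattice_sum \<alpha> f 1 k"

definition oscillatory_integral :: "(real \<Rightarrow> complex) \<Rightarrow> nat \<Rightarrow> complex" where
  "oscillatory_integral f k = integral UNIV (\<lambda>x. exp (\<i> * of_real (\<alpha> / 2 * real k * x\<^sup>2)) * f x)"

lemma chirp_has_vd:
  "k > 0 \<Longrightarrow> (chirp \<alpha> k has_vector_derivative \<i> * of_real (\<alpha> * (t / real k)) * chirp \<alpha> k t) (at t)"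
proof -
  assume "k > 0"
  have "((\<lambda>t. \<alpha> / 2 * t\<^sup>2 / real k) has_real_derivative \<alpha> * (t / real k)) (at t)"
    by (rule derivative_eq_intros refl | use \<open>k > 0\<close> in simp)+
  then have "((\<lambda>t. \<i> * of_real (\<alpha> / 2 * t\<^sup>2 / real k)) has_vector_derivative \<i> * of_real (\<alpha> * (t / real k))) (at t)"
    by (intro has_vector_derivative_mult_right has_vector_derivative_of_real)
  from field_vector_diff_chain_at[OF this DERIV_exp] show ?thesis
    by (simp add: o_def chirp_def[abs_def])
qed

text \<open>The window runs from -M to M - 1; v(M) = 0 supplies the missing right endpoint.\<close>

lemma sum_even_reflect:
  fixes v :: "real \<Rightarrow> complex"
  assumes "\<And>t. v (- t) = v t" "v (real M) = 0"
  shows "(\<Sum>l<2*M. v (real l - real M)) = v 0 + 2 * (\<Sum>i<M. v (real i + 1))"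
proof -
  have "{..<2*M} = {..<M} \<union> {M..<M+M}" by auto
  then have "(\<Sum>l<2*M. v (real l - real M)) = (\<Sum>l<M. v (real l - real M)) + (\<Sum>l=M..<M+M. v (real l - real M))"
    by (simp add: sum.union_disjoint ivl_disj_int)
  also have "(\<Sum>l=M..<M+M. v (real l - real M)) = (\<Sum>l<M. v (real l))"
    using sum.shift_bounds_nat_ivl[of "\<lambda>l. v (real l - real M)" 0 M M] by (simp add: lessThan_atLeast0)
  also have "(\<Sum>l<M. v (real l)) = v 0 + (\<Sum>i<M. v (real i + 1))"
    using sum.lessThan_Suc_shift[of "\<lambda>l. v (real l)" M] assms(2) by (simp add: add.commute)
  also have "(\<Sum>l<M. v (real l - real M)) = (\<Sum>i<M. v (real (M - Suc i) - real M))"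
    by (rule sum.nat_diff_reindex[symmetric])
  also have "\<dots> = (\<Sum>i<M. v (real i + 1))"
  proof (rule sum.cong)
    fix i assume "i \<in> {..<M}"
    then have "real (M - Suc i) - real M = - (real i + 1)" by (simp add: of_nat_diff)
    then show "v (real (M - Suc i) - real M) = v (real i + 1)" using assms(1) by metis
  qed simp
  finally show ?thesis by simp
qed

text \<open>Differentiating the translated sum \<open>T\<close> hits the chirp, giving i\<alpha> x
  f(x), and hits f, giving f'/k; both functions are odd, so \<open>T\<close> is constant on [0,1] up
  to a tiny error. Its mean is found without exchanging sum and integral: \<open>W\<close> is an
  antiderivative of \<open>T\<close> made of translates of the antiderivative \<open>U\<close>, and
  a full lattice step makes it telescope to k times the integral.\<close>

lemma trapezoid_sum_integral:
  assumes f: "smooth f" "supp_in b f" "has_parity 1 f"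
  shows "\<exists>C\<ge>0. \<forall>k>0. norm (trapezoid_sum f k - of_nat k / 2 * oscillatory_integral f k) \<le> C * real k / real k ^ N"
proof -
  define g1 where "g1 = (\<lambda>x. \<i> * of_real \<alpha> * (of_real x * f x))"
  have "resolved_odd g1"
    unfolding resolved_odd_def g1_def using f
    by (auto intro!: smooth_mult smooth_const smooth_of_real simp: supp_in_def has_parity_def)
  moreover have "resolved_odd (vd f)"
    unfolding resolved_odd_def using smooth_vd[OF f(1)] supp_in_vd[OF f(2)] has_parity_vd[OF f(1,3)] by simp
  ultimately obtain C1 C2 where C: "C1 \<ge> 0" "C2 \<ge> 0"
    "\<And>k \<theta>. k > 0 \<Longrightarrow> \<theta> \<le> - (real k * b + real N) \<Longrightarrow> norm (lattice_sum \<alpha> g1 \<theta> k) \<le> C1 * real k / real k ^ N"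
    "\<And>k \<theta>. k > 0 \<Longrightarrow> \<theta> \<le> - (real k * b + real N) \<Longrightarrow> norm (lattice_sum \<alpha> (vd f) \<theta> k) \<le> C2 * real k / real k ^ N"
    using full_lattice_sum_bound by meson
  show ?thesis
  proof (intro exI[of _ "C1 + C2"] conjI allI impI)
    show "0 \<le> C1 + C2" using C by simp
    fix k :: nat assume k: "k > 0"
    \<comment> \<open>The extra 1 keeps the offset \<theta> - M below -(kb + N) for every \<theta>
      in [0,1].\<close>
    define M where "M = nat \<lceil>real k * b + real N + 1\<rceil>"
    have M: "real M \<ge> real k * b + real N + 1" unfolding M_def by linarith
    define E where "E = (C1 + C2) * real k / real k ^ N"
    define v where "v = (\<lambda>t. chirp \<alpha> k t * f (t / real k))"
    define v' where "v' = (\<lambda>t. chirp \<alpha> k t * (g1 (t / real k) + ik k * vd f (t / real k)))"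
    define u where "u = (\<lambda>x. exp (\<i> * of_real (\<alpha> / 2 * real k * x\<^sup>2)) * f x)"
    define r where "r = real M / real k"
    \<comment> \<open>Starting one unit to the left of -r makes all of [-r, r] interior, so that
      \<open>U\<close> has a two-sided derivative there.\<close>
    define U where "U = (\<lambda>x. integral {- r - 1..x} u)"
    define T where "T = (\<lambda>\<theta>. \<Sum>l<2*M. v (real l + (\<theta> - real M)))"
    define T' where "T' = (\<lambda>\<theta>. \<Sum>l<2*M. v' (real l + (\<theta> - real M)))"
    define W where "W = (\<lambda>\<theta>. \<Sum>l<2*M. of_nat k * U ((real l + (\<theta> - real M)) / real k))"
    have r: "r \<ge> b" "r \<ge> 0"
      using M k b(1) mult_nonneg_nonneg[of "real k" b] by (auto simp: r_def field_simps)
    have u_cont: "continuous_on S u" for S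
      unfolding u_def by (intro continuous_intros smooth_continuous_on f)
    have uv: "u (t / real k) = v t" for t
      using k by (simp add: u_def v_def chirp_def power2_eq_square field_simps)
    have scale: "((\<lambda>\<theta>. (real l + (\<theta> - real M)) / real k) has_real_derivative 1 / real k) (at \<theta>)" for l \<theta>
      by (rule derivative_eq_intros refl | use k in simp)+
    have T_deriv: "(T has_vector_derivative T' \<theta>) (at \<theta>)" for \<theta>
      unfolding T_def T'_def
    proof (rule has_vector_derivative_sum)
      fix l
      define t where "t = real l + (\<theta> - real M)"
      have "((\<lambda>\<theta>. real l + (\<theta> - real M)) has_vector_derivative 1) (at \<theta>)"
        by (rule derivative_eq_intros refl)+ simp
      from vector_diff_chain_at[OF this, of "chirp \<alpha> k"] 
      have 1: "((\<lambda>\<theta>. chirp \<alpha> k (real l + (\<theta> - real M))) has_vector_derivative \<i> * of_real (\<alpha> * (t / real k)) * chirp \<alpha> k t) (at \<theta>)"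
        using chirp_has_vd[OF k, of t] by (simp add: o_def t_def)
      have 2: "((\<lambda>\<theta>. f ((real l + (\<theta> - real M)) / real k)) has_vector_derivative (1 / real k) *\<^sub>R vd f (t / real k)) (at \<theta>)"
        using vector_diff_chain_at[of "\<lambda>\<theta>. (real l + (\<theta> - real M)) / real k" "1 / real k" \<theta> f] scale smooth_has_vd[OF f(1)]
        by (simp add: o_def t_def has_real_derivative_iff_has_vector_derivative)
      have "v' t = chirp \<alpha> k t * ((1 / real k) *\<^sub>R vd f (t / real k)) +
          \<i> * of_real (\<alpha> * (t / real k)) * chirp \<alpha> k t * f (t / real k)"
        by (simp add: v'_def g1_def scaleR_conv_of_real inverse_eq_divide algebra_simps)
      then show "((\<lambda>\<theta>. v (real l + (\<theta> - real M))) has_vector_derivative v' (real l + (\<theta> - real M))) (at \<theta>)"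
        using has_vector_derivative_mult[OF 1 2] by (simp only: t_def v_def)
    qed
    have lat: "(\<Sum>l<2*M. chirp \<alpha> k (real l + (\<theta> - real M)) * g ((real l + (\<theta> - real M)) / real k)) = lattice_sum \<alpha> g (\<theta> - real M) k"
      if "\<theta> \<ge> 0" "supp_in b g" for \<theta> g
      using that M by (intro lattice_sum_eq_sum[OF _ _ k, symmetric]) (auto simp: abs_le_iff)
    have T'_le: "norm (T' \<theta>) \<le> E" if "\<theta> \<in> {0..1}" for \<theta>
    proof -
      have "T' \<theta> = lattice_sum \<alpha> g1 (\<theta> - real M) k + ik k * lattice_sum \<alpha> (vd f) (\<theta> - real M) k"
        using that \<open>resolved_odd g1\<close> \<open>resolved_odd (vd f)\<close>
        by (simp add: lat[symmetric] resolved_odd_def T'_def v'_def sum_distrib_left sum.distrib[symmetric] algebra_simps)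
      also have "norm \<dots> \<le> norm (lattice_sum \<alpha> g1 (\<theta> - real M) k) + 1 * norm (lattice_sum \<alpha> (vd f) (\<theta> - real M) k)"
        using k by (intro norm_triangle_le add_mono) (auto simp: norm_mult norm_inverse inverse_le_1_iff intro!: mult_left_le_one_le)
      also have "\<dots> \<le> E"
        using C(3,4)[OF k, of "\<theta> - real M"] that M by (simp add: E_def add_divide_distrib distrib_right)
      finally show ?thesis .
    qed
    have E0: "E \<ge> 0" using C by (simp add: E_def)
    have T_le: "norm (T \<theta> - T 0) \<le> E" if "\<theta> \<in> {0..1}" for \<theta>
    proof -
      have "norm (T \<theta> - T 0) \<le> E * norm (\<theta> - 0)"
        by (rule vector_differentiable_bound[OF T_deriv T'_le]) (use that in \<open>auto simp: closed_segment_eq_real_ivl\<close>)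
      also have "\<dots> \<le> E * 1" using that E0 by (intro mult_left_mono) auto
      finally show ?thesis by simp
    qed
    have U_deriv: "(U has_vector_derivative u x) (at x)" if "x \<in> {-r..r}" for x
    proof -
      have "(U has_vector_derivative u x) (at x within {-r-1..r+1})"
        unfolding U_def using that by (intro integral_has_vector_derivative u_cont) auto
      moreover have "x \<in> interior {-r-1..r+1}" using that by simp
      ultimately show ?thesis by (metis at_within_interior)
    qed
    have W_deriv: "(W has_vector_derivative T \<theta>) (at \<theta>)" if "\<theta> \<in> {0..1}" for \<theta>
      unfolding T_def W_def
    proof (rule has_vector_derivative_sum)
      fix l assume "l \<in> {..<2*M}"
      then have "real l + 1 \<le> 2 * real M" by auto
      then have "(real l + (\<theta> - real M)) / real k \<in> {-r..r}"
        using that unfolding r_def minus_divide_left atLeastAtMost_iff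
        by (intro conjI divide_right_mono) auto
      from has_vector_derivative_mult_right[OF vector_diff_chain_at[of "\<lambda>\<theta>. (real l + (\<theta> - real M)) / real k" "1 / real k" \<theta> U,
             OF _ U_deriv[OF this]], of "of_nat k"] scale
      show "((\<lambda>\<theta>. of_nat k * U ((real l + (\<theta> - real M)) / real k)) has_vector_derivative v (real l + (\<theta> - real M))) (at \<theta>)"
        using k by (simp add: o_def uv has_real_derivative_iff_has_vector_derivative scaleR_conv_of_real)
    qed
    \<comment> \<open>Subtracting \<theta> T(0) from \<open>W\<close> turns near-constancy of
      \<open>T\<close> into a bound on the distance of T(0) from its mean.\<close>
    have "norm ((W 1 - 1 *\<^sub>R T 0) - (W 0 - 0 *\<^sub>R T 0)) \<le> E * norm (1 - 0 :: real)"
    proof (rule vector_differentiable_bound[where f' = "\<lambda>\<theta>. T \<theta> - T 0"])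
      fix \<theta> :: real assume "\<theta> \<in> closed_segment 0 1"
      then have \<theta>: "\<theta> \<in> {0..1}" by (simp add: closed_segment_eq_real_ivl)
      show "((\<lambda>\<theta>. W \<theta> - \<theta> *\<^sub>R T 0) has_vector_derivative T \<theta> - T 0) (at \<theta>)"
        using W_deriv[OF \<theta>] by (auto intro!: derivative_eq_intros)
      show "norm (T \<theta> - T 0) \<le> E" by (rule T_le[OF \<theta>])
    qed
    then have main: "norm (T 0 - (W 1 - W 0)) \<le> E" by (simp add: norm_minus_commute algebra_simps)
    have "W 1 - W 0 = (\<Sum>l<2*M. of_nat k * U ((real (Suc l) - real M) / real k) - of_nat k * U ((real l - real M) / real k))"
      by (simp add: W_def sum_subtractf algebra_simps)
    also have "\<dots> = of_nat k * U r - of_nat k * U (- r)"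
      by (subst sum_lessThan_telescope) (simp add: r_def)
    also have "\<dots> = of_nat k * integral {-r..r} u"
    proof -
      have "integral {-r-1..-r} u + integral {-r..r} u = integral {-r-1..r} u"
        using r by (intro Henstock_Kurzweil_Integration.integral_combine integrable_continuous_real u_cont) auto
      then have "U r = U (- r) + integral {-r..r} u" by (simp add: U_def)
      then show ?thesis by (simp add: algebra_simps)
    qed
    also have "integral {-r..r} u = oscillatory_integral f k"
    proof -
      have "u x = (if x \<in> {-r..r} then u x else 0)" for x
        using r f(2) by (auto simp: u_def supp_in_def)
      then show ?thesis
        unfolding oscillatory_integral_def u_def[symmetric] using integral_restrict_UNIV[of "{-r..r}" u] by presburger
    qed
    finally have W: "W 1 - W 0 = of_nat k * oscillatory_integral f k" .
    have v_even: "v (- t) = v t" for t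
      using f(3) by (simp add: v_def chirp_def has_parity_def)
    have "\<bar>real M / real k\<bar> > b" using M k by (simp add: field_simps)
    then have "v (real M) = 0" using f(2) by (simp add: v_def supp_in_def)
    have "T 0 = v 0 + 2 * (\<Sum>i<M. v (real i + 1))"
      using sum_even_reflect[of v M, OF v_even \<open>v (real M) = 0\<close>] by (simp add: T_def)
    also have "(\<Sum>i<M. v (real i + 1)) = lattice_sum \<alpha> f 1 k"
      unfolding v_def using M by (intro lattice_sum_eq_sum[OF _ f(2) k, symmetric]) (auto simp: abs_le_iff)
    finally have "T 0 = 2 * trapezoid_sum f k"
      by (simp add: trapezoid_sum_def v_def chirp_def)
    with main W have "2 * norm (trapezoid_sum f k - of_nat k / 2 * oscillatory_integral f k) \<le> E"
      unfolding norm_mult[of 2, simplified, symmetric] by (simp add: algebra_simps)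
    then show "norm (trapezoid_sum f k - of_nat k / 2 * oscillatory_integral f k) \<le> (C1 + C2) * real k / real k ^ N"
      using E0 unfolding E_def[symmetric] by (smt (verit) norm_ge_zero)
  qed
qed

end

subsection \<open>Gaussian integrals\<close>

definition gauss :: "complex \<Rightarrow> real \<Rightarrow> complex" where
  "gauss z x = exp (- z * of_real (x\<^sup>2 / 2))"

definition gauss_integral :: "complex \<Rightarrow> (real \<Rightarrow> complex) \<Rightarrow> complex" where
  "gauss_integral z F = (\<integral>x. gauss z x * F x \<partial>lborel)"

lemma norm_gauss: "Re z = 1 \<Longrightarrow> norm (gauss z x) = exp (- x\<^sup>2 / 2)"
  by (simp add: gauss_def)

lemma continuous_on_gauss [continuous_intros]: "continuous_on S (gauss z)"
  unfolding gauss_def by (intro continuous_intros) auto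

lemma exp_moment:
  "has_bochner_integral lborel (\<lambda>x. exp (- x\<^sup>2 / 2) * x ^ (2 * k)) (sqrt (2 * pi) * (fact (2 * k) / (2 ^ k * fact k)))"
  using has_bochner_integral_mult_right[OF std_normal_moment_even, of "sqrt (2 * pi)"]
  by (simp add: std_normal_density_def)

text \<open>Growth up to the fourth power suffices: integration by parts meets x h(x) with h of
  quadratic growth, and the fourth moment dominates the cubic term.\<close>

lemma integrable_gauss_mult:
  assumes "Re z = 1" "continuous_on UNIV F" "\<And>x. norm (F x) \<le> B * (1 + x ^ 4)"
  shows "integrable lborel (\<lambda>x. gauss z x * F x)"
proof (rule Bochner_Integration.integrable_bound)
  show "integrable lborel (\<lambda>x. B * (exp (- x\<^sup>2 / 2) * x ^ (2 * 0) + exp (- x\<^sup>2 / 2) * x ^ (2 * 2)))"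
    by (intro integrable_mult_right Bochner_Integration.integrable_add integrable.intros[OF exp_moment])
  show "(\<lambda>x. gauss z x * F x) \<in> borel_measurable lborel"
    using assms(2) by (intro borel_measurable_times) (auto intro!: borel_measurable_continuous_onI continuous_on_gauss)
  have "norm (gauss z x * F x) \<le> norm (B * (exp (- x\<^sup>2 / 2) * x ^ (2 * 0) + exp (- x\<^sup>2 / 2) * x ^ (2 * 2)))" for x
  proof -
    have "norm (gauss z x * F x) \<le> exp (- x\<^sup>2 / 2) * (B * (1 + x ^ 4))"
      using assms by (simp add: norm_mult norm_gauss mult_left_mono)
    also have "\<dots> = B * (exp (- x\<^sup>2 / 2) * x ^ (2 * 0) + exp (- x\<^sup>2 / 2) * x ^ (2 * 2))"
      by (simp add: algebra_simps)
    also have "\<dots> \<le> norm \<dots>" by simp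
    finally show ?thesis .
  qed
  then show "AE x in lborel. norm (gauss z x * F x) \<le> norm (B * (exp (- x\<^sup>2 / 2) * x ^ (2 * 0) + exp (- x\<^sup>2 / 2) * x ^ (2 * 2)))"
    by simp
qed

lemma power_le_1_plus_power_4:
  fixes x :: real
  assumes "m \<le> 4" shows "\<bar>x\<bar> ^ m \<le> 1 + x ^ 4"
proof (cases "\<bar>x\<bar> \<le> 1")
  case True
  then have "\<bar>x\<bar> ^ m \<le> 1" by (simp add: power_le_one)
  moreover have "x ^ 4 \<ge> 0" by simp
  ultimately show ?thesis by linarith
next
  case False
  then have "\<bar>x\<bar> ^ m \<le> \<bar>x\<bar> ^ 4" using assms by (intro power_increasing) auto
  then show ?thesis by simp
qed

lemma power2_le_1_plus_power_4:
  fixes x :: real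
  shows "1 + x\<^sup>2 \<le> 2 * (1 + x ^ 4)" "x\<^sup>2 / 2 \<le> 1 * (1 + x ^ 4)"
proof -
  have "p \<le> 1 + q \<Longrightarrow> 0 \<le> q \<Longrightarrow> 1 + p \<le> 2 * (1 + q) \<and> p / 2 \<le> 1 * (1 + q)" for p q :: real
    by (auto simp: field_simps)
  from this[of "\<bar>x\<bar>\<^sup>2" "x ^ 4"] show "1 + x\<^sup>2 \<le> 2 * (1 + x ^ 4)" "x\<^sup>2 / 2 \<le> 1 * (1 + x ^ 4)"
    using power_le_1_plus_power_4[of 2 x] unfolding power2_abs by auto
qed

text \<open>The derivative of the Gaussian is -z x times itself, and the derivative of Gaussian
  times h integrates to zero because the product decays at both ends. Quadratic growth admits both
  bounded h and h(x) = x.\<close>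

lemma gauss_integral_by_parts:
  assumes "Re z = 1" and h: "\<And>x. (h has_vector_derivative h' x) (at x)" "continuous_on UNIV h'"
    and bounds: "\<And>x. norm (h x) \<le> A * (1 + x\<^sup>2)" "\<And>x. norm (h' x) \<le> A * (1 + x\<^sup>2)"
  shows "gauss_integral z h' = z * gauss_integral z (\<lambda>x. of_real x * h x)"
    and "integrable lborel (\<lambda>x. gauss z x * (of_real x * h x))"
proof -
  have "A \<ge> 0" using bounds(1)[of 0] norm_ge_zero[of "h 0"] by (simp del: norm_ge_zero)
  have h_cont: "continuous_on UNIV h"
    using h(1) has_vector_derivative_continuous by (blast intro: continuous_at_imp_continuous_on)
  have int1: "integrable lborel (\<lambda>x. gauss z x * h' x)"
  proof (rule integrable_gauss_mult[OF assms(1) h(2), of "2 * A"])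
    fix x
    have "A * (1 + x\<^sup>2) \<le> A * (2 * (1 + x ^ 4))"
      by (rule mult_left_mono[OF power2_le_1_plus_power_4(1) \<open>A \<ge> 0\<close>])
    then show "norm (h' x) \<le> 2 * A * (1 + x ^ 4)" using bounds(2)[of x] by (simp add: algebra_simps)
  qed
  show int2: "integrable lborel (\<lambda>x. gauss z x * (of_real x * h x))"
  proof (rule integrable_gauss_mult[OF assms(1), of _ "2 * A"])
    fix x :: real
    have "norm (of_real x * h x) \<le> \<bar>x\<bar> * (A * (1 + x\<^sup>2))"
      using bounds(1) by (simp add: norm_mult mult_left_mono)
    also have "\<dots> = A * (\<bar>x\<bar> ^ 1 + \<bar>x\<bar> ^ 3)"
      by (simp add: power2_eq_square power3_eq_cube algebra_simps flip: power2_abs)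
    also have "\<dots> \<le> A * ((1 + x ^ 4) + (1 + x ^ 4))"
      using \<open>A \<ge> 0\<close> by (intro mult_left_mono add_mono power_le_1_plus_power_4) auto
    finally show "norm (of_real x * h x) \<le> 2 * A * (1 + x ^ 4)" by (simp add: algebra_simps)
  qed (intro continuous_intros h_cont)
  define f where "f = (\<lambda>x. gauss z x * h' x - z * (gauss z x * (of_real x * h x)))"
  have f_int: "integrable lborel f"
    unfolding f_def by (intro Bochner_Integration.integrable_diff int1 integrable_mult_right int2)
  have bound: "norm (gauss z x * h x) \<le> A * ((1 + x\<^sup>2) * exp (- x\<^sup>2 / 2))" for x
  proof -
    have "norm (gauss z x * h x) \<le> exp (- x\<^sup>2 / 2) * (A * (1 + x\<^sup>2))"
      using bounds(1) by (simp add: norm_mult norm_gauss assms(1) mult_left_mono)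
    then show ?thesis by (simp add: mult_ac)
  qed
  have decay: "((\<lambda>x::real. (1 + x\<^sup>2) * exp (- x\<^sup>2 / 2)) \<longlongrightarrow> 0) at_top" "((\<lambda>x::real. (1 + x\<^sup>2) * exp (- x\<^sup>2 / 2)) \<longlongrightarrow> 0) at_bot"
    by real_asymp+
  have lim: "((\<lambda>x. gauss z x * h x) \<longlongrightarrow> 0) at_top" "((\<lambda>x. gauss z x * h x) \<longlongrightarrow> 0) at_bot"
    by (rule Lim_null_comparison[OF always_eventually[OF allI[OF bound]] tendsto_mult_right_zero], rule decay)+
  have "(LBINT x=-\<infinity>..\<infinity>. f x) = 0 - 0"
  proof (rule interval_integral_FTC_integrable[where F = "\<lambda>x. gauss z x * h x"])
    fix x
    have "((\<lambda>x. - z * of_real (x\<^sup>2 / 2)) has_vector_derivative - z * of_real x) (at x)"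
      by (intro has_vector_derivative_mult_right has_vector_derivative_of_real)
        (rule derivative_eq_intros refl | simp)+
    from has_vector_derivative_mult[OF field_vector_diff_chain_at[OF this DERIV_exp] h(1)]
    show "((\<lambda>x. gauss z x * h x) has_vector_derivative f x) (at x)"
      by (simp add: o_def gauss_def f_def algebra_simps)
    show "isCont f x"
      using h(2) h_cont continuous_on_gauss[of UNIV z] unfolding f_def
      by (intro continuous_intros) (auto simp: continuous_on_eq_continuous_at)
  next
    show "set_integrable lborel (einterval (-\<infinity>) \<infinity>) f"
      using f_int by (simp add: set_integrable_def einterval_def)
  qed (use lim in \<open>simp_all add: ereal_tendsto_simps\<close>)
  then have "(\<integral>x. f x \<partial>lborel) = 0"
    by (simp add: interval_lebesgue_integral_def einterval_def set_lebesgue_integral_def)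
  then show "gauss_integral z h' = z * gauss_integral z (\<lambda>x. of_real x * h x)"
    using int1 int2 by (simp add: f_def gauss_integral_def)
qed

text \<open>The difference quotient is estimated directly. With a = (s - t) x^2 / 2 the error of
  exp(ia) against 1 + ia is at most a^2/2 = (s - t)^2 x^4 / 8, and the fourth moment makes this
  integrable; hence \<open>K\<close>.\<close>

lemma gauss_one_integral_deriv:
  "((\<lambda>t. gauss_integral (1 - \<i> * of_real t) (\<lambda>_. 1)) has_vector_derivative
     gauss_integral (1 - \<i> * of_real t) (\<lambda>x. \<i> * of_real (x\<^sup>2 / 2))) (at t)"
proof -
  define G where "G = (\<lambda>t. gauss_integral (1 - \<i> * of_real t) (\<lambda>_. 1))"
  define D where "D = gauss_integral (1 - \<i> * of_real t) (\<lambda>x. \<i> * of_real (x\<^sup>2 / 2))"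
  define K :: real where "K = (\<integral>x. exp (- x\<^sup>2 / 2) * x ^ (2 * 2) / 8 \<partial>lborel)"
  have int: "integrable lborel (\<lambda>x. gauss (1 - \<i> * of_real s) x * 1)"
    "integrable lborel (\<lambda>x. gauss (1 - \<i> * of_real s) x * (\<i> * of_real (x\<^sup>2 / 2)))" for s
  proof -
    note power2_le_1_plus_power_4(2)
    then show "integrable lborel (\<lambda>x. gauss (1 - \<i> * of_real s) x * 1)"
      "integrable lborel (\<lambda>x. gauss (1 - \<i> * of_real s) x * (\<i> * of_real (x\<^sup>2 / 2)))"
      by (intro integrable_gauss_mult[where B = 1] continuous_intros; simp add: norm_mult norm_power norm_divide)+
  qed
  have K: "integrable lborel (\<lambda>x::real. exp (- x\<^sup>2 / 2) * x ^ (2 * 2) / 8)"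
    using integrable.intros[OF exp_moment[of 2]] by simp
  have est: "norm (G s - G t - (s - t) *\<^sub>R D) \<le> K * (s - t)\<^sup>2" for s
  proof -
    let ?r = "\<lambda>x. gauss (1 - \<i> * of_real s) x * 1 - gauss (1 - \<i> * of_real t) x * 1 -
        (s - t) *\<^sub>R (gauss (1 - \<i> * of_real t) x * (\<i> * of_real (x\<^sup>2 / 2)))"
    have Gr: "G s - G t - (s - t) *\<^sub>R D = (\<integral>x. ?r x \<partial>lborel)"
      unfolding G_def D_def gauss_integral_def
      by (simp only: Bochner_Integration.integral_diff integral_scaleR_right int Bochner_Integration.integrable_diff integrable_scaleR_right)
    have "norm (\<integral>x. ?r x \<partial>lborel) \<le> (\<integral>x. (s - t)\<^sup>2 * (exp (- x\<^sup>2 / 2) * x ^ (2 * 2) / 8) \<partial>lborel)"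
    proof (rule Bochner_Integration.integral_norm_bound_integral)
      show "integrable lborel ?r"
        by (intro Bochner_Integration.integrable_diff integrable_scaleR_right int)
      show "integrable lborel (\<lambda>x. (s - t)\<^sup>2 * (exp (- x\<^sup>2 / 2) * x ^ (2 * 2) / 8))"
        by (intro integrable_mult_right K)
      fix x :: real
      define a where "a = (s - t) * (x\<^sup>2 / 2)"
      have "gauss (1 - \<i> * of_real s) x = gauss (1 - \<i> * of_real t) x * exp (\<i> * of_real a)"
        unfolding gauss_def exp_add[symmetric]
        by (rule arg_cong[of _ _ exp]) (simp add: a_def field_simps)
      then have "?r x = gauss (1 - \<i> * of_real t) x * (exp (\<i> * of_real a) - (1 + \<i> * of_real a))"
        by (simp add: a_def scaleR_conv_of_real algebra_simps)
      moreover have "norm (exp (\<i> * of_real a) - (1 + \<i> * of_real a)) \<le> a\<^sup>2 / 2"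
        using iexp_approx1[of a 1] by (simp add: power2_eq_square)
      moreover have a2: "a\<^sup>2 / 2 = (s - t)\<^sup>2 * (x ^ (2 * 2) / 8)"
        unfolding a_def power_mult_distrib power_divide power_mult by simp
      ultimately have "norm (?r x) \<le> exp (- x\<^sup>2 / 2) * (a\<^sup>2 / 2)"
        by (simp add: norm_mult norm_gauss mult_left_mono)
      also have "\<dots> = (s - t)\<^sup>2 * (exp (- x\<^sup>2 / 2) * x ^ (2 * 2) / 8)"
        by (simp only: a2 mult_ac times_divide_eq_right)
      finally show "norm (?r x) \<le> (s - t)\<^sup>2 * (exp (- x\<^sup>2 / 2) * x ^ (2 * 2) / 8)" .
    qed
    then show ?thesis
      unfolding Gr K_def Bochner_Integration.integral_mult_right[OF K] by (simp only: mult.commute)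
  qed
  have "(G has_vector_derivative D) (at t)"
    unfolding has_vector_derivative_def
  proof (rule has_derivativeI_sandwich[of 1])
    show "bounded_linear (\<lambda>x. x *\<^sub>R D)" by (rule bounded_linear_scaleR_left)
    fix s assume "s \<noteq> t" "dist s t < 1"
    have "norm (G s - G t - (s - t) *\<^sub>R D) / norm (s - t) \<le> K * (s - t)\<^sup>2 / norm (s - t)"
      by (intro divide_right_mono est) simp
    moreover have "K * d\<^sup>2 / d = K * d" if "d > 0" for d :: real
      using that by (simp add: power2_eq_square)
    from this[of "\<bar>s - t\<bar>"] have "K * (s - t)\<^sup>2 / norm (s - t) = K * \<bar>s - t\<bar>"
      using \<open>s \<noteq> t\<close> by simp
    ultimately show "norm (G s - G t - (s - t) *\<^sub>R D) / norm (s - t) \<le> K * \<bar>s - t\<bar>" by simp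
  next
    show "((\<lambda>s. K * \<bar>s - t\<bar>) \<longlongrightarrow> 0) (at t)"
      by (rule tendsto_eq_intros refl | simp)+
  qed simp
  then show ?thesis by (simp add: G_def D_def)
qed

text \<open>Integration by parts turns the derivative in \<open>t\<close> into the ODE \<open>G' = i G / (2 z)\<close>, \<open>z = 1 - i t\<close>.\<close>

lemma gauss_integral_one:
  "gauss_integral (1 - \<i> * of_real t) (\<lambda>_. 1) = of_real (sqrt (2 * pi)) / csqrt (1 - \<i> * of_real t)"
proof -
  define G where "G = (\<lambda>t. gauss_integral (1 - \<i> * of_real t) (\<lambda>_. 1))"
  \<comment> \<open>The product is constant by the ODE and known at t = 0. Since Re z = 1 stays off
    the branch cut, this also settles which square root occurs.\<close>
  define Q where "Q = (\<lambda>t. csqrt (1 - \<i> * of_real t) * G t)"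
  have nz: "csqrt (1 - \<i> * of_real t) \<noteq> 0" for t
  proof -
    have "csqrt (1 - \<i> * of_real t) ^ 2 \<noteq> 0"
      by (simp only: power2_csqrt) (simp add: complex_eq_iff)
    then show ?thesis by force
  qed
  have "(Q has_vector_derivative 0) (at t)" for t
  proof -
    define z where "z = 1 - \<i> * complex_of_real t"
    have z: "z \<notin> \<real>\<^sub>\<le>\<^sub>0" "Re z = 1" "z \<noteq> 0" "csqrt z \<noteq> 0" "csqrt z ^ 2 = z"
      using nz[of t] by (auto simp: z_def complex_nonpos_Reals_iff complex_eq_iff)
    have "((\<lambda>t. 1 - \<i> * complex_of_real t) has_vector_derivative - \<i>) (at t)"
      using has_vector_derivative_diff[OF has_vector_derivative_const
          has_vector_derivative_mult_right[OF has_vector_derivative_of_real[OF DERIV_ident]], of 1 \<i>]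
      by simp
    moreover have "(csqrt has_field_derivative 1 / (2 * csqrt z)) (at z)"
      using has_field_derivative_csqrt[OF z(1)] by (simp only: inverse_eq_divide)
    ultimately have 1: "((\<lambda>t. csqrt (1 - \<i> * of_real t)) has_vector_derivative - \<i> * (1 / (2 * csqrt z))) (at t)"
      using field_vector_diff_chain_at[of "\<lambda>t. 1 - \<i> * complex_of_real t" "- \<i>" t csqrt] unfolding o_def z_def by blast
    have "gauss_integral z (\<lambda>_. 1) = z * gauss_integral z (\<lambda>x. of_real x * of_real x)"
    proof (rule gauss_integral_by_parts(1)[OF z(2), of _ _ 1])
      show "(complex_of_real has_vector_derivative 1) (at x)" for x
        using has_vector_derivative_of_real[OF DERIV_ident] by simp
      show "norm (complex_of_real x) \<le> 1 * (1 + x\<^sup>2)" for x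
        using sum_squares_ge_zero[of "\<bar>x\<bar> - 1" "x"] by (simp add: power2_eq_square algebra_simps) 
    qed auto
    moreover have "gauss_integral z (\<lambda>x. \<i> * of_real (x\<^sup>2 / 2)) = \<i> / 2 * gauss_integral z (\<lambda>x. of_real x * of_real x)"
      unfolding gauss_integral_def integral_mult_right_zero[symmetric] by (simp add: power2_eq_square mult_ac)
    ultimately have "gauss_integral z (\<lambda>x. \<i> * of_real (x\<^sup>2 / 2)) = \<i> / 2 * (G t / z)"
      using z(3) by (simp add: G_def z_def[symmetric])
    then have 2: "(G has_vector_derivative \<i> / 2 * (G t / z)) (at t)"
      using gauss_one_integral_deriv[of t] by (simp add: G_def z_def)
    have "csqrt z * (\<i> / 2 * (G t / csqrt z ^ 2)) + - \<i> * (1 / (2 * csqrt z)) * G t = 0"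
      using z(4) by (simp add: power2_eq_square field_simps)
    with has_vector_derivative_mult[OF 1 2] show ?thesis
      by (simp add: Q_def[abs_def] z_def[symmetric] z(5))
  qed
  then have "norm (Q t - Q 0) \<le> 0 * norm (t - 0)"
    by (intro vector_differentiable_bound) auto
  moreover have "G 0 = of_real (sqrt (2 * pi))"
  proof -
    have "has_bochner_integral lborel (\<lambda>x. complex_of_real (exp (- x\<^sup>2 / 2) * x ^ (2 * 0))) (of_real (sqrt (2 * pi) * (fact (2 * 0) / (2 ^ 0 * fact 0))))"
      by (intro has_bochner_integral_of_real exp_moment)
    then show ?thesis
      by (simp add: G_def gauss_integral_def gauss_def has_bochner_integral_integral_eq flip: exp_of_real)
  qed
  ultimately have "csqrt (1 - \<i> * of_real t) * G t = of_real (sqrt (2 * pi))"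
    by (simp add: Q_def)
  then show ?thesis using nz[of t] by (simp add: G_def field_simps)
qed

text \<open>Compact support does not survive a Hadamard quotient, which is -F(0)/x away from the
  support; boundedness of all derivatives does survive.\<close>

definition all_derivs_bounded :: "(real \<Rightarrow> complex) \<Rightarrow> bool" where
  "all_derivs_bounded F \<longleftrightarrow> smooth F \<and> (\<forall>j. \<exists>B. \<forall>x. norm ((vd ^^ j) F x) \<le> B)"

definition phase_step :: "(real \<Rightarrow> complex) \<Rightarrow> real \<Rightarrow> complex" where
  "phase_step F = vd (hadamard F)"

lemma funpow_vd_phase_step: "smooth F \<Longrightarrow> (vd ^^ j) (phase_step F) = wmean (Suc j) ((vd ^^ (j + 2)) F)"
  using funpow_vd_hadamard[of F "Suc j"] by (simp add: phase_step_def funpow_Suc_right del: funpow.simps)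

lemma all_derivs_bounded_phase_step:
  assumes "all_derivs_bounded F" shows "all_derivs_bounded (phase_step F)"
proof -
  have "smooth F" using assms by (simp add: all_derivs_bounded_def)
  then show ?thesis
    using assms norm_wmean_le[OF smooth_vd_funpow[OF \<open>smooth F\<close>]]
    unfolding all_derivs_bounded_def funpow_vd_phase_step[OF \<open>smooth F\<close>]
    by (metis phase_step_def smooth_hadamard smooth_vd)
qed

text \<open>One step costs two derivatives, and the mean of t^(2j+1) over [0,1] contributes
  1/(2j+2). The product 2 * 4 * ... * 2j is 2^j j!.\<close>

lemma funpow_phase_step_0:
  "smooth F \<Longrightarrow> (phase_step ^^ j) F 0 = (vd ^^ (2 * j)) F 0 / (2 ^ j * fact j)"
proof (induction j arbitrary: F)
  case (Suc j)
  have "smooth (phase_step F)"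
    using Suc.prems by (simp add: phase_step_def smooth_vd smooth_hadamard)
  from Suc.IH[OF this]
  have "(phase_step ^^ Suc j) F 0 = (vd ^^ (2 * j)) (phase_step F) 0 / (2 ^ j * fact j)"
    by (simp only: funpow_Suc_right o_apply)
  also have "(vd ^^ (2 * j)) (phase_step F) 0 = (vd ^^ (2 * j + 2)) F 0 / of_nat (2 * j + 2)"
    using Suc.prems by (simp add: funpow_vd_phase_step wmean_0 del: funpow.simps)
  finally show ?case
    by (simp add: divide_simps algebra_simps)
qed simp

lemma gauss_integral_step:
  assumes F: "all_derivs_bounded F"
  shows "gauss_integral (1 - \<i> * of_real t) F = F 0 * of_real (sqrt (2 * pi)) / csqrt (1 - \<i> * of_real t)
     + 1 / (1 - \<i> * of_real t) * gauss_integral (1 - \<i> * of_real t) (phase_step F)"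
proof -
  define z where "z = 1 - \<i> * complex_of_real t"
  have z: "Re z = 1" "z \<noteq> 0" by (auto simp: z_def complex_eq_iff)
  have "smooth F" using F by (simp add: all_derivs_bounded_def)
  obtain B1 B2 where B: "\<And>x. norm (vd F x) \<le> B1" "\<And>x. norm ((vd ^^ (0 + 2)) F x) \<le> B2"
    using F unfolding all_derivs_bounded_def by (metis funpow_0 funpow_Suc_right o_apply)
  have H: "norm (hadamard F x) \<le> max B1 B2 * (1 + x\<^sup>2)" "norm (phase_step F x) \<le> max B1 B2 * (1 + x\<^sup>2)" for x
  proof -
    have "norm (hadamard F x) \<le> B1" "norm (phase_step F x) \<le> B2"
      using norm_wmean_le[OF smooth_vd[OF \<open>smooth F\<close>] B(1), of 0 x]
        norm_wmean_le[OF smooth_vd_funpow[OF \<open>smooth F\<close>] B(2), of "Suc 0" x]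
        funpow_vd_phase_step[OF \<open>smooth F\<close>, of 0, symmetric]
      by (simp_all only: hadamard_def funpow_0)
    moreover have "max B1 B2 * 1 \<le> max B1 B2 * (1 + x\<^sup>2)"
      using norm_ge_zero[of "vd F 0"] B(1)[of 0] by (intro mult_left_mono) (auto simp del: norm_ge_zero)
    ultimately show "norm (hadamard F x) \<le> max B1 B2 * (1 + x\<^sup>2)" "norm (phase_step F x) \<le> max B1 B2 * (1 + x\<^sup>2)"
      by linarith+
  qed
  have deriv: "(hadamard F has_vector_derivative phase_step F x) (at x)" for x
    unfolding phase_step_def by (intro smooth_has_vd smooth_hadamard \<open>smooth F\<close>)
  have cont: "continuous_on UNIV (phase_step F)"
    unfolding phase_step_def by (intro smooth_continuous_on smooth_vd smooth_hadamard \<open>smooth F\<close>)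
  note parts = gauss_integral_by_parts[OF z(1) deriv cont H]
  have "integrable lborel (\<lambda>x. gauss z x * F 0)"
    by (intro integrable_gauss_mult[where B = "norm (F 0)"] z continuous_intros)
      (simp add: algebra_simps)
  from Bochner_Integration.integral_add[OF this parts(2)]
  have "gauss_integral z F = (\<integral>x. gauss z x * F 0 \<partial>lborel) + gauss_integral z (\<lambda>x. of_real x * hadamard F x)"
    unfolding gauss_integral_def distrib_left[symmetric] hadamard_eq[OF \<open>smooth F\<close>, symmetric] .
  also have "(\<integral>x. gauss z x * F 0 \<partial>lborel) = F 0 * gauss_integral z (\<lambda>_. 1)"
    by (simp add: gauss_integral_def)
  also have "gauss_integral z (\<lambda>x. of_real x * hadamard F x) = 1 / z * gauss_integral z (phase_step F)"
    using parts(1) z(2) by simp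
  finally show ?thesis by (simp add: z_def gauss_integral_one)
qed

lemma all_derivs_bounded_funpow_phase_step:
  "all_derivs_bounded F \<Longrightarrow> all_derivs_bounded ((phase_step ^^ N) F)"
  by (induction N) (auto intro: all_derivs_bounded_phase_step)

lemma gauss_integral_expansion:
  assumes F: "all_derivs_bounded F"
  shows "gauss_integral (1 - \<i> * of_real t) F =
     (\<Sum>j<N. (phase_step ^^ j) F 0 * (1 / (1 - \<i> * of_real t)) ^ j) * of_real (sqrt (2 * pi)) / csqrt (1 - \<i> * of_real t)
     + (1 / (1 - \<i> * of_real t)) ^ N * gauss_integral (1 - \<i> * of_real t) ((phase_step ^^ N) F)"
proof (induction N)
  case (Suc N)
  have "S * c / s + p * (a * c / s + w * g) = (S + a * p) * c / s + (w * p) * g" for S c s p a w g :: complex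
    by (simp add: divide_inverse distrib_left distrib_right mult_ac)
  then show ?case
    unfolding Suc gauss_integral_step[OF all_derivs_bounded_funpow_phase_step[OF F], of t N]
    by (simp only: funpow.simps o_apply sum.lessThan_Suc power_Suc)
qed simp

text \<open>The modulus of the Gaussian does not depend on t, so the bound is uniform in t; the
  power of 1/z in front of the remainder then supplies all the decay.\<close>

lemma gauss_integral_bound:
  assumes "all_derivs_bounded F"
  obtains K where "\<And>t. norm (gauss_integral (1 - \<i> * of_real t) F) \<le> K"
proof -
  obtain B where B: "\<And>x. norm (F x) \<le> B"
    using assms unfolding all_derivs_bounded_def by (metis funpow_0)
  have "smooth F" using assms by (simp add: all_derivs_bounded_def)
  have "B \<ge> 0" using B[of 0] norm_ge_zero order_trans by blast
  have int: "integrable lborel (\<lambda>x. B * (exp (- x\<^sup>2 / 2) * x ^ (2 * 0)))"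
    by (intro integrable_mult_right integrable.intros[OF exp_moment])
  show ?thesis
  proof (rule that)
    fix t
    show "norm (gauss_integral (1 - \<i> * of_real t) F) \<le> (\<integral>x. B * (exp (- x\<^sup>2 / 2) * x ^ (2 * 0)) \<partial>lborel)"
      unfolding gauss_integral_def
    proof (rule Bochner_Integration.integral_norm_bound_integral[OF _ int])
      have "B \<le> B * (1 + x ^ 4)" for x :: real
        using \<open>B \<ge> 0\<close> by (simp add: algebra_simps)
      then show "integrable lborel (\<lambda>x. gauss (1 - \<i> * of_real t) x * F x)"
        using B by (intro integrable_gauss_mult[where B = B] smooth_continuous_on \<open>smooth F\<close>) (auto intro: order_trans)
      show "norm (gauss (1 - \<i> * of_real t) x * F x) \<le> B * (exp (- x\<^sup>2 / 2) * x ^ (2 * 0))" for x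
        using B[of x] by (simp add: norm_mult norm_gauss mult.commute mult_right_mono)
    qed
  qed
qed

subsection \<open>Even functions: stationary phase\<close>

context resolved
begin

lemma oscillatory_integral_eq_gauss_integral:
  assumes f: "smooth f" "supp_in b f"
  defines "F \<equiv> \<lambda>x. f x * exp (of_real x ^ 2 * (1 / 2))"
  shows "all_derivs_bounded F"
    and "oscillatory_integral f k = gauss_integral (1 - \<i> * of_real (\<alpha> * real k)) F"
proof -
  have F: "smooth F" "supp_in b F"
    unfolding F_def
    by (intro smooth_mult smooth_exp smooth_power smooth_of_real smooth_const f(1))
      (use f(2) in \<open>simp add: supp_in_def\<close>)
  show adb: "all_derivs_bounded F"
    unfolding all_derivs_bounded_def
    using smooth_supp_bounded[OF smooth_vd_funpow[OF F(1)] supp_in_vd_funpow[OF F(2)]] F(1) by metis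
  let ?z = "1 - \<i> * complex_of_real (\<alpha> * real k)"
  obtain B where B: "B \<ge> 0" "\<And>x. norm (F x) \<le> B" using smooth_supp_bounded[OF F] by blast
  have "B \<le> B * (1 + x ^ 4)" for x :: real
    using B(1) by (simp add: algebra_simps)
  then have "integrable lborel (\<lambda>x. gauss ?z x * F x)"
    using B by (intro integrable_gauss_mult[where B = B] smooth_continuous_on F) (auto intro: order_trans)
  then have *: "gauss_integral ?z F = integral UNIV (\<lambda>x. gauss ?z x * F x)"
    by (simp add: gauss_integral_def integral_lborel)
  have "gauss ?z x * F x = exp (\<i> * of_real (\<alpha> / 2 * real k * x\<^sup>2)) * f x" for x
  proof -
    have "gauss ?z x * exp (of_real x ^ 2 * (1 / 2)) = exp (\<i> * of_real (\<alpha> / 2 * real k * x\<^sup>2))"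
      unfolding gauss_def exp_add[symmetric] by (rule arg_cong[of _ _ exp]) (simp add: algebra_simps diff_divide_distrib)
    then show ?thesis by (simp add: F_def mult_ac)
  qed
  then show "oscillatory_integral f k = gauss_integral ?z F"
    unfolding * oscillatory_integral_def by (simp only:)
qed

text \<open>At w = 1/k this is z^(-1/2) with the factor k^(-1/2) removed, where z = 1 - i\<alpha>k.
  It is smooth at w = 0, so only integer powers of 1/k remain.\<close>

definition inv_root :: "real \<Rightarrow> complex" where
  "inv_root w = 1 / csqrt (of_real w - \<i> * of_real \<alpha>)"

lemma smooth_inv_root: "smooth inv_root"
  unfolding inv_root_def[abs_def] by (rule smooth_inverse_csqrt[OF \<alpha>])

text \<open>z = k (1/k - i\<alpha>), and a positive factor leaves the argument unchanged, so the
  principal root is multiplicative here.\<close>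

lemma inv_root_scaling:
  assumes "k > 0"
  shows "1 / csqrt (1 - \<i> * of_real (\<alpha> * real k)) = inv_root (1 / real k) / of_real (sqrt (real k))"
    and "1 / (1 - \<i> * of_real (\<alpha> * real k)) = ik k * inv_root (1 / real k) ^ 2"
proof -
  define \<zeta> where "\<zeta> = of_real (1 / real k) - \<i> * complex_of_real \<alpha>"
  have eq: "1 - \<i> * of_real (\<alpha> * real k) = of_real (real k) * \<zeta>"
    using assms by (simp add: \<zeta>_def algebra_simps)
  have inv: "inv_root (1 / real k) = 1 / csqrt \<zeta>"
    by (simp only: inv_root_def \<zeta>_def)
  have "csqrt (of_real (real k) * \<zeta>) = of_real (sqrt (real k)) * csqrt \<zeta>"
  proof (rule csqrt_unique)
    show "(of_real (sqrt (real k)) * csqrt \<zeta>)\<^sup>2 = of_real (real k) * \<zeta>"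
      by (simp add: power_mult_distrib flip: of_real_power)
    show "0 < Re (of_real (sqrt (real k)) * csqrt \<zeta>) \<or>
       Re (of_real (sqrt (real k)) * csqrt \<zeta>) = 0 \<and> 0 \<le> Im (of_real (sqrt (real k)) * csqrt \<zeta>)"
      using csqrt_principal[of \<zeta>] assms by (auto simp del: csqrt.simps)
  qed
  then show "1 / csqrt (1 - \<i> * of_real (\<alpha> * real k)) = inv_root (1 / real k) / of_real (sqrt (real k))"
    unfolding eq by (simp add: inv)
  show "1 / (1 - \<i> * of_real (\<alpha> * real k)) = ik k * inv_root (1 / real k) ^ 2"
    unfolding eq by (simp add: inv power_divide inverse_eq_divide)
qed

lemma norm_inv_root_le: "norm (inv_root w ^ 2) \<le> 1 / \<bar>\<alpha>\<bar>"
proof -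
  have "\<bar>\<alpha>\<bar> \<le> norm (of_real w - \<i> * complex_of_real \<alpha>)"
    using abs_Im_le_cmod[of "of_real w - \<i> * complex_of_real \<alpha>"] by simp
  then show ?thesis
    using \<alpha> by (simp add: inv_root_def power_divide norm_divide frac_le)
qed

definition normalized_sum :: "(real \<Rightarrow> complex) \<Rightarrow> nat \<Rightarrow> complex" where
  "normalized_sum f k = trapezoid_sum f k / of_real (sqrt (real k))"

text \<open>Prefactor k/2 and division by the root of k leave a factor sqrt(k) in front of the
  remainder of the Gaussian expansion. Taking N + 1 terms makes that remainder O(k^-(N+1)), which
  absorbs it.\<close>

lemma normalized_sum_expansion:
  assumes f: "smooth f" "supp_in b f" "has_parity 1 f"
  defines "F \<equiv> \<lambda>x. f x * exp (of_real x ^ 2 * (1 / 2))"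
  shows "(\<lambda>k. normalized_sum f k - of_real (sqrt (2 * pi) / 2) *
      (\<Sum>j<N+1. (phase_step ^^ j) F 0 * ik k ^ j * inv_root (1 / real k) ^ (2 * j + 1))) \<in> O(\<lambda>k. ik k ^ N)"
proof -
  have F: "all_derivs_bounded F"
    unfolding F_def by (rule oscillatory_integral_eq_gauss_integral[OF f(1,2)])
  obtain C where C: "C \<ge> 0" "\<And>k. k > 0 \<Longrightarrow>
      norm (trapezoid_sum f k - of_nat k / 2 * oscillatory_integral f k) \<le> C * real k / real k ^ (N+1)"
    using trapezoid_sum_integral[OF f] by meson
  obtain K where K: "\<And>t. norm (gauss_integral (1 - \<i> * of_real t) ((phase_step ^^ (N+1)) F)) \<le> K"
    using gauss_integral_bound[OF all_derivs_bounded_funpow_phase_step[OF F]] by blast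
  have "K \<ge> 0" using K norm_ge_zero order_trans by blast
  show ?thesis
  proof (rule bigoI, use eventually_gt_at_top[of "0::nat"] in eventually_elim)
    fix k :: nat assume k: "k > 0"
    define rk where "rk = complex_of_real (sqrt (real k))"
    define q where "q = inv_root (1 / real k)"
    define R where "R = gauss_integral (1 - \<i> * of_real (\<alpha> * real k)) ((phase_step ^^ (N+1)) F)"
    have R_le: "norm R \<le> K" unfolding R_def by (rule K)
    define S where "S = (\<Sum>j<N+1. (phase_step ^^ j) F 0 * ik k ^ j * q ^ (2 * j + 1))"
    have rk: "rk \<noteq> 0" "rk * rk = of_nat k" using k by (simp_all add: rk_def flip: of_real_mult)
    have "oscillatory_integral f k =
       (\<Sum>j<N+1. (phase_step ^^ j) F 0 * (ik k * q ^ 2) ^ j) * of_real (sqrt (2 * pi)) * (q / rk) + (ik k * q ^ 2) ^ (N+1) * R"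
      unfolding oscillatory_integral_eq_gauss_integral(2)[OF f(1,2), folded F_def]
      by (subst gauss_integral_expansion[OF F, of _ "N+1"])
        (simp only: inv_root_scaling[OF k, symmetric] q_def rk_def R_def times_divide_eq_right mult_1_right)
    also have "(\<Sum>j<N+1. (phase_step ^^ j) F 0 * (ik k * q ^ 2) ^ j) * of_real (sqrt (2 * pi)) * (q / rk) =
       of_real (sqrt (2 * pi)) / rk * S"
      by (simp add: S_def sum_distrib_left sum_distrib_right sum_divide_distrib power_mult_distrib power_mult[symmetric] mult_ac
          del: sum.lessThan_Suc)
    finally have eq: "oscillatory_integral f k = of_real (sqrt (2 * pi)) / rk * S + (ik k * q ^ 2) ^ (N+1) * R" .
    have "r * r / 2 * (c / r * S + X) / r = c / 2 * S + r / 2 * X" if "r \<noteq> 0" for r c S X :: complex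
      using that by (simp add: divide_simps)
    from this[OF rk(1)] have osc: "of_nat k / 2 * oscillatory_integral f k / rk =
        of_real (sqrt (2 * pi) / 2) * S + rk / 2 * ((ik k * q ^ 2) ^ (N+1) * R)"
      unfolding eq rk(2)[symmetric] by (simp only: of_real_divide of_real_numeral)
    have "normalized_sum f k - of_real (sqrt (2 * pi) / 2) * S =
        (trapezoid_sum f k - of_nat k / 2 * oscillatory_integral f k) / rk + rk / 2 * ((ik k * q ^ 2) ^ (N+1) * R)"
      unfolding diff_divide_distrib osc by (simp add: normalized_sum_def rk_def)
    also have "norm \<dots> \<le> C * norm (ik k ^ N) + (1 / \<bar>\<alpha>\<bar>) ^ (N+1) * K * norm (ik k ^ N)"
    proof (intro norm_triangle_le add_mono)
      have "1 \<le> sqrt (real k)" using k by simp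
      then have nrk: "norm rk \<ge> 1" by (simp add: rk_def)
      have "norm ((trapezoid_sum f k - of_nat k / 2 * oscillatory_integral f k) / rk)
          \<le> (C * real k / real k ^ (N+1)) / 1"
        unfolding norm_divide using C(1) C(2)[OF k] nrk by (intro frac_le) auto
      also have "\<dots> = C * norm (ik k ^ N)"
        using k by (simp add: norm_power norm_inverse norm_divide field_simps)
      finally show "norm ((trapezoid_sum f k - of_nat k / 2 * oscillatory_integral f k) / rk) \<le> C * norm (ik k ^ N)" .
      have "sqrt (real k) * 1 \<le> sqrt (real k) * sqrt (real k)"
        using \<open>1 \<le> sqrt (real k)\<close> by (intro mult_left_mono) auto
      then have "norm (rk / 2) \<le> real k" by (simp add: rk_def norm_divide)
      moreover have "norm (ik k * q ^ 2) \<le> 1 / real k * (1 / \<bar>\<alpha>\<bar>)"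
        unfolding norm_mult q_def using norm_inv_root_le by (intro mult_mono) (auto simp: norm_inverse norm_divide inverse_eq_divide)
      ultimately have "norm (rk / 2 * ((ik k * q ^ 2) ^ (N+1) * R)) \<le> real k * ((1 / real k * (1 / \<bar>\<alpha>\<bar>)) ^ (N+1) * K)"
        unfolding norm_mult[of "rk / 2"] norm_mult[of _ R] norm_power
        using R_le \<open>K \<ge> 0\<close> by (intro mult_mono power_mono mult_nonneg_nonneg zero_le_power) auto
      also have "\<dots> = (real k * (1 / real k) ^ (N+1)) * ((1 / \<bar>\<alpha>\<bar>) ^ (N+1) * K)"
        by (simp only: power_mult_distrib mult_ac)
      also have "real k * (1 / real k) ^ (N+1) = norm (ik k ^ N)"
        using k by (simp add: norm_power norm_inverse norm_divide inverse_eq_divide)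
      finally show "norm (rk / 2 * ((ik k * q ^ 2) ^ (N+1) * R)) \<le> (1 / \<bar>\<alpha>\<bar>) ^ (N+1) * K * norm (ik k ^ N)"
        by (simp only: mult_ac)
    qed
    also have "\<dots> = (C + (1 / \<bar>\<alpha>\<bar>) ^ (N+1) * K) * norm (ik k ^ N)"
      by (simp only: distrib_right)
    finally show "norm (normalized_sum f k - of_real (sqrt (2 * pi) / 2) *
      (\<Sum>j<N+1. (phase_step ^^ j) F 0 * ik k ^ j * inv_root (1 / real k) ^ (2 * j + 1)))
        \<le> (C + (1 / \<bar>\<alpha>\<bar>) ^ (N+1) * K) * norm (ik k ^ N)"
      unfolding S_def q_def .
  qed
qed

lemma pexp_normalized_sum:
  assumes "smooth f" "supp_in b f" "has_parity 1 f"
  shows "pexp N (normalized_sum f)"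
  by (rule pexp_perturb[OF _ normalized_sum_expansion[OF assms]])
    (intro pexp_mult pexp_sum pexp_const pexp_power pexp_ik pexp_smooth smooth_inv_root)

text \<open>The expansion is used one order further than needed for n. Terms below n vanish, the
  last one is absorbed in the error, and in the n-th \<open>inv_root (1 / real k)\<close> may be
  replaced by its value at 0 at the cost of a factor 1/k.\<close>

lemma normalized_sum_leading_term:
  assumes f: "smooth f" "supp_in b f" "has_parity 1 f"
  defines "F \<equiv> \<lambda>x. f x * exp (of_real x ^ 2 * (1 / 2))"
  assumes van: "\<And>j. j < 2 * n \<Longrightarrow> (vd ^^ j) F 0 = 0"
  shows "(\<lambda>k. normalized_sum f k - of_real (sqrt (2 * pi) / 2) * inv_root 0 ^ (2 * n + 1) *
     (vd ^^ (2 * n)) F 0 / (2 ^ n * fact n) * ik k ^ n) \<in> O(\<lambda>k. ik k ^ (n + 1))"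
proof -
  let ?c = "complex_of_real (sqrt (2 * pi) / 2)"
  have "smooth F"
    using oscillatory_integral_eq_gauss_integral(1)[OF f(1,2)] by (simp add: F_def all_derivs_bounded_def)
  note D = funpow_phase_step_0[OF this]
  have "(\<lambda>k. inv_root (1 / real k) ^ (2 * n + 1) - inv_root 0 ^ (2 * n + 1)) \<in> O(ik)"
    using smooth_taylor_ik[OF smooth_power[OF smooth_inv_root, of "2 * n + 1"], of 1 1] by simp
  from landau_o.big.mult[OF this landau_o.big_refl[of "\<lambda>k. ik k ^ n"]]
  have B: "(\<lambda>k. ?c * (phase_step ^^ n) F 0 * ((inv_root (1 / real k) ^ (2 * n + 1) - inv_root 0 ^ (2 * n + 1)) * ik k ^ n))
     \<in> O(\<lambda>k. ik k ^ (n + 1))"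
    using landau_o.big.mult[OF bigo_const[of "?c * (phase_step ^^ n) F 0" sequentially]] by fastforce
  have C: "(\<lambda>k. ?c * (phase_step ^^ (n+1)) F 0 * inv_root (1 / real k) ^ (2 * (n+1) + 1) * ik k ^ (n+1)) \<in> O(\<lambda>k. ik k ^ (n + 1))"
    using landau_o.big.mult[OF pexp_bigo[OF pexp_mult[OF pexp_const[of 0 "?c * (phase_step ^^ (n+1)) F 0"]
       pexp_smooth[OF smooth_power[OF smooth_inv_root, of "2 * (n + 1) + 1"], of 0 1]]] landau_o.big_refl[of "\<lambda>k. ik k ^ (n+1)"]]
    by (simp only: mult_1 mult.assoc)
  have A: "(\<lambda>k. normalized_sum f k - ?c *
      (\<Sum>j<n+1+1. (phase_step ^^ j) F 0 * ik k ^ j * inv_root (1 / real k) ^ (2 * j + 1))) \<in> O(\<lambda>k. ik k ^ (n+1))"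
    unfolding F_def by (rule normalized_sum_expansion[OF f])
  have two_terms: "(\<Sum>j<n+1+1. (phase_step ^^ j) F 0 * ik k ^ j * inv_root (1 / real k) ^ (2 * j + 1)) =
     (phase_step ^^ n) F 0 * ik k ^ n * inv_root (1 / real k) ^ (2 * n + 1) +
     (phase_step ^^ (n+1)) F 0 * ik k ^ (n+1) * inv_root (1 / real k) ^ (2 * (n+1) + 1)" for k
  proof -
    have "(\<Sum>j<n. (phase_step ^^ j) F 0 * ik k ^ j * inv_root (1 / real k) ^ (2 * j + 1)) = 0"
      using van by (intro sum.neutral) (simp add: D)
    then show ?thesis by (simp del: funpow.simps power_Suc)
  qed
  have "(\<lambda>k. (normalized_sum f k - ?c * ((phase_step ^^ n) F 0 * ik k ^ n * inv_root (1 / real k) ^ (2 * n + 1) +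
     (phase_step ^^ (n+1)) F 0 * ik k ^ (n+1) * inv_root (1 / real k) ^ (2 * (n+1) + 1)))
     + (?c * (phase_step ^^ n) F 0 * ((inv_root (1 / real k) ^ (2 * n + 1) - inv_root 0 ^ (2 * n + 1)) * ik k ^ n)
     + ?c * (phase_step ^^ (n+1)) F 0 * inv_root (1 / real k) ^ (2 * (n+1) + 1) * ik k ^ (n+1))) \<in> O(\<lambda>k. ik k ^ (n + 1))"
    by (rule sum_in_bigo(1)[OF A[unfolded two_terms] sum_in_bigo(1)[OF B C]])
  moreover have "(V - c * (d * i * q + d' * i' * q')) + (c * d * ((q - q0) * i) + c * d' * q' * i') = V - c * q0 * d * i"
    for V c d i q d' i' q' q0 :: complex
    by (simp add: algebra_simps)
  ultimately have "(\<lambda>k. normalized_sum f k - ?c * inv_root 0 ^ (2 * n + 1) * (phase_step ^^ n) F 0 * ik k ^ n) \<in> O(\<lambda>k. ik k ^ (n + 1))"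
    by (simp only:)
  then show ?thesis by (simp only: D times_divide_eq_right)
qed

end

text \<open>The argument of -i\<alpha> is -(pi/2) sgn \<alpha>; half of it lies in the right
  half-plane and is therefore the principal choice. This is the source of the phase pi/4 in the even
  expansion.\<close>

lemma inverse_csqrt_imaginary:
  assumes "\<alpha> \<noteq> 0"
  shows "1 / csqrt (- \<i> * of_real \<alpha>) = exp (\<i> * of_real (pi / 4 * sgn \<alpha>)) / of_real (sqrt \<bar>\<alpha>\<bar>)"
proof -
  define w where "w = of_real (sqrt \<bar>\<alpha>\<bar>) * exp (\<i> * of_real (- (pi / 4 * sgn \<alpha>)))"
  have "csqrt (- \<i> * of_real \<alpha>) = w"
  proof (rule csqrt_unique)
    have "w\<^sup>2 = of_real (sqrt \<bar>\<alpha>\<bar>) ^ 2 * exp (\<i> * of_real (- (pi / 2 * sgn \<alpha>)))"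
      by (simp add: w_def power_mult_distrib exp_double[symmetric] mult_ac)
    also have "\<dots> = of_real \<bar>\<alpha>\<bar> * cis (- (pi / 2 * sgn \<alpha>))"
      by (simp add: cis_conv_exp flip: of_real_power)
    also have "\<dots> = - \<i> * of_real \<alpha>"
      using assms by (cases "\<alpha> > 0") (auto simp: complex_eq_iff sgn_if)
    finally show "w\<^sup>2 = - \<i> * of_real \<alpha>" .
    have "w = of_real (sqrt \<bar>\<alpha>\<bar>) * cis (- (pi / 4 * sgn \<alpha>))"
      by (simp only: w_def cis_conv_exp)
    then show "0 < Re w \<or> Re w = 0 \<and> 0 \<le> Im w"
      using assms by (auto simp: sgn_if cos_45)
  qed
  moreover have "w * exp (\<i> * of_real (pi / 4 * sgn \<alpha>)) = of_real (sqrt \<bar>\<alpha>\<bar>)"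
    by (simp add: w_def mult.assoc flip: exp_add)
  moreover have "w \<noteq> 0" "complex_of_real (sqrt \<bar>\<alpha>\<bar>) \<noteq> 0"
    using assms by (simp_all add: w_def)
  ultimately show ?thesis
    by (subst frac_eq_eq) (simp_all add: mult.commute)
qed

subsection \<open>Extension from the half-line and conclusion\<close>

text \<open>The polynomials chosen for different orders need not coincide, but uniqueness makes
  their coefficients agree below the smaller order. The l-th coefficient can thus be read off at
  order l + 1.\<close>

lemma pexp_coeff_sequence:
  assumes u: "\<And>N. pexp N u"
  obtains d where "\<And>N. (\<lambda>k. u k - (\<Sum>l<N. d l * ik k ^ l)) \<in> O(\<lambda>k. ik k ^ N)"
proof -
  obtain p where p: "\<And>N. (\<lambda>k. u k - poly (p N) (ik k)) \<in> O(\<lambda>k. ik k ^ N)"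
    using u unfolding pexp_def by metis
  have consistent: "coeff (p N) l = coeff (p (Suc l)) l" if "l < N" for N l
  proof -
    have "(\<lambda>k. u k - poly (p N) (ik k)) \<in> O(\<lambda>k. ik k ^ Suc l)"
      using that by (intro landau_o.big_trans[OF p] ik_power_mono) simp
    from sum_in_bigo(2)[OF p[of "Suc l"] this]
    have "(\<lambda>k. poly (p N - p (Suc l)) (ik k)) \<in> O(\<lambda>k. ik k ^ Suc l)"
      by simp
    from poly_ik_bigo_imp_coeff_0[OF this, of l] show ?thesis by simp
  qed
  show ?thesis
  proof (rule that[of "\<lambda>l. coeff (p (Suc l)) l"])
    fix N
    have split: "poly (p N) x = (\<Sum>l<N. coeff (p N) l * x ^ l) + x ^ N * poly (poly_shift N (p N)) x" for x
    proof -
      have "p N = poly_cutoff N (p N) + monom 1 N * poly_shift N (p N)"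
        by (intro poly_eqI) (auto simp: coeff_poly_cutoff coeff_monom_mult coeff_poly_shift)
      then have "poly (p N) x = poly (poly_cutoff N (p N)) x + x ^ N * poly (poly_shift N (p N)) x"
        by (metis poly_add poly_monom poly_mult mult_1)
      also have "poly_cutoff N (p N) = (\<Sum>l<N. monom (coeff (p N) l) l)"
        by (intro poly_eqI) (simp add: coeff_poly_cutoff coeff_sum sum.delta)
      finally show ?thesis by (simp add: poly_sum poly_monom)
    qed
    have "(\<lambda>k. ik k ^ N * poly (poly_shift N (p N)) (ik k)) \<in> O(\<lambda>k. ik k ^ N * 1)"
      by (intro landau_o.big.mult landau_o.big_refl poly_ik_bigo)
    note sum_in_bigo(1)[OF p[of N] this[unfolded mult_1_right]]
    moreover have "x - (s + t) + t = x - s" for x s t :: complex by simp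
    ultimately have "(\<lambda>k. u k - (\<Sum>l<N. coeff (p N) l * ik k ^ l)) \<in> O(\<lambda>k. ik k ^ N)"
      by (simp only: split)
    moreover have "(\<Sum>l<N. coeff (p N) l * ik k ^ l) = (\<Sum>l<N. coeff (p (Suc l)) l * ik k ^ l)" for k
      by (rule sum.cong) (use consistent in \<open>metis lessThan_iff\<close>)+
    ultimately show "(\<lambda>k. u k - (\<Sum>l<N. coeff (p (Suc l)) l * ik k ^ l)) \<in> O(\<lambda>k. ik k ^ N)"
      by (simp only:)
  qed
qed

text \<open>The leading term forces the first n coefficients to vanish and the next one to be a0.
  Shifting the index by n turns the prefactor k^(s+n) into k^s, and dividing by A matches the factor
  displayed in front of the series.\<close>

lemma has_expansion_of_pexp:
  assumes u: "\<And>N. pexp N u" and lead: "(\<lambda>k. u k - a0 * ik k ^ n) \<in> O(\<lambda>k. ik k ^ (n + 1))"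
    and a: "\<And>k. k > 0 \<Longrightarrow> a k = of_real (real k powr (s + real n)) * u k" and "A \<noteq> 0"
  shows "\<exists>c. c 0 = a0 / A \<and> has_expansion a s A c"
proof -
  obtain d where d: "\<And>N. (\<lambda>k. u k - (\<Sum>l<N. d l * ik k ^ l)) \<in> O(\<lambda>k. ik k ^ N)"
    using pexp_coeff_sequence[OF u] by blast
  define p where "p = (\<Sum>l<n+1. monom (d l) l) - monom a0 n"
  have "(\<lambda>k. poly p (ik k)) \<in> O(\<lambda>k. ik k ^ (n + 1))"
    using sum_in_bigo(2)[OF lead d[of "n + 1"]]
    by (simp add: p_def poly_sum poly_monom del: sum.lessThan_Suc) 
  then have coeff_0: "coeff p l = 0" if "l < n + 1" for l
    using that by (rule poly_ik_bigo_imp_coeff_0)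
  have coeff_p: "coeff p l = d l - (if l = n then a0 else 0)" if "l < n + 1" for l
    using that by (auto simp: p_def coeff_sum sum.delta simp del: sum.lessThan_Suc)
  have d_low: "d l = 0" if "l < n" for l
    using that coeff_0[of l] coeff_p[of l] by simp
  have d_n: "d n = a0"
    using coeff_0[of n] coeff_p[of n] by simp
  have "has_expansion a s A (\<lambda>l. d (l + n) / A)"
    unfolding has_expansion_def
  proof
    fix N
    have "(\<lambda>k. of_real (real k powr (s + real n)) * (u k - (\<Sum>l<N+n. d l * ik k ^ l)))
        \<in> O(\<lambda>k. of_real (real k powr (s + real n)) * ik k ^ (N + n))"
      by (intro landau_o.big.mult_left d)
    also have "?this \<longleftrightarrow> (\<lambda>k. a k - of_real (real k powr s) * A * (\<Sum>l<N. of_real (real k powr - real l) * (d (l + n) / A)))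
        \<in> O(\<lambda>k. complex_of_real (real k powr (s - real N)))"
    proof (rule landau_o.big.cong_ex; rule eventually_mono[OF eventually_gt_at_top[of "0::nat"]])
      fix k :: nat assume k: "k > 0"
      have powr_ik: "of_real (real k powr (s + real n)) * ik k ^ (m + n) = of_real (real k powr (s - real m))" for m
      proof -
        have "ik k ^ (m + n) = of_real (real k powr - real (m + n))"
          using k by (simp only: powr_minus powr_realpow of_nat_0_less_iff of_real_inverse of_real_power of_real_of_nat_eq power_inverse)
        then show ?thesis
          by (simp flip: of_real_mult powr_add)
      qed
      show "of_real (real k powr (s + real n)) * ik k ^ (N + n) = complex_of_real (real k powr (s - real N))"
        by (rule powr_ik)
      have "(\<Sum>l<N+n. d l * ik k ^ l) = (\<Sum>l=0+n..<N+n. d l * ik k ^ l)"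
        by (rule sum.mono_neutral_right) (auto simp: d_low)
      also have "\<dots> = (\<Sum>l<N. d (l + n) * ik k ^ (l + n))"
        by (subst sum.shift_bounds_nat_ivl) (simp add: lessThan_atLeast0)
      finally have "of_real (real k powr (s + real n)) * (\<Sum>l<N+n. d l * ik k ^ l) =
          (\<Sum>l<N. d (l + n) * (of_real (real k powr (s + real n)) * ik k ^ (l + n)))"
        by (simp only: sum_distrib_left mult_ac)
      also have "\<dots> = (\<Sum>l<N. of_real (real k powr s) * A * (of_real (real k powr - real l) * (d (l + n) / A)))"
        unfolding powr_ik using \<open>A \<noteq> 0\<close> by (intro sum.cong) (simp_all add: powr_diff powr_minus divide_inverse mult_ac)
      also have "\<dots> = of_real (real k powr s) * A * (\<Sum>l<N. of_real (real k powr - real l) * (d (l + n) / A))"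
        by (rule sum_distrib_left[symmetric])
      finally show "of_real (real k powr (s + real n)) * (u k - (\<Sum>l<N+n. d l * ik k ^ l)) =
         a k - of_real (real k powr s) * A * (\<Sum>l<N. of_real (real k powr - real l) * (d (l + n) / A))"
        by (simp only: right_diff_distrib a[OF k])
    qed
    finally show "(\<lambda>k. a k - of_real (real k powr s) * A * (\<Sum>l<N. of_real (real k powr - real l) * (d (l + n) / A)))
        \<in> O(\<lambda>k. complex_of_real (real k powr (s - real N)))" .
  qed
  with d_n show ?thesis by (intro exI[of _ "\<lambda>l. d (l + n) / A"]) simp
qed

section \<open>Passage from the half-line to the line\<close>

lemma smooth_of_derivative_sequence:
  assumes "\<And>j x. (D j has_vector_derivative D (Suc j) x) (at x)"
  shows "smooth (D 0)"
proof -
  have eq: "(vd ^^ j) (D 0) = D j" for j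
    by (induction j) (auto intro: vd_eq assms)
  show ?thesis
    unfolding smooth_def eq using assms by (blast intro: differentiableI_vector)
qed

lemma has_vector_derivative_from_both_sides:
  assumes "x \<ge> 0 \<Longrightarrow> (f has_vector_derivative f') (at x within {0..})"
    and "x \<le> 0 \<Longrightarrow> (f has_vector_derivative f') (at x within {..0})"
  shows "(f has_vector_derivative f') (at (x::real))"
proof (cases x "0::real" rule: linorder_cases)
  case less
  then have "at x within {..0} = at x" by (intro at_within_interior) simp
  then show ?thesis using assms(2) less by simp
next
  case greater
  then have "at x within {0..} = at x" by (intro at_within_interior) simp
  then show ?thesis using assms(1) greater by simp
next
  case equal
  have "at x within {0..} \<union> {..0} = at x"
    by (metis UNIV_I ivl_disj_un_singleton(2) le_cases sup_commute top.extremum_uniqueI atLeast_iff atMost_iff Un_iff subsetI)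
  then show ?thesis
    using assms equal unfolding has_vector_derivative_def has_derivative_within
    by (metis (no_types, lifting) at_within_union filterlim_sup order_refl)
qed

text \<open>The extension \<open>x \<mapsto> \<sigma> f (- x)\<close> to the left is smooth at the origin because the derivatives
  of \<open>f\<close> of the wrong parity vanish there.\<close>

lemma halfline_smooth_extension:
  assumes f: "smooth_halfline f" and \<sigma>: "\<sigma> = 1 \<or> \<sigma> = - 1"
    and parity: "\<And>j. \<sigma> * (- 1) ^ j = - 1 \<Longrightarrow> halfline_deriv j f 0 = 0"
  obtains F where "smooth F" "has_parity \<sigma> F" "\<And>x. x \<ge> 0 \<Longrightarrow> F x = f x"
proof -
  define s where "s = (\<lambda>j. \<sigma> * (- 1) ^ j)"
  define D where "D = (\<lambda>j x. if x \<ge> 0 then halfline_deriv j f x else s j * halfline_deriv j f (- x))"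
  have s: "s j = 1 \<or> s j = - 1" for j
    using \<sigma> by (cases "even j") (auto simp: s_def)
  have at0: "s j * halfline_deriv j f 0 = halfline_deriv j f 0" for j
    using s[of j] parity[of j] by (auto simp: s_def)
  have D_neg: "D j x = s j * halfline_deriv j f (- x)" if "x \<le> 0" for j x
    using that at0[of j] by (cases "x = 0") (auto simp: D_def)
  have deriv: "(halfline_deriv j f has_vector_derivative halfline_deriv (Suc j) f x) (at x within {0..})" if "x \<ge> 0" for j x
    using f that by (auto simp: smooth_halfline_def differentiable_on_def halfline_deriv_def vector_derivative_works)
  have "(D j has_vector_derivative D (Suc j) x) (at x)" for j x
  proof (rule has_vector_derivative_from_both_sides)
    assume "x \<ge> 0"
    then show "(D j has_vector_derivative D (Suc j) x) (at x within {0..})"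
      using has_vector_derivative_transform[OF _ _ deriv[of x j], of "D j"] by (simp add: D_def)
  next
    assume x: "x \<le> 0"
    have "((\<lambda>x. - x) has_vector_derivative - 1) (at x within {..0})"
      by (rule derivative_eq_intros refl)+
    moreover have "uminus ` {..0} = {0::real..}" by auto
    ultimately have "(halfline_deriv j f \<circ> uminus has_vector_derivative - 1 *\<^sub>R halfline_deriv (Suc j) f (- x)) (at x within {..0})"
      using deriv[of "- x" j] x by (intro vector_diff_chain_within) auto
    then have "((\<lambda>x. s j * halfline_deriv j f (- x)) has_vector_derivative s j * (- halfline_deriv (Suc j) f (- x))) (at x within {..0})"
      by (intro has_vector_derivative_mult_right) (simp add: o_def)
    moreover have "s j * (- halfline_deriv (Suc j) f (- x)) = D (Suc j) x"
      using D_neg[OF x, of "Suc j"] by (simp add: s_def)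
    ultimately show "(D j has_vector_derivative D (Suc j) x) (at x within {..0})"
      using has_vector_derivative_transform[of x "{..0}" "D j" "\<lambda>x. s j * halfline_deriv j f (- x)"] x D_neg by auto
  qed
  then have "smooth (D 0)" by (rule smooth_of_derivative_sequence)
  moreover have D0: "D 0 x = f x" if "x \<ge> 0" for x using that by (simp add: D_def halfline_deriv_def)
  moreover have "has_parity \<sigma> (D 0)"
  proof -
    have "\<sigma> * \<sigma> = 1" using \<sigma> by auto
    have "D 0 (- x) = \<sigma> * D 0 x" for x
    proof (cases "x \<ge> 0")
      case True
      then show ?thesis using D_neg[of "- x" 0] D0[of x] by (simp add: s_def halfline_deriv_def)
    next
      case False
      then have "D 0 x = \<sigma> * D 0 (- x)" using D_neg[of x 0] D0[of "- x"] by (simp add: s_def halfline_deriv_def)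
      then show ?thesis using \<open>\<sigma> * \<sigma> = 1\<close> by (simp flip: mult.assoc)
    qed
    then show ?thesis by (simp add: has_parity_def)
  qed
  ultimately show ?thesis using that by blast
qed

text \<open>A compact set inside a half-open interval has a largest element, which yields the strict
  gap required for division by the sine.\<close>

lemma halfline_support_bound:
  assumes "compact (halfline_support f)" "halfline_support f \<subseteq> {0..<R}" "R > 0"
  obtains b where "0 \<le> b" "b < R" "\<And>x. x > b \<Longrightarrow> f x = 0"
proof -
  have sub: "x \<in> halfline_support f" if "x \<ge> 0" "f x \<noteq> 0" for x
    using that closure_subset[of "{x \<in> {0..}. f x \<noteq> 0}"] unfolding halfline_support_def by auto
  show ?thesis
  proof (cases "halfline_support f = {}")
    case True
    then show ?thesis using that[of 0] sub \<open>R > 0\<close> by fastforce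
  next
    case False
    obtain b where b: "b \<in> halfline_support f" "\<And>y. y \<in> halfline_support f \<Longrightarrow> y \<le> b"
      using compact_attains_sup[OF assms(1) False] by blast
    then have "0 \<le> b" "b < R" using assms(2) by auto
    moreover have "f x = 0" if "x > b" for x
      using b(2)[of x] sub[of x] that \<open>0 \<le> b\<close> by fastforce
    ultimately show ?thesis using that by blast
  qed
qed

lemma leading_term_along_ik:
  assumes "(\<lambda>x. f x - lam * of_real (x ^ m)) \<in> O[at 0 within {0..}](\<lambda>x. complex_of_real (x ^ (m + 1)))"
    and F: "\<And>x. x \<ge> 0 \<Longrightarrow> F x = f x"
  shows "(\<lambda>k. F (1 / real k) - lam * ik k ^ m) \<in> O(\<lambda>k. ik k ^ Suc m)"
proof -
  have "filterlim (\<lambda>k. 1 / real k) (at 0 within {0..}) sequentially"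
    unfolding filterlim_at using lim_inverse_n[where 'a = real] eventually_gt_at_top[of "0::nat"]
    by (auto simp: inverse_eq_divide elim: eventually_mono)
  from landau_o.big.compose[OF assms(1) this]
  show ?thesis by (simp add: F inverse_eq_divide power_divide)
qed

lemma S_plus_eq_trapezoid_sum:
  assumes "\<And>x. x \<ge> 0 \<Longrightarrow> F x = f x"
  shows "S_plus \<alpha> f = (\<lambda>k. F 0 / 2 + lattice_sum \<alpha> F 1 k)"
  using assms by (simp add: S_plus_def[abs_def] lattice_sum_def chirp_def add.commute)

theorem theorem4p6:
  fixes \<alpha> :: real and f :: "real \<Rightarrow> complex" and n :: nat and lam :: complex
  assumes "\<alpha> \<noteq> 0"
    and "f \<in> smooth_compact_halfline"
    and "halfline_support f \<subseteq> {0..<2 * pi / \<bar>\<alpha>\<bar>}"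
  shows "(even_at_origin f \<and>
          (\<lambda>x. f x - lam * of_real (x ^ (2 * n))) \<in> O[at 0 within {0..}](\<lambda>x. of_real (x ^ (2 * n + 1)))
          \<longrightarrow> (\<exists>c :: nat \<Rightarrow> complex.
                c 0 = (\<i> / (2 * of_real \<alpha>)) ^ n * (fact (2 * n) / fact n) * lam \<and>
                has_expansion (S_plus \<alpha> f) (1 / 2 - real n)
                  (of_real (sqrt (pi / (2 * \<bar>\<alpha>\<bar>))) * exp (\<i> * of_real (pi / 4 * sgn \<alpha>))) c))
       \<and> (odd_at_origin f \<and>
          (\<lambda>x. f x - lam * of_real (x ^ (2 * n + 1))) \<in> O[at 0 within {0..}](\<lambda>x. of_real (x ^ (2 * n + 2)))
          \<longrightarrow> (\<exists>c :: nat \<Rightarrow> complex.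
                c 0 = (2 * \<i> / of_real \<alpha>) ^ (n + 1) * (fact n / 2) * lam \<and>
                has_expansion (S_plus \<alpha> f) (- real n) 1 c))"
proof -
  have f: "smooth_halfline f" "compact (halfline_support f)"
    using assms(2) by (auto simp: smooth_compact_halfline_def)
  obtain b where b: "0 \<le> b" "b < 2 * pi / \<bar>\<alpha>\<bar>" and f_zero: "\<And>x. x > b \<Longrightarrow> f x = 0"
    using halfline_support_bound[OF f(2) assms(3)] assms(1) by auto
  interpret resolved \<alpha> b
    by unfold_locales (use assms(1) b in auto)
  have supp: "supp_in b F" if F: "has_parity \<sigma> F" "\<And>x. x \<ge> 0 \<Longrightarrow> F x = f x" for \<sigma> F
    unfolding supp_in_def
  proof (intro allI impI)
    fix x assume x: "\<bar>x\<bar> > b"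
    show "F x = 0"
    proof (cases "x \<ge> 0")
      case True
      then show ?thesis using x f_zero[of x] F(2) by simp
    next
      case False
      then have "F (- x) = 0" using x f_zero[of "- x"] F(2)[of "- x"] by simp
      then show ?thesis
        using F(1) unfolding has_parity_def by (metis minus_minus mult_zero_right)
    qed
  qed
  show ?thesis
  proof (intro conjI impI; elim conjE)
    assume even: "even_at_origin f"
      and lead: "(\<lambda>x. f x - lam * of_real (x ^ (2 * n))) \<in> O[at 0 within {0..}](\<lambda>x. of_real (x ^ (2 * n + 1)))"
    obtain F where F: "smooth F" "has_parity 1 F" "\<And>x. x \<ge> 0 \<Longrightarrow> F x = f x"
    proof (rule halfline_smooth_extension[OF f(1), of 1])
      show "halfline_deriv j f 0 = 0" if "1 * (- 1) ^ j = (- 1 :: complex)" for j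
        using even that by (cases "Parity.even j") (auto simp: even_at_origin_def taylor_coeff_origin_def)
    qed auto
    have F_supp: "supp_in b F" using supp F(2,3) by blast
    \<comment> \<open>The extra factor is 1 + O(x) at the origin, so \<open>H\<close> has the same
      leading term as \<open>F\<close>.\<close>
    define H where "H = (\<lambda>x. F x * exp (of_real x ^ 2 * (1 / 2)))"
    have e_smooth: "smooth (\<lambda>x. exp (of_real x ^ 2 * (1 / 2)))"
      by (intro smooth_mult smooth_exp smooth_power smooth_of_real smooth_const)
    have "smooth H" unfolding H_def by (intro smooth_mult e_smooth F)
    have 1: "(\<lambda>k. F (1 / real k) - lam * ik k ^ (2 * n)) \<in> O(\<lambda>k. ik k ^ Suc (2 * n))"
      by (rule leading_term_along_ik[OF lead F(3)])
    have 2: "(\<lambda>k. exp (of_real (1 / real k) ^ 2 * (1 / 2)) - 1) \<in> O(ik)"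
      using smooth_taylor_ik[OF e_smooth, of 1 1] by simp
    have "(\<lambda>k. exp (of_real (1 / real k) ^ 2 * (1 / 2)) * (F (1 / real k) - lam * ik k ^ (2 * n)) +
       lam * ((exp (of_real (1 / real k) ^ 2 * (1 / 2)) - 1) * ik k ^ (2 * n))) \<in> O(\<lambda>k. ik k ^ Suc (2 * n))"
    proof (rule sum_in_bigo(1))
      show "(\<lambda>k. exp (of_real (1 / real k) ^ 2 * (1 / 2)) * (F (1 / real k) - lam * ik k ^ (2 * n))) \<in> O(\<lambda>k. ik k ^ Suc (2 * n))"
        using landau_o.big.mult[OF pexp_bigo[OF pexp_smooth[OF e_smooth, of 0 1]] 1] by (simp only: mult_1)
      show "(\<lambda>k. lam * ((exp (of_real (1 / real k) ^ 2 * (1 / 2)) - 1) * ik k ^ (2 * n))) \<in> O(\<lambda>k. ik k ^ Suc (2 * n))"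
        using landau_o.big.mult[OF bigo_const[of lam sequentially] landau_o.big.mult[OF 2 landau_o.big_refl[of "\<lambda>k. ik k ^ (2 * n)"]]]
        by (simp only: mult_1 power_Suc)
    qed
    moreover have "e * (F' - lam * i) + lam * ((e - 1) * i) = F' * e - lam * i" for e F' i
      by (simp add: algebra_simps)
    ultimately have "(\<lambda>k. H (1 / real k) - lam * ik k ^ (2 * n)) \<in> O(\<lambda>k. ik k ^ Suc (2 * n))"
      by (simp only: H_def)
    note taylor = taylor_of_leading_term[OF \<open>smooth H\<close> this]
    define A where "A = of_real (sqrt (pi / (2 * \<bar>\<alpha>\<bar>))) * exp (\<i> * of_real (pi / 4 * sgn \<alpha>))"
    have A: "A = of_real (sqrt (2 * pi) / 2) * inv_root 0"
    proof -
      have "sqrt (pi / (2 * \<bar>\<alpha>\<bar>)) = sqrt (2 * pi / (2\<^sup>2 * \<bar>\<alpha>\<bar>))" by simp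
      also have "\<dots> = sqrt (2 * pi) / 2 / sqrt \<bar>\<alpha>\<bar>"
        unfolding real_sqrt_divide real_sqrt_mult by simp
      finally have "sqrt (pi / (2 * \<bar>\<alpha>\<bar>)) = sqrt (2 * pi) / 2 / sqrt \<bar>\<alpha>\<bar>" .
      then show ?thesis
        using inverse_csqrt_imaginary[OF assms(1)] by (simp add: A_def inv_root_def)
    qed
    \<comment> \<open>1/(-i\<alpha>) = i/\<alpha>. The power 2n + 1 of the root splits into one
      factor belonging to \<open>A\<close> and (i/\<alpha>)^n; with the 2^n n! of the phase steps
      this gives (i/(2\<alpha>))^n / n!.\<close>
    have inv_root_0: "inv_root 0 ^ 2 = \<i> / of_real \<alpha>"
    proof -
      have "inv_root 0 ^ 2 = 1 / (- \<i> * of_real \<alpha>)" by (simp add: inv_root_def power_divide)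
      also have "\<dots> = \<i> / of_real \<alpha>" using assms(1) by (simp add: field_simps)
      finally show ?thesis .
    qed
    have "A \<noteq> 0" using assms(1) by (simp add: A_def)
    let ?a0 = "of_real (sqrt (2 * pi) / 2) * inv_root 0 ^ (2 * n + 1) * (vd ^^ (2 * n)) H 0 / (2 ^ n * fact n)"
    have "\<exists>c. c 0 = ?a0 / A \<and> has_expansion (S_plus \<alpha> f) (1 / 2 - real n) A c"
    proof (rule has_expansion_of_pexp[OF pexp_normalized_sum[OF F(1) F_supp F(2)] _ _ \<open>A \<noteq> 0\<close>])
      show "(\<lambda>k. normalized_sum F k - ?a0 * ik k ^ n) \<in> O(\<lambda>k. ik k ^ (n + 1))"
        unfolding H_def by (rule normalized_sum_leading_term[OF F(1) F_supp F(2)]) (rule taylor(1)[unfolded H_def])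
      show "S_plus \<alpha> f k = of_real (real k powr (1 / 2 - real n + real n)) * normalized_sum F k" if "k > 0" for k
        using that by (simp add: S_plus_eq_trapezoid_sum[OF F(3)] normalized_sum_def trapezoid_sum_def powr_half_sqrt)
    qed
    moreover have "?a0 / A = (\<i> / (2 * of_real \<alpha>)) ^ n * (fact (2 * n) / fact n) * lam"
    proof -
      have "?a0 = A * ((inv_root 0 ^ 2) ^ n * (vd ^^ (2 * n)) H 0 / (2 ^ n * fact n))"
        by (simp add: A power_add power_mult[symmetric])
      then have "?a0 / A = (\<i> / of_real \<alpha>) ^ n * (fact (2 * n) * lam) / (2 ^ n * fact n)"
        using \<open>A \<noteq> 0\<close> by (simp only: inv_root_0 taylor(2)) simp
      then show ?thesis by (simp add: power_divide power_mult_distrib mult_ac)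
    qed
    ultimately show "\<exists>c. c 0 = (\<i> / (2 * of_real \<alpha>)) ^ n * (fact (2 * n) / fact n) * lam \<and>
        has_expansion (S_plus \<alpha> f) (1 / 2 - real n)
          (of_real (sqrt (pi / (2 * \<bar>\<alpha>\<bar>))) * exp (\<i> * of_real (pi / 4 * sgn \<alpha>))) c"
      by (simp only: A_def)
  next
    assume odd: "odd_at_origin f"
      and lead: "(\<lambda>x. f x - lam * of_real (x ^ (2 * n + 1))) \<in> O[at 0 within {0..}](\<lambda>x. of_real (x ^ (2 * n + 2)))"
    obtain F where F: "smooth F" "has_parity (- 1) F" "\<And>x. x \<ge> 0 \<Longrightarrow> F x = f x"
    proof (rule halfline_smooth_extension[OF f(1), of "- 1"])
      show "halfline_deriv j f 0 = 0" if "- 1 * (- 1) ^ j = (- 1 :: complex)" for j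
        using odd that by (cases "Parity.even j") (auto simp: odd_at_origin_def taylor_coeff_origin_def)
    qed auto
    have R: "resolved_odd F"
      using F supp unfolding resolved_odd_def by blast
    \<comment> \<open>The halved term at the origin disappears, so \<open>S_plus\<close> is the
      lattice sum itself.\<close>
    have "F 0 = 0" using F(2) by (auto simp: has_parity_def dest!: spec[of _ 0])
    have "(\<lambda>k. F (1 / real k) - lam * ik k ^ (2 * n + 1)) \<in> O(\<lambda>k. ik k ^ Suc (2 * n + 1))"
      using lead by (intro leading_term_along_ik[OF _ F(3)]) simp_all
    note taylor = taylor_of_leading_term[OF F(1) this]
    have "\<exists>c. c 0 = odd_const n * (vd ^^ (2 * n + 1)) F 0 / 1 \<and> has_expansion (S_plus \<alpha> f) (- real n) 1 c"
    proof (rule has_expansion_of_pexp[OF pexp_lattice_sum[OF R]])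
      show "(\<lambda>k. lattice_sum \<alpha> F 1 k - odd_const n * (vd ^^ (2 * n + 1)) F 0 * ik k ^ n) \<in> O(\<lambda>k. ik k ^ (n + 1))"
        by (rule lattice_sum_leading_term[OF R taylor(1)])
      show "S_plus \<alpha> f k = of_real (real k powr (- real n + real n)) * lattice_sum \<alpha> F 1 k" if "k > 0" for k
        using that \<open>F 0 = 0\<close> by (simp add: S_plus_eq_trapezoid_sum[OF F(3)])
    qed simp
    moreover have "odd_const n * (vd ^^ (2 * n + 1)) F 0 / 1 = (2 * \<i> / of_real \<alpha>) ^ (n + 1) * (fact n / 2) * lam"
      unfolding taylor(2) odd_const_def by (simp del: fact_Suc)
    ultimately show "\<exists>c. c 0 = (2 * \<i> / of_real \<alpha>) ^ (n + 1) * (fact n / 2) * lam \<and>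
        has_expansion (S_plus \<alpha> f) (- real n) 1 c"
      by (simp only:)
  qed
qed

end
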